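(* Assume that $\mathrm{Rank}(B_1)=d$ and that the matrix $$\int_0^T e^{-t(A_1+A_2)}(B_1+B_2)(B_1+B_2)^*\left(e^{-t(A_1+A_2)}\right)^*dt\in\mathbb{R}^{d\times d}$$ is invertible. Let $p>1$. Then the system $$dX(t)=\left(A_1X(t)+A_2\mathbb{E}[X(t)]+B_1u(t)+B_2\mathbb{E}[u(t)]\right)dt+C\,\mathbb{E}[X(t)]\,dW(t),\quad X(0)=x,$$ is exactly controllable to $\mathbb{L}^p_{\mathcal{F}_T}(\Omega;\mathbb{R}^d)$-targets by using $\mathcal{U}^p_r$-controls (where $\mathcal{U}^p_r\subset\mathcal{U}^p$): for every $x\in\mathbb{R}^d$ and every $\xi\in\mathbb{L}^p_{\mathcal{F}_T}(\Omega;\mathbb{R}^d)$ there exists $u\in\mathcal{U}^p_r$ such that the solution $X^{x,u}$ of the system with initial value $x$ and control $u$ satisfies $X^{x,u}(T)=\xi$, $\mathbb{P}$-a.s.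
   Context: Let $T>0$ be fixed and let $(\Omega,\mathcal{F},\mathbb{P})$ be a probability space endowed with a scalar standard Brownian motion $W$ and its natural filtration $\mathbb{F}=\{\mathcal{F}_t\}_{t\ge 0}$ augmented by all $\mathbb{P}$-null sets. Let $d,n\ge1$ be integers, $A_1,A_2,C\in\mathbb{R}^{d\times d}$ and $B_1,B_2\in\mathbb{R}^{d\times n}$ constant matrices; $^*$ denotes transpose. $\mathbb{L}^p_{\mathcal{F}_T}(\Omega;\mathbb{R}^d)$ is the space of $\mathcal{F}_T$-measurable $\mathbb{R}^d$-valued random variables $\xi$ with $\mathbb{E}[\|\xi\|^p]<\infty$. $\mathcal{U}^p$ is the set of $\mathbb{F}$-progressively measurable $\mathbb{R}^n$-valued controls $u$ on $[0,T]$ such that $\mathbb{E}\big[\big(\int_0^T\|B_1u(t)\|dt\big)^p\big]<\infty$ and $\int_0^T\|B_2\mathbb{E}[u(t)]\|dt<\infty$. $\mathcal{U}^p_r$ is the set of $\mathbb{F}$-progressively measurable $\mathbb{R}^n$-valued controls $u$ on $[0,T]$ such that $\int_0^T\left(\mathbb{E}[\|B_1u(t)\|^p]\right)^{1/p}dt<\infty$ and $\int_0^T\|B_2\mathbb{E}[u(t)]\|dt<\infty$. In both definitions $u(t)$ is understood to be integrable for a.e. $t$, so that $\mathbb{E}[u(t)]$ is defined. *)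

theory Defs
  imports "HOL-Probability.Probability"
begin

text \<open>Processes are functions of time first, and only their values at times
  \<open>t \<ge> 0\<close> (respectively \<open>0 \<le> t \<le> T\<close>) matter.\<close>

definition natural_filtration :: "'a measure \<Rightarrow> (real \<Rightarrow> 'a \<Rightarrow> real) \<Rightarrow> real \<Rightarrow> 'a measure" where
  "natural_filtration M W t =
     sigma (space M) {W s -` A \<inter> space M | s A. 0 \<le> s \<and> s \<le> t \<and> A \<in> sets borel}"

text \<open>\<open>M\<close> need not be complete; if it is, \<open>null_sets M\<close> contains all subsets of null sets.\<close>

definition augmented_filtration :: "'a measure \<Rightarrow> (real \<Rightarrow> 'a \<Rightarrow> real) \<Rightarrow> real \<Rightarrow> 'a measure" where
  "augmented_filtration M W t =
     sigma (space M) (sets (natural_filtration M W t) \<union> null_sets M)"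

definition standard_brownian_motion :: "'a measure \<Rightarrow> (real \<Rightarrow> 'a \<Rightarrow> real) \<Rightarrow> bool" where
  "standard_brownian_motion M W \<longleftrightarrow>
     (\<forall>t\<ge>0. W t \<in> borel_measurable M) \<and>
     (AE \<omega> in M. W 0 \<omega> = 0) \<and>
     (AE \<omega> in M. continuous_on {0..} (\<lambda>t. W t \<omega>)) \<and>
     (\<forall>s t. 0 \<le> s \<and> s < t \<longrightarrow>
        distributed M lborel (\<lambda>\<omega>. W t \<omega> - W s \<omega>) (normal_density 0 (sqrt (t - s))) \<and>
        prob_space.indep_set M (sets (natural_filtration M W s))
          {(\<lambda>\<omega>. W t \<omega> - W s \<omega>) -` A \<inter> space M | A. A \<in> sets borel})"

definition progressively_measurable ::
    "(real \<Rightarrow> 'a measure) \<Rightarrow> real \<Rightarrow> (real \<Rightarrow> 'a \<Rightarrow> 'b::euclidean_space) \<Rightarrow> bool" where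
  "progressively_measurable F T u \<longleftrightarrow>
     (\<forall>t\<in>{0..T}. (\<lambda>(s, \<omega>). u s \<omega>) \<in> borel_measurable (restrict_space borel {0..t} \<Otimes>\<^sub>M F t))"

text \<open>The data \<open>k, a, \<eta>\<close> encode the simple process with value \<open>\<eta> i\<close> on
  \<open>(a i, a (i + 1)]\<close> for \<open>i < k\<close>, where \<open>0 \<le> a 0 \<le> \<dots> \<le> a k \<le> t\<close>.\<close>

definition simple_data ::
    "(real \<Rightarrow> 'a measure) \<Rightarrow> real \<Rightarrow> nat \<Rightarrow> (nat \<Rightarrow> real) \<Rightarrow> (nat \<Rightarrow> 'a \<Rightarrow> 'b::euclidean_space) \<Rightarrow> bool" where
  "simple_data F t k a \<eta> \<longleftrightarrow>
     0 \<le> a 0 \<and> (\<forall>i<k. a i \<le> a (Suc i)) \<and> a k \<le> t \<and>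
     (\<forall>i<k. \<eta> i \<in> borel_measurable (F (a i)) \<and> bounded (\<eta> i ` space (F (a i))))"

definition simple_process ::
    "nat \<Rightarrow> (nat \<Rightarrow> real) \<Rightarrow> (nat \<Rightarrow> 'a \<Rightarrow> 'b::euclidean_space) \<Rightarrow> real \<Rightarrow> 'a \<Rightarrow> 'b" where
  "simple_process k a \<eta> s \<omega> = (\<Sum>i<k. indicator {a i<..a (Suc i)} s *\<^sub>R \<eta> i \<omega>)"

definition simple_integral ::
    "(real \<Rightarrow> 'a \<Rightarrow> real) \<Rightarrow> nat \<Rightarrow> (nat \<Rightarrow> real) \<Rightarrow> (nat \<Rightarrow> 'a \<Rightarrow> 'b::euclidean_space) \<Rightarrow> 'a \<Rightarrow> 'b" where
  "simple_integral W k a \<eta> \<omega> = (\<Sum>i<k. (W (a (Suc i)) \<omega> - W (a i) \<omega>) *\<^sub>R \<eta> i \<omega>)"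

text \<open>\<open>has_ito_integral M F W t H Y\<close> says that the Ito integral of \<open>H\<close> with respect to \<open>W\<close>
  over \<open>[0, t]\<close> is (a version of) \<open>Y\<close>. This is the \<open>L\<^sup>2\<close> theory; square integrability of
  \<open>H\<close> on \<open>[0, t] \<times> \<Omega>\<close> is forced by the existence of the approximating sequence.\<close>

definition has_ito_integral ::
    "'a measure \<Rightarrow> (real \<Rightarrow> 'a measure) \<Rightarrow> (real \<Rightarrow> 'a \<Rightarrow> real) \<Rightarrow> real \<Rightarrow>
     (real \<Rightarrow> 'a \<Rightarrow> 'b::euclidean_space) \<Rightarrow> ('a \<Rightarrow> 'b) \<Rightarrow> bool" where
  "has_ito_integral M F W t H Y \<longleftrightarrow>
     progressively_measurable F t H \<and> Y \<in> borel_measurable M \<and>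
     (\<exists>k a \<eta>. (\<forall>j. simple_data F t (k j) (a j) (\<eta> j)) \<and>
        (\<lambda>j. \<integral>\<^sup>+\<omega>. (\<integral>\<^sup>+s\<in>{0..t}. ennreal ((norm (simple_process (k j) (a j) (\<eta> j) s \<omega> - H s \<omega>))\<^sup>2)
               \<partial>lborel) \<partial>M) \<longlonglongrightarrow> 0 \<and>
        (\<lambda>j. \<integral>\<^sup>+\<omega>. ennreal ((norm (simple_integral W (k j) (a j) (\<eta> j) \<omega> - Y \<omega>))\<^sup>2) \<partial>M) \<longlonglongrightarrow> 0)"

text \<open>The ring structure of \<open>'a ^ 'd ^ 'd\<close> is componentwise in the library, so \<open>exp\<close> and
  \<open>^\<close> are not the matrix operations.\<close>

definition matrix_exp :: "real ^ 'd ^ 'd \<Rightarrow> real ^ 'd ^ 'd" where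
  "matrix_exp A = (\<Sum>k. (1 / fact k) *\<^sub>R (((\<lambda>B. A ** B) ^^ k) (mat 1)))"

definition Lp_rv :: "'a measure \<Rightarrow> 'a measure \<Rightarrow> real \<Rightarrow> ('a \<Rightarrow> 'b::euclidean_space) set" where
  "Lp_rv M G p = {\<xi>. \<xi> \<in> borel_measurable G \<and> integrable M (\<lambda>\<omega>. norm (\<xi> \<omega>) powr p)}"

text \<open>\<open>\<U>\<^sup>p\<close> and \<open>\<U>\<^sup>p\<^sub>r\<close>. Finiteness of each integral is expressed as integrability;
  measurability of the integrands already follows from progressive measurability.\<close>

definition controls ::
    "'a measure \<Rightarrow> (real \<Rightarrow> 'a measure) \<Rightarrow> real \<Rightarrow> real ^ 'n ^ 'd \<Rightarrow> real ^ 'n ^ 'd \<Rightarrow> real \<Rightarrow>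
     (real \<Rightarrow> 'a \<Rightarrow> real ^ 'n) set" where
  "controls M F T B1 B2 p =
     {u. progressively_measurable F T u \<and>
         (AE t in lborel. t \<in> {0..T} \<longrightarrow> integrable M (u t)) \<and>
         (AE \<omega> in M. set_integrable lborel {0..T} (\<lambda>t. norm (B1 *v u t \<omega>))) \<and>
         integrable M (\<lambda>\<omega>. (LINT t:{0..T}|lborel. norm (B1 *v u t \<omega>)) powr p) \<and>
         set_integrable lborel {0..T} (\<lambda>t. norm (B2 *v (LINT \<omega>|M. u t \<omega>)))}"

definition controls_r ::
    "'a measure \<Rightarrow> (real \<Rightarrow> 'a measure) \<Rightarrow> real \<Rightarrow> real ^ 'n ^ 'd \<Rightarrow> real ^ 'n ^ 'd \<Rightarrow> real \<Rightarrow>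
     (real \<Rightarrow> 'a \<Rightarrow> real ^ 'n) set" where
  "controls_r M F T B1 B2 p =
     {u. progressively_measurable F T u \<and>
         (AE t in lborel. t \<in> {0..T} \<longrightarrow> integrable M (u t)) \<and>
         (AE t in lborel. t \<in> {0..T} \<longrightarrow> integrable M (\<lambda>\<omega>. norm (B1 *v u t \<omega>) powr p)) \<and>
         set_integrable lborel {0..T} (\<lambda>t. (LINT \<omega>|M. norm (B1 *v u t \<omega>) powr p) powr (1 / p)) \<and>
         set_integrable lborel {0..T} (\<lambda>t. norm (B2 *v (LINT \<omega>|M. u t \<omega>)))}"

definition drift ::
    "'a measure \<Rightarrow> real ^ 'd ^ 'd \<Rightarrow> real ^ 'd ^ 'd \<Rightarrow> real ^ 'n ^ 'd \<Rightarrow> real ^ 'n ^ 'd \<Rightarrow>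
     (real \<Rightarrow> 'a \<Rightarrow> real ^ 'n) \<Rightarrow> (real \<Rightarrow> 'a \<Rightarrow> real ^ 'd) \<Rightarrow> real \<Rightarrow> 'a \<Rightarrow> real ^ 'd" where
  "drift M A1 A2 B1 B2 u X s \<omega> =
     A1 *v X s \<omega> + A2 *v (LINT \<omega>'|M. X s \<omega>') + B1 *v u s \<omega> + B2 *v (LINT \<omega>'|M. u s \<omega>')"

text \<open>Solutions are progressively measurable with almost surely continuous paths and satisfy
  \<open>E (sup\<^bsub>t \<le> T\<^esub> \<parallel>X t\<parallel>\<^sup>p) < \<infinity>\<close>; the equation is the usual integral equation. By path
  continuity it is immaterial that the exceptional null set may depend on \<open>t\<close>.\<close>

definition is_solution ::
    "'a measure \<Rightarrow> (real \<Rightarrow> 'a measure) \<Rightarrow> (real \<Rightarrow> 'a \<Rightarrow> real) \<Rightarrow> real \<Rightarrow>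
     real ^ 'd ^ 'd \<Rightarrow> real ^ 'd ^ 'd \<Rightarrow> real ^ 'n ^ 'd \<Rightarrow> real ^ 'n ^ 'd \<Rightarrow> real ^ 'd ^ 'd \<Rightarrow> real \<Rightarrow>
     real ^ 'd \<Rightarrow> (real \<Rightarrow> 'a \<Rightarrow> real ^ 'n) \<Rightarrow> (real \<Rightarrow> 'a \<Rightarrow> real ^ 'd) \<Rightarrow> bool" where
  "is_solution M F W T A1 A2 B1 B2 C p x u X \<longleftrightarrow>
     progressively_measurable F T X \<and>
     (AE \<omega> in M. continuous_on {0..T} (\<lambda>t. X t \<omega>)) \<and>
     (\<integral>\<^sup>+\<omega>. (SUP t\<in>{0..T}. ennreal (norm (X t \<omega>) powr p)) \<partial>M) < \<infinity> \<and>
     (AE \<omega> in M. set_integrable lborel {0..T} (\<lambda>s. drift M A1 A2 B1 B2 u X s \<omega>)) \<and>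
     (\<forall>t\<in>{0..T}. \<exists>Y. has_ito_integral M F W t (\<lambda>s \<omega>. C *v (LINT \<omega>'|M. X s \<omega>')) Y \<and>
        (AE \<omega> in M. X t \<omega> = x + (LINT s:{0..t}|lborel. drift M A1 A2 B1 B2 u X s \<omega>) + Y \<omega>))"

text \<open>``The solution with control \<open>u\<close> hits the target'' is rendered as: a solution exists, and
  every solution hits the target.\<close>

definition exactly_controllable ::
    "'a measure \<Rightarrow> (real \<Rightarrow> 'a measure) \<Rightarrow> (real \<Rightarrow> 'a \<Rightarrow> real) \<Rightarrow> real \<Rightarrow>
     real ^ 'd ^ 'd \<Rightarrow> real ^ 'd ^ 'd \<Rightarrow> real ^ 'n ^ 'd \<Rightarrow> real ^ 'n ^ 'd \<Rightarrow> real ^ 'd ^ 'd \<Rightarrow> real \<Rightarrow>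
     ('a \<Rightarrow> real ^ 'd) set \<Rightarrow> (real \<Rightarrow> 'a \<Rightarrow> real ^ 'n) set \<Rightarrow> bool" where
  "exactly_controllable M F W T A1 A2 B1 B2 C p targets U \<longleftrightarrow>
     (\<forall>x. \<forall>\<xi>\<in>targets. \<exists>u\<in>U.
        (\<exists>X. is_solution M F W T A1 A2 B1 B2 C p x u X) \<and>
        (\<forall>X. is_solution M F W T A1 A2 B1 B2 C p x u X \<longrightarrow> (AE \<omega> in M. X T \<omega> = \<xi> \<omega>)))"

end

theory Submission
  imports Defs
begin

text \<open>Write \<open>m = E X\<close> and \<open>Y = X - m\<close>. The mean solves a deterministic linear equation that is steered
  from \<open>x\<close> to \<open>E \<xi>\<close> by the Gramian. Since \<open>B1\<close> has a right inverse, a feedback turns the equation for \<open>Y\<close>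
  into \<open>dY = g dt + C m dW\<close> with an arbitrary adapted mean-zero \<open>g\<close>, so it remains to write the
  \<open>L\<^sup>p\<close> random variable \<open>\<zeta> = \<xi> - E \<xi> - (\<integral> C m dW)\<close> as \<open>\<integral> g dt\<close>. Because Brownian paths are continuous, the
  \<open>\<F>\<^sub>t\<close>-measurable variables with \<open>t < T\<close> are dense in \<open>L\<^sup>p(\<F>\<^sub>T)\<close>; writing \<open>\<zeta>\<close> as a rapidly converging
  telescoping sum of such variables and spreading each term over the time interval that follows the time
  at which it is known gives a step process \<open>g\<close> with \<open>\<integral> \<parallel>g\<parallel>\<^sub>p dt < \<infinity>\<close>. As \<open>m\<close> is continuously
  differentiable, the stochastic integral is treated by partial integration; uniqueness follows from the
  Ito isometry and a Gronwall argument, applied first to the means and then to the difference of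
  the solutions.\<close>

section \<open>Matrix exponential and the Gramian\<close>

text \<open>The class of controls is measured by a time integral of \<open>L^p\<close> norms. A
  variable known at some time can be spread evenly over any later interval, however short, at a cost
  equal to its own \<open>L^p\<close> norm; this is why the pieces may be pushed arbitrarily close
  to \<open>T\<close> and only summability of their norms matters. The feedback must not move the
  mean, since \<open>A2\<close>, \<open>B2\<close> and \<open>C\<close> all act on means; hence the
  approximating variables are recentred. The noise coefficient depends on the mean alone, so the
  noise is fixed as soon as the mean is, before the random part of the control is chosen. Two
  further bounds are forced by the definitions: moments of every order of the running maximum of
  Brownian motion, because the supremum of a solution must have a \<open>p\<close>-th moment, and a
  form of Minkowski's inequality, which passes from the time integral of \<open>L^p\<close> norms to
  the \<open>p\<close>-th moment of the time integral. Since paths are continuous and start at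
  \<open>0\<close> only almost surely, pathwise arguments are made for a modification
  \<open>V\<close> of \<open>W\<close>.\<close>

abbreviation mat_power :: "real ^ 'd ^ 'd \<Rightarrow> nat \<Rightarrow> real ^ 'd ^ 'd" where
  "mat_power A k \<equiv> ((\<lambda>B. A ** B) ^^ k) (mat 1)"

lemma mat_power_Suc2: "mat_power A (Suc k) = mat_power A k ** A"
  by (induction k) (simp_all add: matrix_mul_assoc)

lemma mat_power_scaleR: "mat_power (t *\<^sub>R A) k = t ^ k *\<^sub>R mat_power A k"
proof (induction k)
  case (Suc k)
  then show ?case
    by (simp add: scalar_matrix_assoc matrix_scalar_ac mult.commute)
qed simp

text \<open>Each further factor sums \<open>CARD('d)\<close> products of entries, and every entry of
  \<open>A\<close> is at most \<open>norm A\<close>. The growth is geometric in \<open>k\<close>,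
  which \<open>fact k\<close> beats.\<close>

lemma abs_mat_power_le: "\<bar>mat_power A k $ i $ j\<bar> \<le> (real CARD('d) * norm A) ^ k"
  for A :: "real ^ 'd ^ 'd"
proof (induction k arbitrary: i)
  case 0
  then show ?case by (simp add: mat_def)
next
  case (Suc k)
  have e: "\<bar>A $ a $ b\<bar> \<le> norm A" for a b :: 'd
    using order_trans[OF component_le_norm_cart Finite_Cartesian_Product.norm_nth_le] .
  have "\<bar>mat_power A (Suc k) $ i $ j\<bar> \<le> (\<Sum>l\<in>UNIV. \<bar>A $ i $ l * mat_power A k $ l $ j\<bar>)"
    by (simp add: matrix_matrix_mult_def)
  also have "\<dots> \<le> (\<Sum>l\<in>(UNIV::'d set). norm A * (real CARD('d) * norm A) ^ k)"
    unfolding abs_mult by (intro sum_mono mult_mono Suc e) auto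
  finally show ?case by (simp add: mult_ac)
qed

lemma summable_mat_power: "summable (\<lambda>k. mat_power A k $ i $ j / fact k * t ^ k)"
  for A :: "real ^ 'd ^ 'd"
proof (rule summable_comparison_test'[OF summable_exp[of "real CARD('d) * norm A * \<bar>t\<bar>"]])
  fix k
  have "norm (mat_power A k $ i $ j / fact k * t ^ k) \<le>
      (real CARD('d) * norm A) ^ k / fact k * \<bar>t\<bar> ^ k"
    using abs_mat_power_le[of k A i j] by (auto simp: abs_mult power_abs divide_simps intro!: mult_right_mono)
  then show "norm (mat_power A k $ i $ j / fact k * t ^ k) \<le>
      inverse (fact k) * (real CARD('d) * norm A * \<bar>t\<bar>) ^ k"
    by (simp add: field_simps power_mult_distrib)
qed

text \<open>Convergence of matrices is entrywise, so along the line \<open>t *\<^sub>R A\<close>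
  every entry is a real power series in \<open>t\<close>, and termwise differentiation of real power
  series applies.\<close>

lemma matrix_exp_nth: "matrix_exp (t *\<^sub>R A) $ i $ j = (\<Sum>k. mat_power A k $ i $ j / fact k * t ^ k)"
proof -
  let ?L = "\<chi> i j. \<Sum>k. mat_power A k $ i $ j / fact k * t ^ k"
  have "(\<lambda>k. (1 / fact k) *\<^sub>R mat_power (t *\<^sub>R A) k) sums ?L"
    unfolding sums_def
  proof (intro vec_tendstoI)
    fix i j
    show "(\<lambda>n. (\<Sum>k<n. (1 / fact k) *\<^sub>R mat_power (t *\<^sub>R A) k) $ i $ j) \<longlonglongrightarrow> ?L $ i $ j"
      using summable_LIMSEQ[OF summable_mat_power[of A i j t]]
      by (simp add: mat_power_scaleR field_simps)
  qed
  then show ?thesis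
    unfolding matrix_exp_def by (simp add: sums_unique[symmetric])
qed

lemma matrix_mult_nth: "(A ** B) $ i $ j = (\<Sum>l\<in>UNIV. A $ i $ l * B $ l $ j)"
  by (simp add: matrix_matrix_mult_def)

lemma has_vector_derivative_matrix_entrywise:
  fixes f :: "real \<Rightarrow> real ^ 'n ^ 'm"
  assumes "\<And>i j. ((\<lambda>t. f t $ i $ j) has_real_derivative D $ i $ j) (at t)"
  shows "(f has_vector_derivative D) (at t)"
  unfolding has_vector_derivative_def has_derivative_componentwise_within[of f]
  using assms
  by (auto simp: Basis_vec_def inner_axis has_field_derivative_def mult_commute_abs)

lemma bounded_bilinear_matrix_mult:
  "bounded_bilinear ((**) :: real ^ 'n ^ 'm \<Rightarrow> real ^ 'k ^ 'n \<Rightarrow> real ^ 'k ^ 'm)"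
  unfolding bilinear_conv_bounded_bilinear[symmetric] bilinear_def
proof (intro conjI allI linearI)
  fix x y :: "real ^ 'n ^ 'm" and z :: "real ^ 'k ^ 'n"
  show "(x + y) ** z = x ** z + y ** z"
    by (simp add: vec_eq_iff matrix_mult_nth distrib_right sum.distrib)
qed (simp_all only: matrix_add_ldistrib scalar_matrix_assoc matrix_scalar_ac)

lemma bounded_bilinear_matrix_vector_mult:
  "bounded_bilinear ((*v) :: real ^ 'n ^ 'm \<Rightarrow> real ^ 'n \<Rightarrow> real ^ 'm)"
  unfolding bilinear_conv_bounded_bilinear[symmetric] bilinear_def
  by (auto intro!: linearI simp: matrix_vector_right_distrib matrix_vector_mult_add_rdistrib
       scaleR_matrix_vector_assoc matrix_vector_mult_scaleR)

text \<open>\<open>A\<close> commutes with its powers, so the differentiated series can be factored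
  on either side. In \<open>matrix_exp_inverse\<close> both forms are used: the two terms of the
  product rule cancel with \<open>A\<close> standing between the factors.\<close>

lemma matrix_exp_has_vector_derivative:
  "((\<lambda>t. matrix_exp (t *\<^sub>R A)) has_vector_derivative A ** matrix_exp (t *\<^sub>R A)) (at t)"
  "((\<lambda>t. matrix_exp (t *\<^sub>R A)) has_vector_derivative matrix_exp (t *\<^sub>R A) ** A) (at t)"
proof -
  have d: "((\<lambda>t. matrix_exp (t *\<^sub>R A) $ i $ j) has_real_derivative
      (\<Sum>k. mat_power A (Suc k) $ i $ j / fact k * t ^ k)) (at t)" for i j
  proof -
    \<comment> \<open>The factor \<open>Suc k\<close> from differentiation cancels against
      \<open>fact (Suc k)\<close>.\<close>
    have "diffs (\<lambda>k. mat_power A k $ i $ j / fact k) = (\<lambda>k. mat_power A (Suc k) $ i $ j / fact k)"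
      unfolding diffs_def by (simp add: fun_eq_iff fact_Suc del: funpow.simps of_nat_Suc)
    then show ?thesis
      unfolding matrix_exp_nth
      using termdiffs_strong_converges_everywhere[OF summable_mat_power, of A i j t] by simp
  qed
  have "(\<Sum>k. mat_power A (Suc k) $ i $ j / fact k * t ^ k) = (A ** matrix_exp (t *\<^sub>R A)) $ i $ j" for i j
  proof -
    have "(\<Sum>k. mat_power A (Suc k) $ i $ j / fact k * t ^ k) =
        (\<Sum>k. \<Sum>l\<in>UNIV. A $ i $ l * (mat_power A k $ l $ j / fact k * t ^ k))"
      by (simp add: matrix_mult_nth sum_divide_distrib sum_distrib_right mult.assoc)
    also have "\<dots> = (\<Sum>l\<in>UNIV. A $ i $ l * (\<Sum>k. mat_power A k $ l $ j / fact k * t ^ k))"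
      by (simp only: suminf_sum[OF summable_mult[OF summable_mat_power]] suminf_mult[OF summable_mat_power])
    finally show ?thesis by (simp only: matrix_mult_nth matrix_exp_nth)
  qed
  with d show "((\<lambda>t. matrix_exp (t *\<^sub>R A)) has_vector_derivative A ** matrix_exp (t *\<^sub>R A)) (at t)"
    by (intro has_vector_derivative_matrix_entrywise) simp
  have "(\<Sum>k. mat_power A (Suc k) $ i $ j / fact k * t ^ k) = (matrix_exp (t *\<^sub>R A) ** A) $ i $ j" for i j
  proof -
    have "(\<Sum>k. mat_power A (Suc k) $ i $ j / fact k * t ^ k) =
        (\<Sum>k. \<Sum>l\<in>UNIV. mat_power A k $ i $ l / fact k * t ^ k * A $ l $ j)"
      unfolding mat_power_Suc2
      by (simp add: matrix_mult_nth sum_divide_distrib sum_distrib_right sum_distrib_left mult_ac)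
    also have "\<dots> = (\<Sum>l\<in>UNIV. (\<Sum>k. mat_power A k $ i $ l / fact k * t ^ k) * A $ l $ j)"
      by (simp only: suminf_sum[OF summable_mult2[OF summable_mat_power]] suminf_mult2[OF summable_mat_power])
    finally show ?thesis by (simp only: matrix_mult_nth matrix_exp_nth)
  qed
  with d show "((\<lambda>t. matrix_exp (t *\<^sub>R A)) has_vector_derivative matrix_exp (t *\<^sub>R A) ** A) (at t)"
    by (intro has_vector_derivative_matrix_entrywise) simp
qed

lemma matrix_exp_0: "matrix_exp 0 = mat 1"
proof -
  have "(\<Sum>k. (1 / fact k) *\<^sub>R mat_power (0::real^'a^'a) k) = (\<Sum>k\<in>{0}. (1 / fact k) *\<^sub>R mat_power 0 k)"
  proof (rule suminf_finite)
    fix k :: nat assume "k \<notin> {0}"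
    then show "(1 / fact k) *\<^sub>R mat_power (0::real^'a^'a) k = 0"
      by (cases k) (auto simp: matrix_matrix_mult_def vec_eq_iff)
  qed auto
  then show ?thesis by (simp add: matrix_exp_def)
qed

text \<open>The product has derivative zero in \<open>t\<close>, hence equals its value at
  \<open>0\<close>.\<close>

lemma matrix_exp_inverse: "matrix_exp (t *\<^sub>R A) ** matrix_exp ((- t) *\<^sub>R A) = mat 1"
proof -
  let ?f = "\<lambda>t. matrix_exp (t *\<^sub>R A) ** matrix_exp ((- t) *\<^sub>R A)"
  have 1: "((\<lambda>t. matrix_exp ((- t) *\<^sub>R A)) has_vector_derivative
      - (A ** matrix_exp ((- t) *\<^sub>R A))) (at t)" for t
    using vector_diff_chain_at[of uminus "-1" t "\<lambda>t. matrix_exp (t *\<^sub>R A)" "A ** matrix_exp ((- t) *\<^sub>R A)"]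
      matrix_exp_has_vector_derivative(1)[of A "- t"]
      has_vector_derivative_minus[OF has_vector_derivative_id[of "at t"]]
    by (simp add: o_def)
  have "(?f has_vector_derivative 0) (at t)" for t
    using bounded_bilinear.has_vector_derivative[OF bounded_bilinear_matrix_mult
        matrix_exp_has_vector_derivative(2)[of A t] 1[of t]]
    by (simp add: bounded_bilinear.minus_right[OF bounded_bilinear_matrix_mult] matrix_mul_assoc)
  then obtain c where "\<And>t. ?f t = c"
    by (rule has_vector_derivative_zero_constant[OF convex_UNIV]) auto
  then have "?f t = ?f 0" by metis
  then show ?thesis by (simp add: matrix_exp_0)
qed

text \<open>Variation of constants: \<open>\<Psi> t\<close> inverts \<open>\<Phi> t\<close>, so
  \<open>y\<close> is reached once the integral of \<open>\<Phi> s *v (B *v v s)\<close> equals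
  \<open>\<Phi> T *v y - x\<close>. A control made of the transposes of \<open>B\<close> and
  \<open>\<Phi> t\<close> applied to a constant \<open>z\<close> turns that integral into the
  Gramian applied to \<open>z\<close>, and \<open>z\<close> is found by inverting the
  Gramian.\<close>

lemma deterministic_controllability:
  fixes A :: "real ^ 'd ^ 'd" and B :: "real ^ 'n ^ 'd"
  assumes T: "T > 0"
    and inv: "invertible (integral {0..T} (\<lambda>t. matrix_exp ((- t) *\<^sub>R A) ** B ** transpose B
             ** transpose (matrix_exp ((- t) *\<^sub>R A))))"
  obtains v m where "continuous_on UNIV v" "m 0 = x" "m T = y"
    "\<And>t. t \<in> {0..T} \<Longrightarrow> (m has_vector_derivative (A *v m t + B *v v t)) (at t within {0..T})"
proof -
  define \<Phi> where "\<Phi> t = matrix_exp ((- t) *\<^sub>R A)" for t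
  define \<Psi> where "\<Psi> t = matrix_exp (t *\<^sub>R A)" for t
  define G where "G = integral {0..T} (\<lambda>t. \<Phi> t ** B ** transpose B ** transpose (\<Phi> t))"
  obtain G' where G': "G ** G' = mat 1"
    using inv by (auto simp: invertible_def G_def \<Phi>_def)
  define z where "z = G' *v (\<Phi> T *v y - x)"
  define v where "v t = transpose B *v (transpose (\<Phi> t) *v z)" for t
  define m where "m t = \<Psi> t *v (x + integral {0..t} (\<lambda>s. \<Phi> s *v (B *v v s)))" for t
  have c\<Psi>: "continuous_on S \<Psi>" for S
    unfolding \<Psi>_def
    by (intro continuous_at_imp_continuous_on ballI
        has_vector_derivative_continuous[OF matrix_exp_has_vector_derivative(1)])
  have c\<Phi>: "continuous_on S \<Phi>" for S
    using continuous_on_compose[of S uminus \<Psi>, OF _ c\<Psi>]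
    by (simp add: \<Phi>_def \<Psi>_def o_def continuous_on_minus)
  have lt: "linear (transpose :: real ^ 'a ^ 'b \<Rightarrow> real ^ 'b ^ 'a)"
    by (auto intro!: linearI simp: transpose_def vec_eq_iff)
  note cb = bounded_bilinear.continuous_on[OF bounded_bilinear_matrix_vector_mult]
    bounded_bilinear.continuous_on[OF bounded_bilinear_matrix_mult]
    linear_continuous_on_compose[OF _ lt]
  have cv: "continuous_on S v" for S
    unfolding v_def by (intro cb continuous_intros c\<Phi>)
  have ci: "continuous_on S (\<lambda>s. \<Phi> s *v (B *v v s))" for S
    by (intro cb continuous_intros c\<Phi> cv)
  have \<Psi>\<Phi>: "\<Psi> t ** \<Phi> t = mat 1" for t
    unfolding \<Psi>_def \<Phi>_def by (rule matrix_exp_inverse)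
  have d: "(m has_vector_derivative (A *v m t + B *v v t)) (at t within {0..T})"
    if t: "t \<in> {0..T}" for t
  proof -
    have "((\<lambda>t. x + integral {0..t} (\<lambda>s. \<Phi> s *v (B *v v s))) has_vector_derivative
        0 + \<Phi> t *v (B *v v t)) (at t within {0..T})"
      by (intro has_vector_derivative_add integral_has_vector_derivative ci t) auto
    from bounded_bilinear.has_vector_derivative[OF bounded_bilinear_matrix_vector_mult
        has_vector_derivative_at_within[OF matrix_exp_has_vector_derivative(1)[of A t]] this]
    show ?thesis
      unfolding m_def \<Psi>_def[symmetric]
      by (simp add: matrix_vector_mul_assoc matrix_mul_assoc \<Psi>\<Phi> add.commute)
  qed
  have gint: "(\<lambda>t. \<Phi> t ** B ** transpose B ** transpose (\<Phi> t)) integrable_on {0..T}"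
    by (intro integrable_continuous_real cb continuous_intros c\<Phi>)
  have bl: "bounded_linear (\<lambda>P. P *v z)"
    by (rule bounded_bilinear.bounded_linear_left[OF bounded_bilinear_matrix_vector_mult])
  have "integral {0..T} (\<lambda>s. \<Phi> s *v (B *v v s)) = G *v z"
    unfolding G_def integral_linear[OF gint bl, symmetric]
    by (simp add: v_def o_def matrix_vector_mul_assoc matrix_mul_assoc del: transpose_matrix_vector)
  also have "\<dots> = \<Phi> T *v y - x"
    by (simp add: z_def matrix_vector_mul_assoc G')
  finally have "m T = y"
    by (simp add: m_def matrix_vector_mul_assoc \<Psi>\<Phi>)
  moreover have "m 0 = x"
    by (simp add: m_def \<Psi>_def matrix_exp_0)
  ultimately show thesis using that d cv by blast
qed

section \<open>Brownian increments\<close>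

lemma space_augmented_filtration [simp]: "space (augmented_filtration M W t) = space M"
  by (simp add: augmented_filtration_def space_measure_of_conv)

lemma space_natural_filtration [simp]: "space (natural_filtration M W t) = space M"
  by (simp add: natural_filtration_def space_measure_of_conv)

lemma sets_natural_filtration:
  "sets (natural_filtration M W t) =
     sigma_sets (space M) {W s -` A \<inter> space M | s A. 0 \<le> s \<and> s \<le> t \<and> A \<in> sets borel}"
  by (auto simp: natural_filtration_def intro!: sets_measure_of)

lemma sets_augmented_filtration:
  "sets (augmented_filtration M W t) =
     sigma_sets (space M) (sets (natural_filtration M W t) \<union> null_sets M)"
  unfolding augmented_filtration_def
  by (rule sets_measure_of) (use sets.sets_into_space[of _ "natural_filtration M W t"] sets.sets_into_space[of _ M] in auto)

lemma null_sets_augmented_filtration: "N \<in> null_sets M \<Longrightarrow> N \<in> sets (augmented_filtration M W t)"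
  unfolding sets_augmented_filtration by auto

lemma sets_natural_filtration_mono:
  "s \<le> t \<Longrightarrow> sets (natural_filtration M W s) \<subseteq> sets (natural_filtration M W t)"
  unfolding sets_natural_filtration by (intro sigma_sets_mono') (auto; metis order_trans)

lemma sets_augmented_filtration_mono:
  "s \<le> t \<Longrightarrow> sets (augmented_filtration M W s) \<subseteq> sets (augmented_filtration M W t)"
  unfolding sets_augmented_filtration using sets_natural_filtration_mono[of s t M W]
  by (intro sigma_sets_mono') auto

lemma measurable_augmented_filtration_mono:
  "f \<in> measurable (augmented_filtration M W s) N \<Longrightarrow> s \<le> t \<Longrightarrow> f \<in> measurable (augmented_filtration M W t) N"
  using sets_augmented_filtration_mono[of s t M W] by (auto simp: measurable_def)

locale brownian = prob_space M for M :: "'a measure" +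
  fixes W :: "real \<Rightarrow> 'a \<Rightarrow> real"
  assumes bm: "standard_brownian_motion M W"
begin

abbreviation "F \<equiv> augmented_filtration M W"

lemma W_measurable: "0 \<le> t \<Longrightarrow> W t \<in> borel_measurable M"
  using bm by (auto simp: standard_brownian_motion_def)

lemma W_distributed: "0 \<le> s \<Longrightarrow> s < t \<Longrightarrow>
    distributed M lborel (\<lambda>\<omega>. W t \<omega> - W s \<omega>) (normal_density 0 (sqrt (t - s)))"
  using bm by (auto simp: standard_brownian_motion_def)

lemma sets_natural_subset: "sets (natural_filtration M W t) \<subseteq> sets M"
  unfolding sets_natural_filtration using W_measurable
  by (auto intro!: sets.sigma_sets_subset)

lemma sets_F_subset: "sets (F t) \<subseteq> sets M"
  unfolding sets_augmented_filtration using sets_natural_subset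
  by (intro sets.sigma_sets_subset) auto

lemma measurable_F: "f \<in> measurable (F t) N \<Longrightarrow> f \<in> measurable M N"
  using sets_F_subset[of t] by (auto simp: measurable_def)

lemma W_adapted: "0 \<le> s \<Longrightarrow> s \<le> t \<Longrightarrow> W s \<in> borel_measurable (F t)"
  by (rule measurableI)
    (auto simp: sets_augmented_filtration sets_natural_filtration intro!: sigma_sets.Basic)

text \<open>The sets with an almost surely equal partner in the natural filtration are closed under
  complements and countable unions and contain the null sets, whose partner is the empty set. This
  lets independence, postulated for the natural filtration, pass to the augmented one.\<close>

lemma F_AE_eq_natural:
  assumes "A \<in> sets (F t)"
  shows "\<exists>A'\<in>sets (natural_filtration M W t). AE \<omega> in M. \<omega> \<in> A \<longleftrightarrow> \<omega> \<in> A'"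
  using assms unfolding sets_augmented_filtration
proof (induction rule: sigma_sets.induct)
  case (Basic A)
  then consider "A \<in> sets (natural_filtration M W t)" | "A \<in> null_sets M" by auto
  then show ?case
  proof cases
    case 1
    then show ?thesis by (intro bexI[of _ A]) auto
  next
    case 2
    then show ?thesis by (intro bexI[of _ "{}"]) (auto dest: AE_not_in)
  qed
next
  case Empty
  show ?case by (intro bexI[of _ "{}"]) auto
next
  case (Compl A)
  then obtain A' where A': "A' \<in> sets (natural_filtration M W t)" "AE \<omega> in M. \<omega> \<in> A \<longleftrightarrow> \<omega> \<in> A'" by auto
  have "space M - A' \<in> sets (natural_filtration M W t)"
    using sets.compl_sets[OF A'(1)] by simp
  with A'(2) show ?case by (intro bexI[of _ "space M - A'"]) auto
next
  case (Union A)
  then obtain A' where A': "\<And>i. A' i \<in> sets (natural_filtration M W t)"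
    "\<And>i. AE \<omega> in M. \<omega> \<in> A i \<longleftrightarrow> \<omega> \<in> A' i" by metis
  have "AE \<omega> in M. \<forall>i. \<omega> \<in> A i \<longleftrightarrow> \<omega> \<in> A' i"
    using A'(2) by (simp add: AE_all_countable)
  then show ?case using A'(1) by (intro bexI[of _ "\<Union>i. A' i"]) auto
qed

text \<open>Exchanging an event for an almost surely equal one changes neither its probability nor
  that of its intersection with an event of the increment.\<close>

lemma indep_set_increment:
  assumes "0 \<le> s" "s < t"
  shows "indep_set (sets (F s)) {(\<lambda>\<omega>. W t \<omega> - W s \<omega>) -` A \<inter> space M | A. A \<in> sets borel}"
  unfolding indep_sets2_eq
proof (intro conjI ballI)
  have nat: "indep_set (sets (natural_filtration M W s))
      {(\<lambda>\<omega>. W t \<omega> - W s \<omega>) -` A \<inter> space M | A. A \<in> sets borel}"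
    using bm assms by (auto simp: standard_brownian_motion_def)
  show "{(\<lambda>\<omega>. W t \<omega> - W s \<omega>) -` A \<inter> space M | A. A \<in> sets borel} \<subseteq> events"
    using indep_setD_ev2[OF nat] .
  show "sets (F s) \<subseteq> events" by (rule sets_F_subset)
  fix a b assume a: "a \<in> sets (F s)" and b: "b \<in> {(\<lambda>\<omega>. W t \<omega> - W s \<omega>) -` A \<inter> space M | A. A \<in> sets borel}"
  obtain a' where a': "a' \<in> sets (natural_filtration M W s)" "AE \<omega> in M. \<omega> \<in> a \<longleftrightarrow> \<omega> \<in> a'"
    using F_AE_eq_natural[OF a] by auto
  have ev: "a \<in> events" "a' \<in> events" "b \<in> events"
    using a a'(1) b sets_F_subset indep_setD_ev1[OF nat] indep_setD_ev2[OF nat] by blast+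
  have "prob (a \<inter> b) = prob (a' \<inter> b)" "prob a = prob a'"
    using a'(2) ev by (auto intro!: finite_measure_eq_AE)
  with indep_setD[OF nat a'(1) b] show "prob (a \<inter> b) = prob a * prob b" by simp
qed

lemma indep_var_increment:
  assumes st: "0 \<le> s" "s < t" and f: "f \<in> borel_measurable (F s)"
  shows "indep_var borel f borel (\<lambda>\<omega>. W t \<omega> - W s \<omega>)"
  unfolding indep_var_eq
proof (intro conjI)
  show "random_variable borel f" using measurable_F[OF f] .
  show "random_variable borel (\<lambda>\<omega>. W t \<omega> - W s \<omega>)"
    using st W_measurable by auto
  let ?D = "{(\<lambda>\<omega>. W t \<omega> - W s \<omega>) -` A \<inter> space M | A. A \<in> sets borel}"
  have "Int_stable ?D"
  proof (rule Int_stableI)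
    fix a b assume "a \<in> ?D" "b \<in> ?D"
    then obtain A B where AB: "A \<in> sets borel" "B \<in> sets borel"
      "a = (\<lambda>\<omega>. W t \<omega> - W s \<omega>) -` A \<inter> space M" "b = (\<lambda>\<omega>. W t \<omega> - W s \<omega>) -` B \<inter> space M"
      by auto
    then show "a \<inter> b \<in> ?D" by (intro CollectI exI[of _ "A \<inter> B"]) auto
  qed
  then have "indep_set (sigma_sets (space M) (sets (F s))) (sigma_sets (space M) ?D)"
    by (intro indep_set_sigma_sets indep_set_increment st) (auto simp: Int_stable_def)
  moreover have "sigma_sets (space M) {f -` A \<inter> space M |A. A \<in> sets borel} \<subseteq> sigma_sets (space M) (sets (F s))"
    using measurable_sets[OF f] by (intro sigma_sets_mono') auto
  ultimately show "indep_set (sigma_sets (space M) {f -` A \<inter> space M |A. A \<in> sets borel}) (sigma_sets (space M) ?D)"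
    unfolding indep_sets2_eq by blast
qed

section \<open>Moments and covariances of increments\<close>

lemma increment_moment: "0 \<le> s \<Longrightarrow> s \<le> t \<Longrightarrow> integrable M (\<lambda>\<omega>. (W t \<omega> - W s \<omega>) ^ k)"
proof (cases "s = t")
  case False
  moreover assume "0 \<le> s" "s \<le> t"
  ultimately have st: "0 \<le> s" "s < t" by auto
  have "integrable lborel (\<lambda>x. normal_density 0 (sqrt (t - s)) x * (x - 0) ^ k)"
    using st by (intro integrable_normal_moment) auto
  then show ?thesis
    using distributed_integrable[OF W_distributed[OF st], of "\<lambda>x. x ^ k"] by simp
qed (cases k; simp)

lemma increment_mean: "0 \<le> s \<Longrightarrow> s < t \<Longrightarrow> expectation (\<lambda>\<omega>. W t \<omega> - W s \<omega>) = 0"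
  using normal_distributed_expectation[OF _ W_distributed] by simp

lemma increment_var: "0 \<le> s \<Longrightarrow> s < t \<Longrightarrow> expectation (\<lambda>\<omega>. (W t \<omega> - W s \<omega>)\<^sup>2) = t - s"
  using normal_distributed_variance[of "sqrt (t - s)", OF _ W_distributed[of s t]] increment_mean[of s t]
  by simp

lemma expectation_times_increment:
  assumes st: "0 \<le> s" "s \<le> t" and f: "f \<in> borel_measurable (F s)" "integrable M f"
  shows "integrable M (\<lambda>\<omega>. f \<omega> * (W t \<omega> - W s \<omega>))" "expectation (\<lambda>\<omega>. f \<omega> * (W t \<omega> - W s \<omega>)) = 0"
proof -
  have "integrable M (\<lambda>\<omega>. f \<omega> * (W t \<omega> - W s \<omega>)) \<and> expectation (\<lambda>\<omega>. f \<omega> * (W t \<omega> - W s \<omega>)) = 0"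
  proof (cases "s = t")
    case False
    with st have "s < t" by simp
    note iv = indep_var_increment[OF st(1) this f(1)]
    have "integrable M (\<lambda>\<omega>. W t \<omega> - W s \<omega>)" using increment_moment[OF st, of 1] by simp
    with indep_var_integrable[OF iv f(2) this] indep_var_lebesgue_integral[OF iv f(2) this]
      increment_mean[OF st(1) \<open>s < t\<close>]
    show ?thesis by simp
  qed simp
  then show "integrable M (\<lambda>\<omega>. f \<omega> * (W t \<omega> - W s \<omega>))" "expectation (\<lambda>\<omega>. f \<omega> * (W t \<omega> - W s \<omega>)) = 0"
    by auto
qed

lemma expectation_times_increment_square:
  assumes st: "0 \<le> s" "s \<le> t" and f: "f \<in> borel_measurable (F s)" "integrable M f"
  shows "integrable M (\<lambda>\<omega>. f \<omega> * (W t \<omega> - W s \<omega>)\<^sup>2)"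
    "expectation (\<lambda>\<omega>. f \<omega> * (W t \<omega> - W s \<omega>)\<^sup>2) = (t - s) * expectation f"
proof -
  have "integrable M (\<lambda>\<omega>. f \<omega> * (W t \<omega> - W s \<omega>)\<^sup>2) \<and>
    expectation (\<lambda>\<omega>. f \<omega> * (W t \<omega> - W s \<omega>)\<^sup>2) = (t - s) * expectation f"
  proof (cases "s = t")
    case False
    with st have "s < t" by simp
    have iv: "indep_var borel f borel (\<lambda>\<omega>. (W t \<omega> - W s \<omega>)\<^sup>2)"
      using indep_var_compose[OF indep_var_increment[OF st(1) \<open>s < t\<close> f(1)], of id borel "\<lambda>x. x\<^sup>2" borel]
      by (simp add: o_def)
    note i2 = increment_moment[OF st, of 2]
    from indep_var_integrable[OF iv f(2) this] indep_var_lebesgue_integral[OF iv f(2) i2]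
      increment_var[OF st(1) \<open>s < t\<close>]
    show ?thesis by (simp add: mult.commute)
  qed simp
  then show "integrable M (\<lambda>\<omega>. f \<omega> * (W t \<omega> - W s \<omega>)\<^sup>2)"
    "expectation (\<lambda>\<omega>. f \<omega> * (W t \<omega> - W s \<omega>)\<^sup>2) = (t - s) * expectation f"
    by auto
qed

text \<open>Cutting the intervals at \<open>s'\<close> and at \<open>q = min t t'\<close> expands
  the product into four terms. Three contain an increment that starts when everything else in the
  term is already known, and vanish in mean; the square over the common part gives
  \<open>q - s'\<close>, by independence from the weight \<open>z\<close>.\<close>

lemma expectation_two_increments_aux:
  assumes "0 \<le> s" "s \<le> t" "s \<le> s'" "s' \<le> t'"
    and z: "z \<in> borel_measurable (F s')" "\<And>\<omega>. \<omega> \<in> space M \<Longrightarrow> \<bar>z \<omega>\<bar> \<le> c"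
  shows "integrable M (\<lambda>\<omega>. z \<omega> * ((W t \<omega> - W s \<omega>) * (W t' \<omega> - W s' \<omega>))) \<and>
    expectation (\<lambda>\<omega>. z \<omega> * ((W t \<omega> - W s \<omega>) * (W t' \<omega> - W s' \<omega>))) =
      max 0 (min t t' - max s s') * expectation z"
proof -
  have zM: "z \<in> borel_measurable M" by (rule measurable_F[OF z(1)])
  have zi: "integrable M z"
    by (rule integrable_const_bound[of _ c]) (use z(2) zM in auto)
  have ad: "W u \<in> borel_measurable (F v)" if "0 \<le> u" "u \<le> v" for u v
    using W_adapted that by auto
  have zd: "(\<lambda>\<omega>. z \<omega> * (W b \<omega> - W a \<omega>)) \<in> borel_measurable (F v)"
    "integrable M (\<lambda>\<omega>. z \<omega> * (W b \<omega> - W a \<omega>))"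
    if "0 \<le> a" "a \<le> b" "b \<le> v" "s' \<le> v" for a b v
  proof -
    show "(\<lambda>\<omega>. z \<omega> * (W b \<omega> - W a \<omega>)) \<in> borel_measurable (F v)"
      using that measurable_augmented_filtration_mono[OF z(1)]
      by (intro borel_measurable_times borel_measurable_diff ad) auto
    show "integrable M (\<lambda>\<omega>. z \<omega> * (W b \<omega> - W a \<omega>))"
    proof (rule Bochner_Integration.integrable_bound)
      show "integrable M (\<lambda>\<omega>. c * (W b \<omega> - W a \<omega>))"
        using increment_moment[of a b 1] that by simp
      show "(\<lambda>\<omega>. z \<omega> * (W b \<omega> - W a \<omega>)) \<in> borel_measurable M"
        using zM W_measurable that by auto
      show "AE \<omega> in M. norm (z \<omega> * (W b \<omega> - W a \<omega>)) \<le> norm (c * (W b \<omega> - W a \<omega>))"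
      proof (rule AE_I2)
        fix \<omega> assume "\<omega> \<in> space M"
        then have "\<bar>z \<omega>\<bar> \<le> \<bar>c\<bar>" using z(2)[of \<omega>] by linarith
        then show "norm (z \<omega> * (W b \<omega> - W a \<omega>)) \<le> norm (c * (W b \<omega> - W a \<omega>))"
          by (simp add: abs_mult mult_right_mono)
      qed
    qed
  qed
  show ?thesis
  proof (cases "t \<le> s'")
    case True
    then show ?thesis
      using expectation_times_increment[of s' t' "\<lambda>\<omega>. z \<omega> * (W t \<omega> - W s \<omega>)"] zd[of s t s'] assms
      by (simp add: mult.assoc)
  next
    case False
    define q where "q = min t t'"
    have q: "s' \<le> q" "0 \<le> s'" "0 \<le> q" "q \<le> t" "q \<le> t'" using assms False by (auto simp: q_def)
    note 1 = expectation_times_increment[of s' t', OF _ _ zd[of s s' s']]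
    note 2 = expectation_times_increment_square[of s' q z]
    note 3 = expectation_times_increment[of q t', OF _ _ zd[of s' q q]]
    note 4 = expectation_times_increment[of q t, OF _ _ zd[of s' q q]]
    \<comment> \<open>One of the last two summands is zero: the fourth if \<open>t \<le> t'\<close>,
      the third otherwise. Keeping both avoids a case distinction in the expectations.\<close>
    have eq: "z \<omega> * ((W t \<omega> - W s \<omega>) * (W t' \<omega> - W s' \<omega>)) =
        z \<omega> * (W s' \<omega> - W s \<omega>) * (W t' \<omega> - W s' \<omega>) + z \<omega> * (W q \<omega> - W s' \<omega>)\<^sup>2
        + z \<omega> * (W q \<omega> - W s' \<omega>) * (W t' \<omega> - W q \<omega>) + z \<omega> * (W q \<omega> - W s' \<omega>) * (W t \<omega> - W q \<omega>)" for \<omega>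
      by (cases "t \<le> t'") (simp_all add: q_def min_def power2_eq_square algebra_simps)
    have i: "integrable M (\<lambda>\<omega>. z \<omega> * (W s' \<omega> - W s \<omega>) * (W t' \<omega> - W s' \<omega>))"
      "integrable M (\<lambda>\<omega>. z \<omega> * (W q \<omega> - W s' \<omega>)\<^sup>2)"
      "integrable M (\<lambda>\<omega>. z \<omega> * (W q \<omega> - W s' \<omega>) * (W t' \<omega> - W q \<omega>))"
      "integrable M (\<lambda>\<omega>. z \<omega> * (W q \<omega> - W s' \<omega>) * (W t \<omega> - W q \<omega>))"
      using 1(1) 2(1) 3(1) 4(1) q assms zi z(1) by auto
    show ?thesis
      unfolding eq
      using 1(2) 2(2) 3(2) 4(2) q assms zi z(1) i
      by (simp only: Bochner_Integration.integral_add Bochner_Integration.integrable_add) (simp add: q_def)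
  qed
qed

lemma expectation_two_increments:
  assumes "0 \<le> s" "s \<le> t" "0 \<le> s'" "s' \<le> t'"
    and z: "z \<in> borel_measurable (F (max s s'))" "\<And>\<omega>. \<omega> \<in> space M \<Longrightarrow> \<bar>z \<omega>\<bar> \<le> c"
  shows "integrable M (\<lambda>\<omega>. z \<omega> * ((W t \<omega> - W s \<omega>) * (W t' \<omega> - W s' \<omega>)))"
    "expectation (\<lambda>\<omega>. z \<omega> * ((W t \<omega> - W s \<omega>) * (W t' \<omega> - W s' \<omega>))) =
      max 0 (min t t' - max s s') * expectation z"
proof -
  have "integrable M (\<lambda>\<omega>. z \<omega> * ((W t \<omega> - W s \<omega>) * (W t' \<omega> - W s' \<omega>))) \<and>
    expectation (\<lambda>\<omega>. z \<omega> * ((W t \<omega> - W s \<omega>) * (W t' \<omega> - W s' \<omega>))) =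
      max 0 (min t t' - max s s') * expectation z"
  proof (cases "s \<le> s'")
    case True
    then show ?thesis
      using assms by (intro expectation_two_increments_aux) (auto simp: max_absorb2)
  next
    case False
    have "integrable M (\<lambda>\<omega>. z \<omega> * ((W t' \<omega> - W s' \<omega>) * (W t \<omega> - W s \<omega>))) \<and>
      expectation (\<lambda>\<omega>. z \<omega> * ((W t' \<omega> - W s' \<omega>) * (W t \<omega> - W s \<omega>))) =
        max 0 (min t' t - max s' s) * expectation z"
      using assms False by (intro expectation_two_increments_aux) (auto simp: max_absorb1)
    then show ?thesis
      by (simp only: mult.commute[of "W t' _ - W s' _"] min.commute[of t'] max.commute[of s'])
  qed
  then show "integrable M (\<lambda>\<omega>. z \<omega> * ((W t \<omega> - W s \<omega>) * (W t' \<omega> - W s' \<omega>)))"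
    "expectation (\<lambda>\<omega>. z \<omega> * ((W t \<omega> - W s \<omega>) * (W t' \<omega> - W s' \<omega>))) =
      max 0 (min t t' - max s s') * expectation z"
    by auto
qed

end

section \<open>The Ito isometry\<close>

text \<open>The overlap length is the number that \<open>expectation_two_increments\<close> produces
  for the same pair of intervals; this agreement is the content of the isometry.\<close>

lemma integral_Ioc_overlap:
  fixes a b a' b' :: real
  shows "integrable lborel (\<lambda>s. indicator {a<..b} s * indicator {a'<..b'} s :: real)"
    "(LINT s|lborel. indicator {a<..b} s * indicator {a'<..b'} s) = max 0 (min b b' - max a a')"
proof -
  have eq: "indicator {a<..b} s * indicator {a'<..b'} s = (indicator {max a a'<..min b b'} s :: real)" for s
    by (auto simp: indicator_def)
  show "integrable lborel (\<lambda>s. indicator {a<..b} s * indicator {a'<..b'} s :: real)"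
    unfolding eq by (cases "max a a' \<le> min b b'") (auto intro!: integrable_real_indicator simp: emeasure_lborel_Ioc)
  show "(LINT s|lborel. indicator {a<..b} s * indicator {a'<..b'} s) = max 0 (min b b' - max a a')"
    unfolding eq by (cases "max a a' \<le> min b b'") (auto simp: measure_lborel_Ioc)
qed

lemma norm_sum_scaleR_square:
  fixes v :: "'j \<Rightarrow> 'b::real_inner"
  shows "(norm (\<Sum>j\<in>J. x j *\<^sub>R v j))\<^sup>2 = (\<Sum>i\<in>J. \<Sum>j\<in>J. (v i \<bullet> v j) * (x i * x j))"
  by (simp add: power2_norm_eq_inner inner_sum_left inner_sum_right sum_distrib_left mult_ac inner_commute)

text \<open>Clamping the time extends a process on \<open>{0..t}\<close> to all times while keeping joint measurability.\<close>

definition clamp_time :: "real \<Rightarrow> real \<Rightarrow> real" where "clamp_time t s = max 0 (min t s)"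

lemma clamp_time_id [simp]: "s \<in> {0..t} \<Longrightarrow> clamp_time t s = s"
  by (auto simp: clamp_time_def)

lemma norm_square_triangle3:
  fixes a b c :: "'b::real_normed_vector"
  shows "(norm (a + b + c))\<^sup>2 \<le> 3 * (norm a)\<^sup>2 + 3 * (norm b)\<^sup>2 + 3 * (norm c)\<^sup>2"
proof -
  have "(norm (a + b + c))\<^sup>2 \<le> (norm a + norm b + norm c)\<^sup>2"
    by (intro power_mono norm_triangle_le add_right_mono norm_triangle_ineq) auto
  also have "\<dots> \<le> 3 * (norm a)\<^sup>2 + 3 * (norm b)\<^sup>2 + 3 * (norm c)\<^sup>2"
    using sum_squares_ge_zero[of "norm a - norm b" 0] zero_le_power2[of "norm a - norm b"]
      zero_le_power2[of "norm b - norm c"] zero_le_power2[of "norm a - norm c"]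
    by (simp add: power2_eq_square algebra_simps)
  finally show ?thesis .
qed

context brownian
begin

text \<open>The intervals may overlap, so the difference of two simple processes on different partitions
  is covered without passing to a common refinement.\<close>

lemma ito_isometry:
  fixes \<eta> :: "'j \<Rightarrow> 'a \<Rightarrow> 'b::euclidean_space"
  assumes fin: "finite J" and ab: "\<And>j. j \<in> J \<Longrightarrow> 0 \<le> a j \<and> a j \<le> b j \<and> b j \<le> t"
    and \<eta>: "\<And>j. j \<in> J \<Longrightarrow> \<eta> j \<in> borel_measurable (F (a j))"
    and bdd: "\<And>j. j \<in> J \<Longrightarrow> bounded (\<eta> j ` space M)"
  shows "(\<integral>\<^sup>+\<omega>. ennreal ((norm (\<Sum>j\<in>J. (W (b j) \<omega> - W (a j) \<omega>) *\<^sub>R \<eta> j \<omega>))\<^sup>2) \<partial>M) =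
    (\<integral>\<^sup>+\<omega>. (\<integral>\<^sup>+s\<in>{0..t}. ennreal ((norm (\<Sum>j\<in>J. indicator {a j<..b j} s *\<^sub>R \<eta> j \<omega>))\<^sup>2) \<partial>lborel) \<partial>M)"
proof -
  define L where "L i j = max 0 (min (b i) (b j) - max (a i) (a j))" for i j
  have bd: "\<exists>c. \<forall>\<omega>\<in>space M. \<bar>\<eta> i \<omega> \<bullet> \<eta> j \<omega>\<bar> \<le> c" if ij: "i \<in> J" "j \<in> J" for i j
  proof -
    obtain c d where c: "\<forall>\<omega>\<in>space M. norm (\<eta> i \<omega>) \<le> c" "\<forall>\<omega>\<in>space M. norm (\<eta> j \<omega>) \<le> d"
      using bdd[OF ij(1)] bdd[OF ij(2)] unfolding bounded_iff by auto
    have "\<bar>\<eta> i \<omega> \<bullet> \<eta> j \<omega>\<bar> \<le> c * d" if "\<omega> \<in> space M" for \<omega>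
    proof -
      have "\<bar>\<eta> i \<omega> \<bullet> \<eta> j \<omega>\<bar> \<le> norm (\<eta> i \<omega>) * norm (\<eta> j \<omega>)" by (rule Cauchy_Schwarz_ineq2)
      also have "\<dots> \<le> c * d"
        using c that by (intro mult_mono) (auto intro: order_trans[OF norm_ge_zero])
      finally show ?thesis .
    qed
    then show ?thesis by blast
  qed
  have meas: "(\<lambda>\<omega>. \<eta> i \<omega> \<bullet> \<eta> j \<omega>) \<in> borel_measurable (F (max (a i) (a j)))" if "i \<in> J" "j \<in> J" for i j
    using that \<eta> by (intro borel_measurable_inner measurable_augmented_filtration_mono[OF \<eta>]) auto
  have int\<eta>: "integrable M (\<lambda>\<omega>. \<eta> i \<omega> \<bullet> \<eta> j \<omega>)" if "i \<in> J" "j \<in> J" for i j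
  proof -
    obtain c where c: "\<forall>\<omega>\<in>space M. \<bar>\<eta> i \<omega> \<bullet> \<eta> j \<omega>\<bar> \<le> c" using bd[OF \<open>i \<in> J\<close> \<open>j \<in> J\<close>] by auto
    show ?thesis
      by (rule integrable_const_bound[of _ c]) (use c measurable_F[OF meas] that in auto)
  qed
  have *: "integrable M (\<lambda>\<omega>. (\<eta> i \<omega> \<bullet> \<eta> j \<omega>) * ((W (b i) \<omega> - W (a i) \<omega>) * (W (b j) \<omega> - W (a j) \<omega>)))"
    "expectation (\<lambda>\<omega>. (\<eta> i \<omega> \<bullet> \<eta> j \<omega>) * ((W (b i) \<omega> - W (a i) \<omega>) * (W (b j) \<omega> - W (a j) \<omega>))) =
      L i j * expectation (\<lambda>\<omega>. \<eta> i \<omega> \<bullet> \<eta> j \<omega>)" if ij: "i \<in> J" "j \<in> J" for i j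
  proof -
    obtain c where "\<forall>\<omega>\<in>space M. \<bar>\<eta> i \<omega> \<bullet> \<eta> j \<omega>\<bar> \<le> c" using bd[OF ij] by auto
    then show "integrable M (\<lambda>\<omega>. (\<eta> i \<omega> \<bullet> \<eta> j \<omega>) * ((W (b i) \<omega> - W (a i) \<omega>) * (W (b j) \<omega> - W (a j) \<omega>)))"
      "expectation (\<lambda>\<omega>. (\<eta> i \<omega> \<bullet> \<eta> j \<omega>) * ((W (b i) \<omega> - W (a i) \<omega>) * (W (b j) \<omega> - W (a j) \<omega>))) =
      L i j * expectation (\<lambda>\<omega>. \<eta> i \<omega> \<bullet> \<eta> j \<omega>)"
      unfolding L_def using ab[OF ij(1)] ab[OF ij(2)] meas[OF ij]
      by (intro expectation_two_increments; auto)+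
  qed
  \<comment> \<open>Both sides of the isometry are evaluated to this double sum, one through
    covariances of increments, the other through overlaps of indicators.\<close>
  let ?E = "\<Sum>i\<in>J. \<Sum>j\<in>J. L i j * expectation (\<lambda>\<omega>. \<eta> i \<omega> \<bullet> \<eta> j \<omega>)"
  have "has_bochner_integral M (\<lambda>\<omega>. (norm (\<Sum>j\<in>J. (W (b j) \<omega> - W (a j) \<omega>) *\<^sub>R \<eta> j \<omega>))\<^sup>2) ?E"
    unfolding norm_sum_scaleR_square using *
    by (intro has_bochner_integral_sum) (auto simp: has_bochner_integral_iff)
  then have 1: "(\<integral>\<^sup>+\<omega>. ennreal ((norm (\<Sum>j\<in>J. (W (b j) \<omega> - W (a j) \<omega>) *\<^sub>R \<eta> j \<omega>))\<^sup>2) \<partial>M) = ennreal ?E"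
    by (subst nn_integral_eq_integral) (auto simp: has_bochner_integral_iff)
  define q where "q \<omega> = (\<Sum>i\<in>J. \<Sum>j\<in>J. L i j * (\<eta> i \<omega> \<bullet> \<eta> j \<omega>))" for \<omega>
  have b: "has_bochner_integral lborel (\<lambda>s. (norm (\<Sum>j\<in>J. indicator {a j<..b j} s *\<^sub>R \<eta> j \<omega>))\<^sup>2) (q \<omega>)" for \<omega>
    unfolding norm_sum_scaleR_square q_def L_def
    using integral_Ioc_overlap
    by (intro has_bochner_integral_sum) (auto simp: has_bochner_integral_iff mult.commute)
  have q0: "0 \<le> q \<omega>" for \<omega>
    by (subst has_bochner_integral_integral_eq[OF b, symmetric]) (rule integral_nonneg_AE, simp)
  have "(\<integral>\<^sup>+s\<in>{0..t}. ennreal ((norm (\<Sum>j\<in>J. indicator {a j<..b j} s *\<^sub>R \<eta> j \<omega>))\<^sup>2) \<partial>lborel) = ennreal (q \<omega>)" for \<omega>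
  proof -
    have "(\<Sum>j\<in>J. indicator {a j<..b j} s *\<^sub>R \<eta> j \<omega>) = 0" if "s \<notin> {0..t}" for s
      using that ab by (intro sum.neutral) (force simp: indicator_def)
    then have "(\<integral>\<^sup>+s\<in>{0..t}. ennreal ((norm (\<Sum>j\<in>J. indicator {a j<..b j} s *\<^sub>R \<eta> j \<omega>))\<^sup>2) \<partial>lborel) =
        (\<integral>\<^sup>+s. ennreal ((norm (\<Sum>j\<in>J. indicator {a j<..b j} s *\<^sub>R \<eta> j \<omega>))\<^sup>2) \<partial>lborel)"
      by (intro nn_integral_cong) (auto split: split_indicator)
    also have "\<dots> = ennreal (q \<omega>)"
      using b[of \<omega>] by (subst nn_integral_eq_integral) (auto simp: has_bochner_integral_iff)
    finally show ?thesis .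
  qed
  moreover have "has_bochner_integral M q ?E"
    unfolding q_def using int\<eta>
    by (intro has_bochner_integral_sum) (auto simp: has_bochner_integral_iff)
  then have "(\<integral>\<^sup>+\<omega>. ennreal (q \<omega>) \<partial>M) = ennreal ?E"
    using q0 by (subst nn_integral_eq_integral) (auto simp: has_bochner_integral_iff)
  ultimately show ?thesis using 1 by simp
qed

section \<open>Simple integrands and uniqueness of the Ito integral\<close>

lemma simple_data_times:
  assumes "simple_data F t k a \<eta>" "i < k"
  shows "0 \<le> a i" "a i \<le> a (Suc i)" "a (Suc i) \<le> t"
proof -
  have m: "a i \<le> a j" if "i \<le> j" "j \<le> k" for i j
    using that(1,2)
  proof (induction rule: dec_induct)
    case (step n)
    then show ?case using assms(1) unfolding simple_data_def by (meson Suc_le_lessD Suc_leD order_trans)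
  qed simp
  show "0 \<le> a i" using m[of 0 i] assms by (auto simp: simple_data_def)
  show "a i \<le> a (Suc i)" using assms by (auto simp: simple_data_def)
  show "a (Suc i) \<le> t" using m[of "Suc i" k] assms by (auto simp: simple_data_def)
qed

lemma simple_data_time_nonneg: "simple_data F t k a \<eta> \<Longrightarrow> 0 \<le> t"
  using simple_data_times[of t k a \<eta> 0] by (cases k) (auto simp: simple_data_def)

lemma simple_data_value:
  assumes "simple_data F t k a \<eta>" "i < k"
  shows "\<eta> i \<in> borel_measurable (F (a i))" "bounded (\<eta> i ` space M)"
  using assms by (auto simp: simple_data_def)

text \<open>Indexed by the disjoint sum of the two partitions, with the second family of values
  negated, the difference is a single sum of the kind treated in
  \<open>ito_isometry\<close>.\<close>

lemma ito_isometry_diff: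
  fixes \<eta> \<eta>' :: "nat \<Rightarrow> 'a \<Rightarrow> 'b::euclidean_space"
  assumes sd: "simple_data F t k a \<eta>" "simple_data F t k' a' \<eta>'"
  shows "(\<integral>\<^sup>+\<omega>. ennreal ((norm (simple_integral W k a \<eta> \<omega> - simple_integral W k' a' \<eta>' \<omega>))\<^sup>2) \<partial>M) =
    (\<integral>\<^sup>+\<omega>. (\<integral>\<^sup>+s\<in>{0..t}. ennreal ((norm (simple_process k a \<eta> s \<omega> - simple_process k' a' \<eta>' s \<omega>))\<^sup>2) \<partial>lborel) \<partial>M)"
proof -
  let ?J = "{..<k} <+> {..<k'}"
  have "(\<integral>\<^sup>+\<omega>. ennreal ((norm (\<Sum>j\<in>?J. (W (case_sum (a \<circ> Suc) (a' \<circ> Suc) j) \<omega> - W (case_sum a a' j) \<omega>) *\<^sub>R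
        case_sum \<eta> (\<lambda>i \<omega>. - \<eta>' i \<omega>) j \<omega>))\<^sup>2) \<partial>M) =
    (\<integral>\<^sup>+\<omega>. (\<integral>\<^sup>+s\<in>{0..t}. ennreal ((norm (\<Sum>j\<in>?J. indicator {case_sum a a' j<..case_sum (a \<circ> Suc) (a' \<circ> Suc) j} s *\<^sub>R
        case_sum \<eta> (\<lambda>i \<omega>. - \<eta>' i \<omega>) j \<omega>))\<^sup>2) \<partial>lborel) \<partial>M)"
  proof (rule ito_isometry)
    fix j assume j: "j \<in> ?J"
    show "0 \<le> case_sum a a' j \<and> case_sum a a' j \<le> case_sum (a \<circ> Suc) (a' \<circ> Suc) j \<and> case_sum (a \<circ> Suc) (a' \<circ> Suc) j \<le> t"
      using j simple_data_times[OF sd(1)] simple_data_times[OF sd(2)] by (auto split: sum.splits)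
    show "case_sum \<eta> (\<lambda>i \<omega>. - \<eta>' i \<omega>) j \<in> borel_measurable (F (case_sum a a' j))"
      using j simple_data_value[OF sd(1)] simple_data_value[OF sd(2)] by (auto split: sum.splits)
    show "bounded (case_sum \<eta> (\<lambda>i \<omega>. - \<eta>' i \<omega>) j ` space M)"
      using j simple_data_value[OF sd(1)] simple_data_value[OF sd(2)]
      by (auto split: sum.splits simp: bounded_iff)
  qed simp
  then show ?thesis
    by (simp only: sum.Plus[OF finite_lessThan finite_lessThan] sum.case simple_integral_def simple_process_def
        sum_negf scaleR_minus_right o_def diff_conv_add_uminus)
qed

lemma progressively_measurable_clamp:
  assumes "progressively_measurable F T H" "0 \<le> t" "t \<le> T"
  shows "(\<lambda>x. H (clamp_time t (fst x)) (snd x)) \<in> borel_measurable (lborel \<Otimes>\<^sub>M F t)"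
    "(\<lambda>x. H (clamp_time t (fst x)) (snd x)) \<in> borel_measurable (lborel \<Otimes>\<^sub>M M)"
proof -
  have H: "(\<lambda>x. H (fst x) (snd x)) \<in> borel_measurable (restrict_space borel {0..t} \<Otimes>\<^sub>M F t)"
    using assms by (auto simp: progressively_measurable_def case_prod_beta')
  have c: "clamp_time t \<in> measurable lborel (restrict_space borel {0..t})"
    using assms by (intro measurable_restrict_space2) (auto simp: clamp_time_def[abs_def])
  have id: "(\<lambda>x. x) \<in> measurable M (F t)" using measurable_F[of "\<lambda>x. x" t "F t"] by simp
  have "(\<lambda>x. (clamp_time t (fst x), snd x)) \<in> measurable (lborel \<Otimes>\<^sub>M F t) (restrict_space borel {0..t} \<Otimes>\<^sub>M F t)"
    using measurable_compose[OF measurable_fst c] by (intro measurable_Pair) auto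
  from measurable_compose[OF this H]
  show "(\<lambda>x. H (clamp_time t (fst x)) (snd x)) \<in> borel_measurable (lborel \<Otimes>\<^sub>M F t)" by simp
  have "(\<lambda>x. (clamp_time t (fst x), snd x)) \<in> measurable (lborel \<Otimes>\<^sub>M M) (restrict_space borel {0..t} \<Otimes>\<^sub>M F t)"
    using measurable_compose[OF measurable_fst c] measurable_compose[OF measurable_snd id] by (intro measurable_Pair) auto
  from measurable_compose[OF this H]
  show "(\<lambda>x. H (clamp_time t (fst x)) (snd x)) \<in> borel_measurable (lborel \<Otimes>\<^sub>M M)" by simp
qed

lemma measurable_simple_process_error:
  fixes H :: "real \<Rightarrow> 'a \<Rightarrow> 'b::euclidean_space"
  assumes sd: "simple_data F t k a \<eta>" and H: "progressively_measurable F t H"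
  shows "(\<lambda>\<omega>. \<integral>\<^sup>+s\<in>{0..t}. ennreal ((norm (simple_process k a \<eta> s \<omega> - H s \<omega>))\<^sup>2) \<partial>lborel) \<in> borel_measurable M"
    "\<omega> \<in> space M \<Longrightarrow> (\<lambda>s. ennreal ((norm (simple_process k a \<eta> s \<omega> - H s \<omega>))\<^sup>2) * indicator {0..t} s) \<in> borel_measurable lborel"
proof -
  have [measurable]: "(\<lambda>x. H (clamp_time t (fst x)) (snd x)) \<in> borel_measurable (lborel \<Otimes>\<^sub>M M)"
    using progressively_measurable_clamp[OF H _ order_refl] simple_data_time_nonneg[OF sd] by auto
  have \<eta>: "\<eta> i \<in> borel_measurable M" if "i < k" for i
    using measurable_F[OF simple_data_value(1)[OF sd that]] .
  have [measurable]: "(\<lambda>x. simple_process k a \<eta> (fst x) (snd x)) \<in> borel_measurable (lborel \<Otimes>\<^sub>M M)"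
    unfolding simple_process_def using measurable_compose[OF measurable_snd \<eta>]
    by (intro borel_measurable_sum borel_measurable_scaleR) auto
  define e where "e x = ennreal ((norm (simple_process k a \<eta> (fst x) (snd x) - H (clamp_time t (fst x)) (snd x)))\<^sup>2)
      * indicator {0..t} (fst x)" for x
  have e: "e \<in> borel_measurable (lborel \<Otimes>\<^sub>M M)" unfolding e_def[abs_def] by measurable
  have eq: "ennreal ((norm (simple_process k a \<eta> s \<omega> - H s \<omega>))\<^sup>2) * indicator {0..t} s = e (s, \<omega>)" for s \<omega>
    by (auto simp: e_def split: split_indicator)
  have "(\<lambda>\<omega>. \<integral>\<^sup>+s. e (s, \<omega>) \<partial>lborel) \<in> borel_measurable M"
    by (rule lborel.borel_measurable_nn_integral) (use measurable_compose[OF measurable_pair_swap' e] in \<open>simp add: case_prod_beta'\<close>)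
  then show "(\<lambda>\<omega>. \<integral>\<^sup>+s\<in>{0..t}. ennreal ((norm (simple_process k a \<eta> s \<omega> - H s \<omega>))\<^sup>2) \<partial>lborel) \<in> borel_measurable M"
    unfolding eq .
  show "(\<lambda>s. ennreal ((norm (simple_process k a \<eta> s \<omega> - H s \<omega>))\<^sup>2) * indicator {0..t} s) \<in> borel_measurable lborel"
    if "\<omega> \<in> space M"
    unfolding eq using measurable_compose[OF measurable_Pair2'[of \<omega> M lborel] e] that
    by auto
qed

lemma simple_integral_measurable:
  assumes sd: "simple_data F t k a \<eta>"
  shows "simple_integral W k a \<eta> \<in> borel_measurable M"
  unfolding simple_integral_def[abs_def]
  using measurable_F[OF simple_data_value(1)[OF sd]] simple_data_times[OF sd]
  by (intro borel_measurable_sum borel_measurable_scaleR borel_measurable_diff W_measurable) (auto intro: order_trans)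

text \<open>\<open>Y - Y'\<close> splits into \<open>Y - I\<close>, \<open>I - I'\<close> and
  \<open>I' - Y'\<close> for members \<open>I\<close>, \<open>I'\<close> of the two approximating
  sequences. The isometry turns the middle term into the distance of two simple processes that
  approximate the same integrand, so all three parts tend to \<open>0\<close>.\<close>

lemma ito_integral_unique:
  fixes Y Y' :: "'a \<Rightarrow> 'b::euclidean_space"
  assumes "has_ito_integral M F W t H Y" "has_ito_integral M F W t H' Y'"
    and HH: "\<And>s \<omega>. s \<in> {0..t} \<Longrightarrow> \<omega> \<in> space M \<Longrightarrow> H s \<omega> = H' s \<omega>"
  shows "AE \<omega> in M. Y \<omega> = Y' \<omega>"
proof -
  obtain k a \<eta> where pm: "progressively_measurable F t H" and Y[measurable]: "Y \<in> borel_measurable M"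
    and sd: "\<And>j. simple_data F t (k j) (a j) (\<eta> j)"
    and P: "(\<lambda>j. \<integral>\<^sup>+\<omega>. (\<integral>\<^sup>+s\<in>{0..t}. ennreal ((norm (simple_process (k j) (a j) (\<eta> j) s \<omega> - H s \<omega>))\<^sup>2)
               \<partial>lborel) \<partial>M) \<longlonglongrightarrow> 0"
    and I: "(\<lambda>j. \<integral>\<^sup>+\<omega>. ennreal ((norm (simple_integral W (k j) (a j) (\<eta> j) \<omega> - Y \<omega>))\<^sup>2) \<partial>M) \<longlonglongrightarrow> 0"
    using assms(1) unfolding has_ito_integral_def by auto
  obtain k' a' \<eta>' where pm': "progressively_measurable F t H'" and Y'[measurable]: "Y' \<in> borel_measurable M"
    and sd': "\<And>j. simple_data F t (k' j) (a' j) (\<eta>' j)"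
    and P': "(\<lambda>j. \<integral>\<^sup>+\<omega>. (\<integral>\<^sup>+s\<in>{0..t}. ennreal ((norm (simple_process (k' j) (a' j) (\<eta>' j) s \<omega> - H' s \<omega>))\<^sup>2)
               \<partial>lborel) \<partial>M) \<longlonglongrightarrow> 0"
    and I': "(\<lambda>j. \<integral>\<^sup>+\<omega>. ennreal ((norm (simple_integral W (k' j) (a' j) (\<eta>' j) \<omega> - Y' \<omega>))\<^sup>2) \<partial>M) \<longlonglongrightarrow> 0"
    using assms(2) unfolding has_ito_integral_def by auto
  let ?S = "\<lambda>j. simple_process (k j) (a j) (\<eta> j)" and ?S' = "\<lambda>j. simple_process (k' j) (a' j) (\<eta>' j)"
  let ?I = "\<lambda>j. simple_integral W (k j) (a j) (\<eta> j)" and ?I' = "\<lambda>j. simple_integral W (k' j) (a' j) (\<eta>' j)"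
  define p where "p j = (\<integral>\<^sup>+\<omega>. (\<integral>\<^sup>+s\<in>{0..t}. ennreal ((norm (?S j s \<omega> - H s \<omega>))\<^sup>2) \<partial>lborel) \<partial>M)" for j
  define p' where "p' j = (\<integral>\<^sup>+\<omega>. (\<integral>\<^sup>+s\<in>{0..t}. ennreal ((norm (?S' j s \<omega> - H' s \<omega>))\<^sup>2) \<partial>lborel) \<partial>M)" for j
  define i where "i j = (\<integral>\<^sup>+\<omega>. ennreal ((norm (?I j \<omega> - Y \<omega>))\<^sup>2) \<partial>M)" for j
  define i' where "i' j = (\<integral>\<^sup>+\<omega>. ennreal ((norm (?I' j \<omega> - Y' \<omega>))\<^sup>2) \<partial>M)" for j
  have [measurable]: "?I j \<in> borel_measurable M" "?I' j \<in> borel_measurable M" for j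
    by (rule simple_integral_measurable[OF sd], rule simple_integral_measurable[OF sd'])
  have SS: "(\<integral>\<^sup>+\<omega>. ennreal ((norm (?I j \<omega> - ?I' j \<omega>))\<^sup>2) \<partial>M) \<le> 3 * p j + 3 * p' j" for j
  proof -
    have "(\<integral>\<^sup>+\<omega>. ennreal ((norm (?I j \<omega> - ?I' j \<omega>))\<^sup>2) \<partial>M) =
        (\<integral>\<^sup>+\<omega>. (\<integral>\<^sup>+s\<in>{0..t}. ennreal ((norm (?S j s \<omega> - ?S' j s \<omega>))\<^sup>2) \<partial>lborel) \<partial>M)"
      by (rule ito_isometry_diff[OF sd sd'])
    also have "\<dots> \<le> (\<integral>\<^sup>+\<omega>. 3 * (\<integral>\<^sup>+s\<in>{0..t}. ennreal ((norm (?S j s \<omega> - H s \<omega>))\<^sup>2) \<partial>lborel) +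
        3 * (\<integral>\<^sup>+s\<in>{0..t}. ennreal ((norm (?S' j s \<omega> - H' s \<omega>))\<^sup>2) \<partial>lborel) \<partial>M)"
    proof (rule nn_integral_mono)
      fix \<omega> assume w: "\<omega> \<in> space M"
      note m = measurable_simple_process_error(2)[OF sd pm w] measurable_simple_process_error(2)[OF sd' pm' w]
      have "(\<integral>\<^sup>+s\<in>{0..t}. ennreal ((norm (?S j s \<omega> - ?S' j s \<omega>))\<^sup>2) \<partial>lborel) \<le>
        (\<integral>\<^sup>+s. 3 * (ennreal ((norm (?S j s \<omega> - H s \<omega>))\<^sup>2) * indicator {0..t} s) +
         3 * (ennreal ((norm (?S' j s \<omega> - H' s \<omega>))\<^sup>2) * indicator {0..t} s) \<partial>lborel)"
      proof (rule nn_integral_mono)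
        fix s
        show "ennreal ((norm (?S j s \<omega> - ?S' j s \<omega>))\<^sup>2) * indicator {0..t} s \<le>
          3 * (ennreal ((norm (?S j s \<omega> - H s \<omega>))\<^sup>2) * indicator {0..t} s) +
          3 * (ennreal ((norm (?S' j s \<omega> - H' s \<omega>))\<^sup>2) * indicator {0..t} s)"
          using norm_square_triangle3[of "?S j s \<omega> - H s \<omega>" 0 "H' s \<omega> - ?S' j s \<omega>"] HH[of s \<omega>] w
          by (auto split: split_indicator simp: ennreal_numeral[symmetric] ennreal_mult[symmetric]
              ennreal_plus[symmetric] norm_minus_commute simp del: ennreal_numeral ennreal_plus intro!: ennreal_leI)
      qed
      also have "\<dots> = 3 * (\<integral>\<^sup>+s\<in>{0..t}. ennreal ((norm (?S j s \<omega> - H s \<omega>))\<^sup>2) \<partial>lborel) +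
        3 * (\<integral>\<^sup>+s\<in>{0..t}. ennreal ((norm (?S' j s \<omega> - H' s \<omega>))\<^sup>2) \<partial>lborel)"
        using m by (simp add: nn_integral_add nn_integral_cmult)
      finally show "(\<integral>\<^sup>+s\<in>{0..t}. ennreal ((norm (?S j s \<omega> - ?S' j s \<omega>))\<^sup>2) \<partial>lborel) \<le> \<dots>" .
    qed
    also have "\<dots> = 3 * p j + 3 * p' j"
      unfolding p_def p'_def
      using measurable_simple_process_error(1)[OF sd pm] measurable_simple_process_error(1)[OF sd' pm']
      by (simp add: nn_integral_add nn_integral_cmult)
    finally show ?thesis .
  qed
  have le: "(\<integral>\<^sup>+\<omega>. ennreal ((norm (Y \<omega> - Y' \<omega>))\<^sup>2) \<partial>M) \<le> 3 * i j + 3 * (3 * p j + 3 * p' j) + 3 * i' j" for j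
  proof -
    have "(\<integral>\<^sup>+\<omega>. ennreal ((norm (Y \<omega> - Y' \<omega>))\<^sup>2) \<partial>M) \<le>
      (\<integral>\<^sup>+\<omega>. 3 * ennreal ((norm (?I j \<omega> - Y \<omega>))\<^sup>2) + 3 * ennreal ((norm (?I j \<omega> - ?I' j \<omega>))\<^sup>2)
         + 3 * ennreal ((norm (?I' j \<omega> - Y' \<omega>))\<^sup>2) \<partial>M)"
    proof (rule nn_integral_mono)
      fix \<omega>
      show "ennreal ((norm (Y \<omega> - Y' \<omega>))\<^sup>2) \<le> 3 * ennreal ((norm (?I j \<omega> - Y \<omega>))\<^sup>2) +
        3 * ennreal ((norm (?I j \<omega> - ?I' j \<omega>))\<^sup>2) + 3 * ennreal ((norm (?I' j \<omega> - Y' \<omega>))\<^sup>2)"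
        using norm_square_triangle3[of "Y \<omega> - ?I j \<omega>" "?I j \<omega> - ?I' j \<omega>" "?I' j \<omega> - Y' \<omega>"]
        by (simp add: ennreal_numeral[symmetric] ennreal_mult[symmetric]
              ennreal_plus[symmetric] norm_minus_commute del: ennreal_numeral ennreal_plus)
    qed
    also have "\<dots> = 3 * i j + 3 * (\<integral>\<^sup>+\<omega>. ennreal ((norm (?I j \<omega> - ?I' j \<omega>))\<^sup>2) \<partial>M) + 3 * i' j"
      unfolding i_def i'_def by (simp add: nn_integral_add nn_integral_cmult)
    also have "\<dots> \<le> 3 * i j + 3 * (3 * p j + 3 * p' j) + 3 * i' j"
      by (intro add_mono mult_left_mono SS) auto
    finally show ?thesis .
  qed
  have "(\<lambda>j. 3 * i j + 3 * (3 * p j + 3 * p' j) + 3 * i' j) \<longlonglongrightarrow> 3 * 0 + 3 * (3 * 0 + 3 * 0) + 3 * 0"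
    using P P' I I' unfolding p_def p'_def i_def i'_def
    by (intro tendsto_add ennreal_tendsto_cmult) auto
  then have "(\<integral>\<^sup>+\<omega>. ennreal ((norm (Y \<omega> - Y' \<omega>))\<^sup>2) \<partial>M) \<le> 0"
    using le by (intro LIMSEQ_le_const[of _ 0]) auto
  then show ?thesis by (simp add: nn_integral_0_iff_AE)
qed

section \<open>Mean of the Ito integral\<close>

lemma simple_integral_mean:
  fixes \<eta> :: "nat \<Rightarrow> 'a \<Rightarrow> 'b::euclidean_space"
  assumes sd: "simple_data F t k a \<eta>"
  shows "integrable M (\<lambda>\<omega>. simple_integral W k a \<eta> \<omega>)" "expectation (simple_integral W k a \<eta>) = 0"
proof -
  have *: "integrable M (\<lambda>\<omega>. simple_integral W k a \<eta> \<omega> \<bullet> e)"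
    "expectation (\<lambda>\<omega>. simple_integral W k a \<eta> \<omega> \<bullet> e) = 0" for e
  proof -
    have i: "has_bochner_integral M (\<lambda>\<omega>. (\<eta> i \<omega> \<bullet> e) * (W (a (Suc i)) \<omega> - W (a i) \<omega>)) 0" if ik: "i < k" for i
    proof -
      have m: "(\<lambda>\<omega>. \<eta> i \<omega> \<bullet> e) \<in> borel_measurable (F (a i))"
        using simple_data_value(1)[OF sd ik] by auto
      obtain c where c: "\<forall>\<omega>\<in>space M. norm (\<eta> i \<omega>) \<le> c"
        using simple_data_value(2)[OF sd ik] unfolding bounded_iff by auto
      have "integrable M (\<lambda>\<omega>. \<eta> i \<omega> \<bullet> e)"
        by (rule integrable_const_bound[of _ "c * norm e"])
          (use c measurable_F[OF m] in \<open>auto intro!: AE_I2 order_trans[OF Cauchy_Schwarz_ineq2] mult_right_mono\<close>)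
      with m expectation_times_increment[OF simple_data_times(1,2)[OF sd ik]]
      show ?thesis by (auto simp: has_bochner_integral_iff)
    qed
    have "has_bochner_integral M (\<lambda>\<omega>. \<Sum>i<k. (\<eta> i \<omega> \<bullet> e) * (W (a (Suc i)) \<omega> - W (a i) \<omega>)) (\<Sum>i<k. 0)"
      by (intro has_bochner_integral_sum i) auto
    then show "integrable M (\<lambda>\<omega>. simple_integral W k a \<eta> \<omega> \<bullet> e)"
      "expectation (\<lambda>\<omega>. simple_integral W k a \<eta> \<omega> \<bullet> e) = 0"
      by (simp_all add: simple_integral_def inner_sum_left mult.commute has_bochner_integral_iff)
  qed
  have "integrable M (\<lambda>\<omega>. \<Sum>e\<in>Basis. (simple_integral W k a \<eta> \<omega> \<bullet> e) *\<^sub>R e)"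
    using *(1) by (intro Bochner_Integration.integrable_sum integrable_scaleR_left)
  then show int: "integrable M (\<lambda>\<omega>. simple_integral W k a \<eta> \<omega>)"
    by (simp add: euclidean_representation)
  show "expectation (simple_integral W k a \<eta>) = 0"
  proof (rule euclidean_eqI)
    fix e :: 'b
    show "expectation (simple_integral W k a \<eta>) \<bullet> e = 0 \<bullet> e"
      using integral_inner_left[of e M "simple_integral W k a \<eta>"] int *(2)[of e] by auto
  qed
qed

text \<open>Simple integrals have mean zero and converge to \<open>Y\<close> in mean square, hence
  in \<open>L^1\<close>, so the mean survives the limit.\<close>

lemma ito_integral_mean:
  fixes Y :: "'a \<Rightarrow> 'b::euclidean_space"
  assumes "has_ito_integral M F W t H Y"
  shows "integrable M Y" "expectation Y = 0"
proof -
  obtain k a \<eta> where Y[measurable]: "Y \<in> borel_measurable M"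
    and sd: "\<And>j. simple_data F t (k j) (a j) (\<eta> j)"
    and I: "(\<lambda>j. \<integral>\<^sup>+\<omega>. ennreal ((norm (simple_integral W (k j) (a j) (\<eta> j) \<omega> - Y \<omega>))\<^sup>2) \<partial>M) \<longlonglongrightarrow> 0"
    using assms(1) unfolding has_ito_integral_def by auto
  let ?I = "\<lambda>j. simple_integral W (k j) (a j) (\<eta> j)"
  have [measurable]: "?I j \<in> borel_measurable M" for j
    by (rule simple_integral_measurable[OF sd])
  have small: "\<exists>j. integrable M (\<lambda>\<omega>. Y \<omega> - ?I j \<omega>) \<and> expectation (\<lambda>\<omega>. norm (Y \<omega> - ?I j \<omega>)) \<le> 2 * e" if e: "0 < e" for e :: real
  proof -
    have "\<forall>\<^sub>F j in sequentially. (\<integral>\<^sup>+\<omega>. ennreal ((norm (?I j \<omega> - Y \<omega>))\<^sup>2) \<partial>M) < ennreal (e\<^sup>2)"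
      using I e by (intro order_tendstoD(2)) auto
    then obtain j where j: "(\<integral>\<^sup>+\<omega>. ennreal ((norm (?I j \<omega> - Y \<omega>))\<^sup>2) \<partial>M) < ennreal (e\<^sup>2)"
      by (auto simp: eventually_sequentially)
    have "(\<integral>\<^sup>+\<omega>. ennreal (norm (Y \<omega> - ?I j \<omega>)) \<partial>M) \<le> (\<integral>\<^sup>+\<omega>. ennreal e + ennreal (1 / e) * ennreal ((norm (?I j \<omega> - Y \<omega>))\<^sup>2) \<partial>M)"
    proof (rule nn_integral_mono)
      fix \<omega>
      \<comment> \<open>The bound \<open>x \<le> e + x^2 / e\<close> turns a mean square below
        \<open>e^2\<close> into a first moment of at most \<open>2 * e\<close>.\<close>
      have "e * x \<le> e * e + x\<^sup>2" for x
        using sum_squares_bound[of e x] sum_squares_ge_zero[of e x] unfolding power2_eq_square by linarith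
      then have "e * x \<le> e * (e + 1 / e * x\<^sup>2)" for x
        using e by (simp add: distrib_left)
      then have "x \<le> e + 1 / e * x\<^sup>2" for x
        using e mult_le_cancel_left_pos by blast
      from this[of "norm (Y \<omega> - ?I j \<omega>)"]
      show "ennreal (norm (Y \<omega> - ?I j \<omega>)) \<le> ennreal e + ennreal (1 / e) * ennreal ((norm (?I j \<omega> - Y \<omega>))\<^sup>2)"
        using e by (simp add: ennreal_mult[symmetric] ennreal_plus[symmetric] norm_minus_commute del: ennreal_plus)
    qed
    also have "\<dots> = ennreal e + ennreal (1 / e) * (\<integral>\<^sup>+\<omega>. ennreal ((norm (?I j \<omega> - Y \<omega>))\<^sup>2) \<partial>M)"
      by (simp add: nn_integral_add nn_integral_cmult emeasure_space_1)
    also have "\<dots> \<le> ennreal e + ennreal (1 / e) * ennreal (e\<^sup>2)"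
      using j by (intro add_left_mono mult_left_mono) auto
    also have "\<dots> = ennreal (2 * e)"
      using e by (simp add: ennreal_mult[symmetric] ennreal_plus[symmetric] power2_eq_square del: ennreal_plus)
    finally have le: "(\<integral>\<^sup>+\<omega>. ennreal (norm (Y \<omega> - ?I j \<omega>)) \<partial>M) \<le> ennreal (2 * e)" .
    have int: "integrable M (\<lambda>\<omega>. Y \<omega> - ?I j \<omega>)"
      using le by (auto simp: integrable_iff_bounded intro: le_less_trans)
    then have "ennreal (expectation (\<lambda>\<omega>. norm (Y \<omega> - ?I j \<omega>))) \<le> ennreal (2 * e)"
      using le by (subst nn_integral_eq_integral[symmetric]) auto
    with int e show ?thesis by (auto simp: ennreal_le_iff2)
  qed
  from small[of 1] obtain j where "integrable M (\<lambda>\<omega>. Y \<omega> - ?I j \<omega>)" by auto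
  from Bochner_Integration.integrable_add[OF this simple_integral_mean(1)[OF sd[of j]]]
  show Yi: "integrable M Y" by simp
  have "norm (expectation Y) \<le> 0 + e" if e: "0 < e" for e
  proof -
    obtain j where j: "integrable M (\<lambda>\<omega>. Y \<omega> - ?I j \<omega>)" "expectation (\<lambda>\<omega>. norm (Y \<omega> - ?I j \<omega>)) \<le> e"
      using small[of "e / 2"] e by auto
    have "expectation Y = expectation (\<lambda>\<omega>. Y \<omega> - ?I j \<omega>)"
      using Yi simple_integral_mean[OF sd[of j]] by (simp add: Bochner_Integration.integral_diff)
    then show ?thesis unfolding add_0 using order_trans[OF integral_norm_bound j(2)] by metis
  qed
  then have "norm (expectation Y) \<le> 0" by (rule field_le_epsilon)
  then show "expectation Y = 0" by simp
qed

end

section \<open>Minkowski's integral inequality\<close>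

text \<open>The weighted arithmetic-geometric mean inequality with weights \<open>1 / p\<close> and
  \<open>1 - 1 / p\<close>, applied to \<open>f powr p * k powr (1 - p)\<close> and
  \<open>k\<close>, where \<open>k = s * h\<close>: the powers of \<open>k\<close> cancel in the
  geometric mean and leave \<open>f\<close>. The parameter \<open>s\<close> stays free, to be
  optimised after integration in time.\<close>

lemma young_weighted:
  fixes f h s p :: real
  assumes "p > 1" "0 \<le> f" "0 < h" "0 < s"
  shows "f \<le> s powr (1 - p) / p * (f powr p * h powr (1 - p)) + (1 - 1 / p) * (s * h)"
proof (cases "f = 0")
  case False
  define k where "k = s * h"
  have k: "0 < k" using assms by (simp add: k_def)
  have "(1 - p) * (1 / p) + (1 - 1 / p) = 0" using assms by (simp add: field_simps)
  then have "k powr ((1 - p) * (1 / p)) * k powr (1 - 1 / p) = 1"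
    using k by (simp only: powr_add[symmetric]) simp
  then have "(f powr p * k powr (1 - p)) powr (1 / p) * k powr (1 - 1 / p) = f"
    using False assms k by (simp add: powr_mult powr_powr mult.assoc)
  moreover have "(f powr p * k powr (1 - p)) powr (1 / p) * k powr (1 - 1 / p) \<le>
      1 / p * (f powr p * k powr (1 - p)) + (1 - 1 / p) * k"
    using assms False k by (intro Youngs_inequality_0) auto
  ultimately show ?thesis using assms by (simp add: k_def powr_mult mult_ac)
qed (use assms in simp)

text \<open>The weighted function \<open>g\<close> has expected time integral at most the integral
  of \<open>h\<close>, so \<open>I\<close> is finite almost surely; on such paths Young's inequality
  bounds the \<open>p\<close>-th power of the time integral of \<open>f\<close> by
  \<open>H powr (p - 1)\<close> times \<open>I + 1\<close>. This serves the inclusion of the control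
  classes and the moments of the supremum of the controlled process.\<close>

lemma (in prob_space) minkowski_integral_finite:
  fixes f :: "real \<Rightarrow> 'a \<Rightarrow> real"
  assumes f[measurable]: "(\<lambda>x. f (fst x) (snd x)) \<in> borel_measurable (lborel \<Otimes>\<^sub>M M)"
    and nn: "\<And>t \<omega>. 0 \<le> f t \<omega>" and p: "p > 1" and T: "T > 0"
    and int: "AE t in lborel. t \<in> {0..T} \<longrightarrow> integrable M (\<lambda>\<omega>. f t \<omega> powr p)"
    and norms: "set_integrable lborel {0..T} (\<lambda>t. (LINT \<omega>|M. f t \<omega> powr p) powr (1 / p))"
  shows "AE \<omega> in M. set_integrable lborel {0..T} (\<lambda>t. f t \<omega>)" (is ?A)
    and "integrable M (\<lambda>\<omega>. (LINT t:{0..T}|lborel. f t \<omega>) powr p)" (is ?B)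
proof -
  interpret P: pair_sigma_finite lborel M ..
  \<comment> \<open>The added \<open>1\<close> keeps the weight \<open>h\<close> positive; Young's inequality with weight \<open>h\<close> replaces Jensen.\<close>
  define h where "h t = (LINT \<omega>|M. f t \<omega> powr p) powr (1 / p) + 1" for t
  define g where "g t \<omega> = f t \<omega> powr p * h t powr (1 - p)" for t \<omega>
  define I where "I \<omega> = (\<integral>\<^sup>+t\<in>{0..T}. ennreal (g t \<omega>) \<partial>lborel)" for \<omega>
  have h1: "1 \<le> h t" for t by (simp add: h_def)
  have h0: "0 < h t" for t using h1[of t] by linarith
  have g0: "0 \<le> g t \<omega>" for t \<omega> by (simp add: g_def)
  have [measurable]: "h \<in> borel_measurable lborel"
    unfolding h_def[abs_def] by (measurable; simp add: case_prod_beta')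
  have g[measurable]: "(\<lambda>x. g (fst x) (snd x)) \<in> borel_measurable (lborel \<Otimes>\<^sub>M M)"
    unfolding g_def by measurable
  have swap: "(\<lambda>x. f (snd x) (fst x)) \<in> borel_measurable (M \<Otimes>\<^sub>M lborel)"
    "(\<lambda>x. g (snd x) (fst x)) \<in> borel_measurable (M \<Otimes>\<^sub>M lborel)"
    using measurable_compose[OF measurable_pair_swap' f] measurable_compose[OF measurable_pair_swap' g]
    by (simp_all add: case_prod_beta')
  have sec: "(\<lambda>t. f t \<omega>) \<in> borel_measurable lborel" "(\<lambda>t. g t \<omega>) \<in> borel_measurable lborel" if "\<omega> \<in> space M" for \<omega>
    using measurable_compose[OF measurable_Pair2'[OF that] f] measurable_compose[OF measurable_Pair2'[OF that] g] by auto
  have seco: "f t \<in> borel_measurable M" "g t \<in> borel_measurable M" for t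
    using measurable_compose[OF measurable_Pair1'[of t lborel M] f] measurable_compose[OF measurable_Pair1'[of t lborel M] g] by auto
  have Im[measurable]: "I \<in> borel_measurable M"
    unfolding I_def[abs_def]
    by (rule lborel.borel_measurable_nn_integral) (use swap in \<open>simp add: case_prod_beta'; measurable\<close>)
  have hint: "set_integrable lborel {0..T} h"
    unfolding h_def[abs_def] by (intro set_integral_add(1) norms) (use T in \<open>auto simp: set_integrable_def intro!: integrable_real_indicator\<close>)
  define H where "H = (LINT t:{0..T}|lborel. h t)"
  have "(LINT t:{0..T}|lborel. 1::real) \<le> H"
    unfolding H_def by (intro set_integral_mono hint h1) (use T in \<open>auto simp: set_integrable_def intro!: integrable_real_indicator\<close>)
  then have H0: "0 < H" using T by (simp add: set_lebesgue_integral_def)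
  have "(\<integral>\<^sup>+\<omega>. I \<omega> \<partial>M) = (\<integral>\<^sup>+t. \<integral>\<^sup>+\<omega>. ennreal (g t \<omega>) * indicator {0..T} t \<partial>M \<partial>lborel)"
    unfolding I_def using P.Fubini[of "\<lambda>x. ennreal (g (fst x) (snd x)) * indicator {0..T} (fst x)"] by simp
  also have "\<dots> = (\<integral>\<^sup>+t. (\<integral>\<^sup>+\<omega>. ennreal (g t \<omega>) \<partial>M) * indicator {0..T} t \<partial>lborel)"
    using seco by (intro nn_integral_cong nn_integral_multc) auto
  also have "\<dots> \<le> (\<integral>\<^sup>+t. ennreal (h t) * indicator {0..T} t \<partial>lborel)"
  proof (rule nn_integral_mono_AE, use int in eventually_elim)
    fix t assume i: "t \<in> {0..T} \<longrightarrow> integrable M (\<lambda>\<omega>. f t \<omega> powr p)"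
    show "(\<integral>\<^sup>+\<omega>. ennreal (g t \<omega>) \<partial>M) * indicator {0..T} t \<le> ennreal (h t) * indicator {0..T} t"
    proof (cases "t \<in> {0..T}")
      case True
      with i have i: "integrable M (\<lambda>\<omega>. f t \<omega> powr p)" by simp
      have E0: "0 \<le> (LINT \<omega>|M. f t \<omega> powr p)" by simp
      have "(\<integral>\<^sup>+\<omega>. ennreal (g t \<omega>) \<partial>M) = ennreal ((LINT \<omega>|M. f t \<omega> powr p) * h t powr (1 - p))"
        using i g0 by (subst nn_integral_eq_integral) (auto simp: g_def[abs_def])
      \<comment> \<open>\<open>h t\<close> exceeds the \<open>L^p\<close> norm of
        \<open>f t\<close>, so its \<open>p\<close>-th power absorbs the moment and one power of
        \<open>h t\<close> remains.\<close>
      moreover have "(LINT \<omega>|M. f t \<omega> powr p) * h t powr (1 - p) \<le> h t"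
      proof -
        have "(LINT \<omega>|M. f t \<omega> powr p) = ((LINT \<omega>|M. f t \<omega> powr p) powr (1 / p)) powr p"
          using p E0 by (simp add: powr_powr)
        also have "\<dots> * h t powr (1 - p) \<le> h t powr p * h t powr (1 - p)"
          using p by (intro mult_right_mono powr_mono2) (auto simp: h_def)
        also have "\<dots> = h t" using h0[of t] by (simp add: powr_add[symmetric])
        finally show ?thesis .
      qed
      ultimately show ?thesis by (auto intro!: mult_right_mono ennreal_leI)
    qed simp
  qed
  also have "\<dots> = (\<integral>\<^sup>+t. ennreal (indicator {0..T} t *\<^sub>R h t) \<partial>lborel)"
    by (intro nn_integral_cong) (auto split: split_indicator)
  also have "\<dots> < \<infinity>"
    using hint h0 unfolding set_integrable_def
    by (subst nn_integral_eq_integral) (auto simp: less_imp_le split: split_indicator)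
  finally have EI: "(\<integral>\<^sup>+\<omega>. I \<omega> \<partial>M) < \<infinity>" .
  then have AEI: "AE \<omega> in M. I \<omega> \<noteq> \<infinity>"
    by (intro nn_integral_PInf_AE) auto
  have key: "set_integrable lborel {0..T} (\<lambda>t. f t \<omega>) \<and>
      ennreal ((LINT t:{0..T}|lborel. f t \<omega>) powr p) \<le> ennreal (H powr (p - 1)) * (I \<omega> + 1)"
    if w: "\<omega> \<in> space M" "I \<omega> \<noteq> \<infinity>" for \<omega>
  proof -
    note [measurable] = sec[OF w(1)]
    have eqI: "I \<omega> = (\<integral>\<^sup>+t. ennreal (indicator {0..T} t *\<^sub>R g t \<omega>) \<partial>lborel)"
      unfolding I_def by (intro nn_integral_cong) (auto split: split_indicator)
    have gi: "set_integrable lborel {0..T} (\<lambda>t. g t \<omega>)"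
      unfolding set_integrable_def
    proof (rule integrableI_nonneg)
      show "(\<integral>\<^sup>+t. ennreal (indicator {0..T} t *\<^sub>R g t \<omega>) \<partial>lborel) < \<infinity>"
        using w(2) unfolding eqI by (simp add: top.not_eq_extremum)
    qed (use g0 in auto)
    define G where "G = (LINT t:{0..T}|lborel. g t \<omega>)"
    have IG: "I \<omega> = ennreal G"
      unfolding eqI G_def set_lebesgue_integral_def using gi g0
      by (subst nn_integral_eq_integral) (auto simp: set_integrable_def)
    have G0: "0 \<le> G" unfolding G_def set_lebesgue_integral_def using g0 by (intro integral_nonneg_AE) auto
    \<comment> \<open>Adding \<open>1\<close> keeps \<open>s\<close> positive when
      \<open>G = 0\<close>. The value of \<open>s\<close> minimises the integrated Young bound: with
      \<open>s powr p = J / H\<close> its two terms are the shares \<open>1 / p\<close> and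
      \<open>1 - 1 / p\<close> of \<open>s * H\<close>.\<close>
    define J where "J = G + 1"
    define s where "s = (J / H) powr (1 / p)"
    have J0: "0 < J" using G0 by (simp add: J_def)
    have s0: "0 < s" using J0 H0 by (simp add: s_def)
    define b where "b t = s powr (1 - p) / p * g t \<omega> + (1 - 1 / p) * (s * h t)" for t
    have fb: "f t \<omega> \<le> b t" for t
      unfolding b_def g_def using young_weighted[OF p nn h0 s0] .
    have bi: "set_integrable lborel {0..T} b"
      unfolding b_def[abs_def] using gi hint by (intro set_integral_add(1) set_integrable_mult_right) auto
    have fi: "set_integrable lborel {0..T} (\<lambda>t. f t \<omega>)"
      unfolding set_integrable_def
    proof (rule Bochner_Integration.integrable_bound[OF bi[unfolded set_integrable_def]])
      show "AE t in lborel. norm (indicator {0..T} t *\<^sub>R f t \<omega>) \<le> norm (indicator {0..T} t *\<^sub>R b t)"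
        using fb nn order_trans[OF nn fb] by (intro AE_I2) (auto split: split_indicator)
    qed measurable
    let ?A = "LINT t:{0..T}|lborel. f t \<omega>"
    have A0: "0 \<le> ?A" unfolding set_lebesgue_integral_def using nn by (intro integral_nonneg_AE) auto
    have "?A \<le> (LINT t:{0..T}|lborel. b t)"
      by (intro set_integral_mono fi bi fb)
    also have "\<dots> = s powr (1 - p) / p * G + (1 - 1 / p) * (s * H)"
      unfolding b_def[abs_def] G_def H_def using gi hint
      by (simp add: set_integral_add set_integrable_mult_right)
    also have "\<dots> \<le> s powr (1 - p) / p * J + (1 - 1 / p) * (s * H)"
      using p by (intro add_right_mono mult_left_mono) (auto simp: J_def)
    also have "s powr (1 - p) / p * J = s * H / p"
    proof -
      have "s powr p = J / H" using p J0 H0 by (simp add: s_def powr_powr)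
      then have "J = s powr p * H" using H0 by (simp add: field_simps)
      then show ?thesis using s0 by (simp add: powr_add[symmetric] mult.assoc[symmetric])
    qed
    also have "s * H / p + (1 - 1 / p) * (s * H) = s * H" by (simp add: field_simps)
    finally have "?A powr p \<le> (s * H) powr p" using A0 p by (intro powr_mono2) auto
    also have "\<dots> = J / H * H powr p" using p J0 H0 s0 by (simp add: powr_mult) (simp add: s_def powr_powr)
    also have "\<dots> = H powr (p - 1) * (G + 1)" using H0 by (simp add: powr_diff J_def)
    finally have "ennreal (?A powr p) \<le> ennreal (H powr (p - 1) * (G + 1))" by (rule ennreal_leI)
    also have "\<dots> = ennreal (H powr (p - 1)) * (I \<omega> + 1)"
      using G0 by (simp add: IG ennreal_mult ennreal_plus[symmetric] ennreal_1[symmetric] del: ennreal_plus ennreal_1)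
    finally show ?thesis using fi by blast
  qed
  show ?A using AEI by (rule AE_mp) (use key in auto)
  have [measurable]: "(\<lambda>\<omega>. LINT t:{0..T}|lborel. f t \<omega>) \<in> borel_measurable M"
    unfolding set_lebesgue_integral_def
    by (rule lborel.borel_measurable_lebesgue_integral) (use swap in \<open>simp add: case_prod_beta'; measurable\<close>)
  show ?B
  proof (rule integrableI_nonneg)
    have "(\<integral>\<^sup>+\<omega>. ennreal ((LINT t:{0..T}|lborel. f t \<omega>) powr p) \<partial>M) \<le> (\<integral>\<^sup>+\<omega>. ennreal (H powr (p - 1)) * (I \<omega> + 1) \<partial>M)"
      by (rule nn_integral_mono_AE, rule AE_mp[OF AEI]) (use key in auto)
    also have "\<dots> = ennreal (H powr (p - 1)) * ((\<integral>\<^sup>+\<omega>. I \<omega> \<partial>M) + 1)"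
      by (simp add: nn_integral_cmult nn_integral_add emeasure_space_1)
    also have "\<dots> < \<infinity>" using EI by (simp add: ennreal_mult_less_top)
    finally show "(\<integral>\<^sup>+\<omega>. ennreal ((LINT t:{0..T}|lborel. f t \<omega>) powr p) \<partial>M) < \<infinity>" .
  qed auto
qed

section \<open>Comparison of the two control classes\<close>

lemma matrix_vector_measurable [measurable (raw)]:
  fixes A :: "real ^ 'n ^ 'm"
  shows "f \<in> borel_measurable N \<Longrightarrow> (\<lambda>x. A *v f x) \<in> borel_measurable N"
  by (rule borel_measurable_continuous_onI[THEN measurable_compose[rotated]])
    (simp add: linear_continuous_on)

context brownian
begin

text \<open>Minkowski's inequality applied to the norm process; its time is clamped because that
  inequality asks for joint measurability on the whole line.\<close>

lemma controls_r_subset_controls: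
  fixes B1 B2 :: "real ^ 'n ^ 'd"
  assumes T: "T > 0" and p: "p > 1"
  shows "controls_r M F T B1 B2 p \<subseteq> controls M F T B1 B2 p"
proof
  fix u assume u: "u \<in> controls_r M F T B1 B2 p"
  then have pm: "progressively_measurable F T u"
    and i: "AE t in lborel. t \<in> {0..T} \<longrightarrow> integrable M (\<lambda>\<omega>. norm (B1 *v u t \<omega>) powr p)"
    and s: "set_integrable lborel {0..T} (\<lambda>t. (LINT \<omega>|M. norm (B1 *v u t \<omega>) powr p) powr (1 / p))"
    by (auto simp: controls_r_def)
  define f where "f t \<omega> = norm (B1 *v u (clamp_time T t) \<omega>)" for t \<omega>
  have eq: "f t \<omega> = norm (B1 *v u t \<omega>)" if "t \<in> {0..T}" for t \<omega> using that by (simp add: f_def)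
  have [measurable]: "(\<lambda>x. u (clamp_time T (fst x)) (snd x)) \<in> borel_measurable (lborel \<Otimes>\<^sub>M M)"
    using progressively_measurable_clamp[OF pm] T by auto
  have f: "(\<lambda>x. f (fst x) (snd x)) \<in> borel_measurable (lborel \<Otimes>\<^sub>M M)"
    unfolding f_def by measurable
  have i': "AE t in lborel. t \<in> {0..T} \<longrightarrow> integrable M (\<lambda>\<omega>. f t \<omega> powr p)"
    using i by (rule AE_mp) (auto simp: eq)
  have s': "set_integrable lborel {0..T} (\<lambda>t. (LINT \<omega>|M. f t \<omega> powr p) powr (1 / p))"
    using s by (subst set_integrable_cong[OF refl refl]) (auto simp: eq)
  note mk = minkowski_integral_finite[OF f _ p T i' s']
  have f0: "0 \<le> f t \<omega>" for t \<omega> by (simp add: f_def)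
  have "set_integrable lborel {0..T} (\<lambda>t. f t \<omega>) = set_integrable lborel {0..T} (\<lambda>t. norm (B1 *v u t \<omega>))" for \<omega>
    by (intro set_integrable_cong) (auto simp: eq)
  moreover have "(LINT t:{0..T}|lborel. f t \<omega>) = (LINT t:{0..T}|lborel. norm (B1 *v u t \<omega>))" for \<omega>
    by (intro set_lebesgue_integral_cong) (auto simp: eq)
  ultimately show "u \<in> controls M F T B1 B2 p"
    using u mk f0 by (auto simp: controls_r_def controls_def)
qed

end

section \<open>The running maximum of Brownian motion\<close>

text \<open>Rounding \<open>t\<close> down to the grid of mesh \<open>T / 2 ^ N\<close> stays inside
  \<open>{0..T}\<close> and converges to \<open>t\<close>. Dyadic grids are nested, which makes the
  events in \<open>sup_V_tail\<close> increase.\<close>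

lemma le_of_dyadic_le:
  fixes f :: "real \<Rightarrow> real"
  assumes cont: "continuous_on {0..T} f" and le: "\<And>N k. k \<le> 2 ^ N \<Longrightarrow> f (T * real k / 2 ^ N) \<le> a"
    and t: "t \<in> {0..T}"
  shows "f t \<le> a"
proof (cases "T = 0")
  case True
  then show ?thesis using le[of 0 0] t by simp
next
  case False
  with t have T: "0 < T" by auto
  define r where "r N = T * real (nat \<lfloor>2 ^ N * (t / T)\<rfloor>) / 2 ^ N" for N :: nat
  have k: "nat \<lfloor>2 ^ N * (t / T)\<rfloor> \<le> 2 ^ N" for N :: nat
  proof -
    have "2 ^ N * (t / T) \<le> 2 ^ N" using t T by (simp add: field_simps)
    then have "\<lfloor>2 ^ N * (t / T)\<rfloor> \<le> int (2 ^ N)" by (simp add: floor_le_iff)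
    then show ?thesis by (simp add: nat_le_iff)
  qed
  have fl: "real (nat \<lfloor>2 ^ N * (t / T)\<rfloor>) = of_int \<lfloor>2 ^ N * (t / T)\<rfloor>" for N :: nat
    using t T by (intro of_nat_nat) simp
  have b: "t - T * (1 / 2) ^ N \<le> r N \<and> r N \<le> t" for N
  proof -
    have "2 ^ N * (t / T) - 1 \<le> of_int \<lfloor>2 ^ N * (t / T)\<rfloor>" "of_int \<lfloor>2 ^ N * (t / T)\<rfloor> \<le> 2 ^ N * (t / T)"
      by linarith+
    then have "T / 2 ^ N * (2 ^ N * (t / T) - 1) \<le> T / 2 ^ N * of_int \<lfloor>2 ^ N * (t / T)\<rfloor>"
      "T / 2 ^ N * of_int \<lfloor>2 ^ N * (t / T)\<rfloor> \<le> T / 2 ^ N * (2 ^ N * (t / T))"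
      using T by (intro mult_left_mono; simp)+
    moreover have "T / 2 ^ N * of_int \<lfloor>2 ^ N * (t / T)\<rfloor> = r N" unfolding r_def fl by simp
    moreover have "T / 2 ^ N * (2 ^ N * (t / T)) = t" "T / 2 ^ N * (2 ^ N * (t / T) - 1) = t - T * (1 / 2) ^ N"
      using T by (simp_all add: right_diff_distrib power_one_over)
    ultimately show ?thesis by simp
  qed
  have "(\<lambda>N. t - T * (1 / 2) ^ N) \<longlonglongrightarrow> t - T * 0"
    by (intro tendsto_intros LIMSEQ_power_zero) simp
  then have lim: "r \<longlonglongrightarrow> t"
    by (intro tendsto_sandwich[of "\<lambda>N. t - T * (1 / 2) ^ N" r sequentially "\<lambda>_. t"]) (use b in auto)
  have "r N \<in> {0..T}" for N
    using b[of N] t T by (auto simp: r_def)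
  then have "(\<lambda>N. f (r N)) \<longlonglongrightarrow> f t"
    using lim t by (intro continuous_on_tendsto_compose[OF cont]) auto
  moreover have "f (r N) \<le> a" for N
    unfolding r_def by (rule le[OF k])
  ultimately show ?thesis by (intro LIMSEQ_le_const2) auto
qed

text \<open>Convexity of an even power, from Bernoulli's inequality for \<open>(1 + d) ^ n\<close>
  scaled by \<open>x ^ n\<close>. In \<open>doob_maximal\<close> the linear term is the one that
  integrates to zero.\<close>

lemma even_power_tangent:
  fixes x y :: real
  assumes "even n" "x \<noteq> 0"
  shows "x ^ n + real n * x ^ (n - 1) * (y - x) \<le> y ^ n"
proof (cases n)
  case (Suc m)
  define d where "d = (y - x) / x"
  have y: "y = x + d * x" using assms(2) by (simp add: d_def)
  have "(1 + real n * d) * x ^ n \<le> (1 + d) ^ n * x ^ n"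
    using assms by (intro mult_right_mono Bernoulli_inequality_even) (auto simp: zero_le_even_power)
  also have "(1 + d) ^ n * x ^ n = y ^ n"
    unfolding y by (simp add: power_mult_distrib[symmetric] distrib_right)
  finally show ?thesis unfolding y Suc by (simp add: algebra_simps)
qed simp

section \<open>A modification with continuous paths, and Doob's inequality\<close>

context brownian
begin

text \<open>Off this null set the paths are continuous and start at \<open>0\<close>; the process \<open>V\<close> below modifies \<open>W\<close>
  to be continuous everywhere.\<close>

definition "exceptional =
  (SOME N. N \<in> null_sets M \<and> {\<omega> \<in> space M. \<not> (W 0 \<omega> = 0 \<and> continuous_on {0..} (\<lambda>t. W t \<omega>))} \<subseteq> N)"

lemma exceptional:
  "exceptional \<in> null_sets M"
  "\<omega> \<in> space M \<Longrightarrow> \<omega> \<notin> exceptional \<Longrightarrow> W 0 \<omega> = 0 \<and> continuous_on {0..} (\<lambda>t. W t \<omega>)"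
proof -
  have "AE \<omega> in M. W 0 \<omega> = 0 \<and> continuous_on {0..} (\<lambda>t. W t \<omega>)"
    using bm by (auto simp: standard_brownian_motion_def)
  then have "\<exists>N. N \<in> null_sets M \<and> {\<omega> \<in> space M. \<not> (W 0 \<omega> = 0 \<and> continuous_on {0..} (\<lambda>t. W t \<omega>))} \<subseteq> N"
    unfolding eventually_ae_filter by (simp only: Bex_def)
  note N = someI_ex[OF this, folded exceptional_def]
  show "exceptional \<in> null_sets M" using N by (rule conjunct1)
  assume "\<omega> \<in> space M" "\<omega> \<notin> exceptional"
  then show "W 0 \<omega> = 0 \<and> continuous_on {0..} (\<lambda>t. W t \<omega>)" using N by blast
qed

definition V :: "real \<Rightarrow> 'a \<Rightarrow> real" where
  "V t \<omega> = (if \<omega> \<in> exceptional then 0 else W t \<omega>)"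

lemma V_0: "\<omega> \<in> space M \<Longrightarrow> V 0 \<omega> = 0"
  using exceptional(2) by (auto simp: V_def)

lemma V_continuous: "\<omega> \<in> space M \<Longrightarrow> S \<subseteq> {0..} \<Longrightarrow> continuous_on S (\<lambda>t. V t \<omega>)"
proof (cases "\<omega> \<in> exceptional")
  case False
  moreover assume "\<omega> \<in> space M" "S \<subseteq> {0..}"
  ultimately show ?thesis
    using continuous_on_subset[of "{0..}" "\<lambda>t. W t \<omega>" S] exceptional(2)[of \<omega>] by (simp add: V_def)
qed (simp add: V_def)

text \<open>This is where the augmentation enters: the exceptional null set belongs to every
  \<open>F t\<close>, so setting the path to \<open>0\<close> on it uses no future
  information.\<close>

lemma V_adapted: "0 \<le> s \<Longrightarrow> s \<le> t \<Longrightarrow> V s \<in> borel_measurable (F t)"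
  unfolding V_def[abs_def]
  using W_adapted[of s t] sets.Int[OF null_sets_augmented_filtration[OF exceptional(1), of W t] sets.top]
  by (intro measurable_If_set) auto

lemma V_measurable: "0 \<le> s \<Longrightarrow> V s \<in> borel_measurable M"
  using measurable_F[OF V_adapted[of s s]] by auto

lemma AE_V_eq: "AE \<omega> in M. \<forall>t. V t \<omega> = W t \<omega>"
  using AE_not_in[OF exceptional(1)] by eventually_elim (simp add: V_def)

lemma AE_W_eq_increment: "AE \<omega> in M. \<forall>t. V t \<omega> = W t \<omega> - W 0 \<omega>"
  using AE_not_in[OF exceptional(1)] AE_space by eventually_elim (simp add: V_def exceptional(2))

lemma V_moment: "0 \<le> t \<Longrightarrow> integrable M (\<lambda>\<omega>. V t \<omega> ^ k)"
proof -
  assume t: "0 \<le> t"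
  have "integrable M (\<lambda>\<omega>. (W t \<omega> - W 0 \<omega>) ^ k)" using increment_moment[of 0 t k] t by simp
  then show ?thesis
  proof (rule integrable_cong_AE_imp)
    show "(\<lambda>\<omega>. V t \<omega> ^ k) \<in> borel_measurable M"
      using V_measurable[OF t] by (rule borel_measurable_power)
    show "AE \<omega> in M. (W t \<omega> - W 0 \<omega>) ^ k = V t \<omega> ^ k"
      using AE_W_eq_increment by (rule eventually_mono) simp
  qed
qed

lemma expectation_times_V_increment:
  assumes st: "0 \<le> s" "s \<le> t" and f: "f \<in> borel_measurable (F s)" "integrable M f"
  shows "integrable M (\<lambda>\<omega>. f \<omega> * (V t \<omega> - V s \<omega>))" "expectation (\<lambda>\<omega>. f \<omega> * (V t \<omega> - V s \<omega>)) = 0"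
proof -
  have [measurable]: "f \<in> borel_measurable M" "V t \<in> borel_measurable M" "V s \<in> borel_measurable M"
    "W t \<in> borel_measurable M" "W s \<in> borel_measurable M"
    using measurable_F[OF f(1)] st V_measurable W_measurable by auto
  have "AE \<omega> in M. f \<omega> * (W t \<omega> - W s \<omega>) = f \<omega> * (V t \<omega> - V s \<omega>)"
    using AE_V_eq by eventually_elim simp
  note ae = this
  show "integrable M (\<lambda>\<omega>. f \<omega> * (V t \<omega> - V s \<omega>))"
    by (rule integrable_cong_AE_imp[OF expectation_times_increment(1)[OF assms] _ ae]) measurable
  have "expectation (\<lambda>\<omega>. f \<omega> * (W t \<omega> - W s \<omega>)) = expectation (\<lambda>\<omega>. f \<omega> * (V t \<omega> - V s \<omega>))"
    by (rule integral_cong_AE[OF _ _ ae]) measurable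
  then show "expectation (\<lambda>\<omega>. f \<omega> * (V t \<omega> - V s \<omega>)) = 0"
    using expectation_times_increment(2)[OF assms] by simp
qed

text \<open>On the event \<open>A i\<close> of first passing the level \<open>a\<close> at index
  \<open>i\<close>, the tangent at \<open>V (\<tau> i)\<close> bounds \<open>V T ^ n\<close> from
  below by \<open>a ^ n\<close> plus a term linear in \<open>V T - V (\<tau> i)\<close>. Its
  coefficient is known at time \<open>\<tau> i\<close>, so the linear term has mean zero; the events
  are disjoint, and the bounds add up.\<close>

lemma doob_maximal:
  fixes \<tau> :: "nat \<Rightarrow> real"
  assumes n: "even n" and a: "0 < a" and \<tau>: "\<And>i. i \<le> N \<Longrightarrow> 0 \<le> \<tau> i \<and> \<tau> i \<le> T"
    and mono: "\<And>i j. i \<le> j \<Longrightarrow> j \<le> N \<Longrightarrow> \<tau> i \<le> \<tau> j"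
  shows "a ^ n * prob {\<omega> \<in> space M. \<exists>i\<le>N. a < \<bar>V (\<tau> i) \<omega>\<bar>} \<le> expectation (\<lambda>\<omega>. V T \<omega> ^ n)"
proof -
  have T: "0 \<le> T" using \<tau>[of 0] by auto
  define A where "A i = {\<omega> \<in> space M. a < \<bar>V (\<tau> i) \<omega>\<bar> \<and> (\<forall>j\<in>{..<i}. \<bar>V (\<tau> j) \<omega>\<bar> \<le> a)}" for i
  have AF: "A i \<in> sets (F (\<tau> i))" if i: "i \<le> N" for i
  proof -
    have Vm: "V (\<tau> j) \<in> borel_measurable (F (\<tau> i))" if "j \<le> i" for j
      using that i \<tau>[of j] mono[of j i] by (intro V_adapted) auto
    have "{\<omega> \<in> space (F (\<tau> i)). a < \<bar>V (\<tau> i) \<omega>\<bar>} \<in> sets (F (\<tau> i))"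
      using borel_measurable_less[OF borel_measurable_const borel_measurable_abs[OF Vm[OF order_refl]]] .
    moreover have "{\<omega> \<in> space (F (\<tau> i)). \<bar>V (\<tau> j) \<omega>\<bar> \<le> a} \<in> sets (F (\<tau> i))" if "j \<in> {..<i}" for j
      using borel_measurable_le[OF borel_measurable_abs[OF Vm[of j]] borel_measurable_const] that by simp
    ultimately have "{\<omega> \<in> space (F (\<tau> i)). a < \<bar>V (\<tau> i) \<omega>\<bar> \<and> (\<forall>j\<in>{..<i}. \<bar>V (\<tau> j) \<omega>\<bar> \<le> a)} \<in> sets (F (\<tau> i))"
      by (intro sets.sets_Collect_conj sets.sets_Collect_finite_All) auto
    then show ?thesis by (simp add: A_def)
  qed
  have AM[measurable]: "A i \<in> sets M" if "i \<le> N" for i using AF[OF that] sets_F_subset by auto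
  have VT: "integrable M (\<lambda>\<omega>. V T \<omega> ^ n)" by (rule V_moment[OF T])
  have step: "a ^ n * prob (A i) \<le> expectation (\<lambda>\<omega>. indicator (A i) \<omega> * V T \<omega> ^ n)" if i: "i \<le> N" for i
  proof -
    let ?f = "\<lambda>\<omega>. real n * (indicator (A i) \<omega> * V (\<tau> i) \<omega> ^ (n - 1))"
    have t: "0 \<le> \<tau> i" "\<tau> i \<le> T" using \<tau>[OF i] by auto
    have ind: "integrable M (\<lambda>\<omega>. indicator (A i) \<omega> * V s \<omega> ^ k)" if "0 \<le> s" for s k
      using integrable_mult_indicator[OF AM[OF i] V_moment[OF that, of k]] by simp
    have f: "?f \<in> borel_measurable (F (\<tau> i))" "integrable M ?f"
      using AF[OF i] V_adapted[OF t(1) order_refl] ind[OF t(1)] by auto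
    have ae: "indicator (A i) \<omega> * a ^ n + ?f \<omega> * (V T \<omega> - V (\<tau> i) \<omega>) \<le> indicator (A i) \<omega> * V T \<omega> ^ n" for \<omega>
    proof (cases "\<omega> \<in> A i")
      case True
      then have av: "a < \<bar>V (\<tau> i) \<omega>\<bar>" by (simp add: A_def)
      have "a ^ n \<le> \<bar>V (\<tau> i) \<omega>\<bar> ^ n" using av a by (intro power_mono) auto
      also have "\<dots> = V (\<tau> i) \<omega> ^ n" using n by (simp add: power_even_abs)
      finally show ?thesis
        using True even_power_tangent[OF n, of "V (\<tau> i) \<omega>" "V T \<omega>"] av a by (cases "V (\<tau> i) \<omega> = 0") auto
    qed simp
    have "a ^ n * prob (A i) = expectation (\<lambda>\<omega>. indicator (A i) \<omega> * a ^ n + ?f \<omega> * (V T \<omega> - V (\<tau> i) \<omega>))"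
      using expectation_times_V_increment[OF t f] AM[OF i] ind[of 0 0]
      by (subst Bochner_Integration.integral_add) (auto simp: mult.commute)
    also have "\<dots> \<le> expectation (\<lambda>\<omega>. indicator (A i) \<omega> * V T \<omega> ^ n)"
      using expectation_times_V_increment[OF t f] AM[OF i] ind[OF T] ind[of 0 0] ae
      by (intro integral_mono Bochner_Integration.integrable_add) auto
    finally show ?thesis .
  qed
  have U: "{\<omega> \<in> space M. \<exists>i\<le>N. a < \<bar>V (\<tau> i) \<omega>\<bar>} = (\<Union>i\<in>{..N}. A i)"
  proof (intro equalityI subsetI)
    fix \<omega> assume w: "\<omega> \<in> {\<omega> \<in> space M. \<exists>i\<le>N. a < \<bar>V (\<tau> i) \<omega>\<bar>}"
    define i where "i = (LEAST i. a < \<bar>V (\<tau> i) \<omega>\<bar>)"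
    obtain i0 where i0: "i0 \<le> N" "a < \<bar>V (\<tau> i0) \<omega>\<bar>" using w by auto
    have "a < \<bar>V (\<tau> i) \<omega>\<bar>" "i \<le> i0" unfolding i_def using i0 by (auto intro: LeastI Least_le)
    moreover have "\<bar>V (\<tau> j) \<omega>\<bar> \<le> a" if "j < i" for j using not_less_Least[of j "\<lambda>i. a < \<bar>V (\<tau> i) \<omega>\<bar>"] that by (auto simp: i_def)
    ultimately show "\<omega> \<in> (\<Union>i\<in>{..N}. A i)" using w i0 by (auto simp: A_def intro!: bexI[of _ i])
  qed (auto simp: A_def)
  have disj: "disjoint_family_on A {..N}"
  proof (unfold disjoint_family_on_def, intro ballI impI)
    fix i j :: nat assume "i \<noteq> j"
    then show "A i \<inter> A j = {}"
      by (cases i j rule: linorder_cases) (force simp: A_def)+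
  qed
  have "a ^ n * prob (\<Union>i\<in>{..N}. A i) = (\<Sum>i\<le>N. a ^ n * prob (A i))"
    using disj by (subst finite_measure_finite_Union) (auto simp: sum_distrib_left)
  also have "\<dots> \<le> (\<Sum>i\<le>N. expectation (\<lambda>\<omega>. indicator (A i) \<omega> * V T \<omega> ^ n))"
    by (intro sum_mono step) auto
  also have "\<dots> = expectation (\<lambda>\<omega>. \<Sum>i\<le>N. indicator (A i) \<omega> * V T \<omega> ^ n)"
    using integrable_mult_indicator[OF AM VT] by (intro Bochner_Integration.integral_sum[symmetric]) auto
  also have "\<dots> \<le> expectation (\<lambda>\<omega>. V T \<omega> ^ n)"
  proof (rule integral_mono)
    show "integrable M (\<lambda>\<omega>. \<Sum>i\<le>N. indicator (A i) \<omega> * V T \<omega> ^ n)"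
      using integrable_mult_indicator[OF AM VT] by (intro Bochner_Integration.integrable_sum) auto
    fix \<omega>
    have "(\<Sum>i\<le>N. indicator (A i) \<omega> * V T \<omega> ^ n) = indicator (\<Union>i\<in>{..N}. A i) \<omega> * V T \<omega> ^ n"
      using disj by (subst indicator_UN_disjoint) (auto simp: sum_distrib_right)
    also have "\<dots> \<le> 1 * V T \<omega> ^ n"
      using n by (intro mult_right_mono) (auto simp: zero_le_even_power indicator_def)
    finally show "(\<Sum>i\<le>N. indicator (A i) \<omega> * V T \<omega> ^ n) \<le> V T \<omega> ^ n" by simp
  qed (rule VT)
  finally show ?thesis unfolding U .
qed

section \<open>Tail and moments of the running supremum\<close>

definition sup_V :: "real \<Rightarrow> 'a \<Rightarrow> real" where
  "sup_V T \<omega> = (SUP t\<in>{0..T}. \<bar>V t \<omega>\<bar>)"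

lemma V_bdd_above: "\<omega> \<in> space M \<Longrightarrow> bdd_above ((\<lambda>t. \<bar>V t \<omega>\<bar>) ` {0..T})"
  by (intro bounded_imp_bdd_above compact_imp_bounded compact_continuous_image continuous_on_rabs V_continuous) auto

lemma abs_V_le_sup_V: "\<omega> \<in> space M \<Longrightarrow> t \<in> {0..T} \<Longrightarrow> \<bar>V t \<omega>\<bar> \<le> sup_V T \<omega>"
  unfolding sup_V_def by (rule cSUP_upper[OF _ V_bdd_above, of t])

lemma sup_V_nonneg: "\<omega> \<in> space M \<Longrightarrow> 0 \<le> T \<Longrightarrow> 0 \<le> sup_V T \<omega>"
  using abs_V_le_sup_V[of \<omega> 0 T] by auto

text \<open>By path continuity the supremum is decided on the dyadic grids. This makes
  \<open>sup_V T\<close> measurable and its tail events countable unions.\<close>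

lemma sup_V_le_iff:
  assumes "\<omega> \<in> space M" "0 \<le> T"
  shows "sup_V T \<omega> \<le> a \<longleftrightarrow> (\<forall>N. \<forall>k\<le>2 ^ N. \<bar>V (T * real k / 2 ^ N) \<omega>\<bar> \<le> a)"
proof
  assume s: "sup_V T \<omega> \<le> a"
  show "\<forall>N. \<forall>k\<le>2 ^ N. \<bar>V (T * real k / 2 ^ N) \<omega>\<bar> \<le> a"
  proof (intro allI impI)
    fix N k :: nat assume "k \<le> 2 ^ N"
    then have "real k \<le> real (2 ^ N)" by (simp only: of_nat_le_iff)
    then have "T * real k / 2 ^ N \<in> {0..T}"
      using assms by (auto simp: divide_simps mult_left_mono)
    from abs_V_le_sup_V[OF assms(1) this] s show "\<bar>V (T * real k / 2 ^ N) \<omega>\<bar> \<le> a" by simp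
  qed
next
  assume "\<forall>N. \<forall>k\<le>2 ^ N. \<bar>V (T * real k / 2 ^ N) \<omega>\<bar> \<le> a"
  then have le: "\<And>N k. k \<le> 2 ^ N \<Longrightarrow> \<bar>V (T * real k / 2 ^ N) \<omega>\<bar> \<le> a" by blast
  have cont: "continuous_on {0..T} (\<lambda>t. \<bar>V t \<omega>\<bar>)"
    by (intro continuous_on_rabs V_continuous assms) auto
  show "sup_V T \<omega> \<le> a"
    unfolding sup_V_def using assms(2) le_of_dyadic_le[OF cont le] by (intro cSUP_least) auto
qed

lemma sup_V_measurable: 
  assumes T: "0 \<le> T"
  shows "sup_V T \<in> borel_measurable M"
proof (rule borel_measurableI_le)
  fix a
  have m: "V (T * real k / 2 ^ N) \<in> borel_measurable M" for k N
    using T by (intro V_measurable) auto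
  have "{\<omega> \<in> space M. sup_V T \<omega> \<le> a} = {\<omega> \<in> space M. \<forall>N. \<forall>k\<in>{..2 ^ N}. \<bar>V (T * real k / 2 ^ N) \<omega>\<bar> \<le> a}"
    using sup_V_le_iff[OF _ T] by auto
  also have "\<dots> \<in> sets M"
    using borel_measurable_le[OF borel_measurable_abs[OF m] borel_measurable_const]
    by (intro sets.sets_Collect_countable_All sets.sets_Collect_finite_All) auto
  finally show "{\<omega> \<in> space M. sup_V T \<omega> \<le> a} \<in> sets M" .
qed

text \<open>The bound from \<open>doob_maximal\<close> is the same for every grid, and the events
  \<open>E N\<close> increase to the tail event of the supremum because the grids are
  nested.\<close>

lemma sup_V_tail:
  assumes n: "even n" and a: "0 < a" and T: "0 \<le> T"
  shows "prob {\<omega> \<in> space M. a < sup_V T \<omega>} \<le> expectation (\<lambda>\<omega>. V T \<omega> ^ n) / a ^ n"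
proof -
  define E where "E N = {\<omega> \<in> space M. \<exists>k\<le>2 ^ N. a < \<bar>V (T * real k / 2 ^ N) \<omega>\<bar>}" for N :: nat
  have E: "E N \<in> sets M" for N
  proof -
    have m: "V (T * real k / 2 ^ N) \<in> borel_measurable M" for k
      using T by (intro V_measurable) auto
    have "E N = {\<omega> \<in> space M. \<exists>k\<in>{..2 ^ N}. a < \<bar>V (T * real k / 2 ^ N) \<omega>\<bar>}" by (auto simp: E_def)
    also have "\<dots> \<in> sets M"
      using borel_measurable_less[OF borel_measurable_const borel_measurable_abs[OF m]]
      by (intro sets.sets_Collect_finite_Ex) auto
    finally show ?thesis .
  qed
  have U: "{\<omega> \<in> space M. a < sup_V T \<omega>} = (\<Union>N. E N)"
    using sup_V_le_iff[OF _ T, of _ a] unfolding E_def by (auto simp: not_le[symmetric])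
  have inc: "incseq E"
  proof (rule incseq_SucI, rule subsetI)
    fix N \<omega> assume "\<omega> \<in> E N"
    then obtain k where k: "\<omega> \<in> space M" "k \<le> 2 ^ N" "a < \<bar>V (T * real k / 2 ^ N) \<omega>\<bar>" by (auto simp: E_def)
    have "T * real (2 * k) / 2 ^ Suc N = T * real k / 2 ^ N" by simp
    with k show "\<omega> \<in> E (Suc N)" by (auto simp: E_def intro!: exI[of _ "2 * k"])
  qed
  have le: "prob (E N) \<le> expectation (\<lambda>\<omega>. V T \<omega> ^ n) / a ^ n" for N
  proof -
    have "a ^ n * prob {\<omega> \<in> space M. \<exists>i\<le>2 ^ N. a < \<bar>V (T * real i / 2 ^ N) \<omega>\<bar>} \<le> expectation (\<lambda>\<omega>. V T \<omega> ^ n)"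
    proof (rule doob_maximal[OF n a])
      fix i :: nat assume "i \<le> 2 ^ N"
      then have "real i \<le> real (2 ^ N)" by (simp only: of_nat_le_iff)
      then show "0 \<le> T * real i / 2 ^ N \<and> T * real i / 2 ^ N \<le> T"
        using T by (auto simp: divide_simps mult_left_mono)
    next
      fix i j :: nat assume "i \<le> j"
      then show "T * real i / 2 ^ N \<le> T * real j / 2 ^ N"
        using T by (intro divide_right_mono mult_left_mono) auto
    qed
    then show ?thesis using a by (simp add: E_def field_simps)
  qed
  have "(\<lambda>N. prob (E N)) \<longlonglongrightarrow> prob (\<Union>N. E N)"
    using E inc by (intro finite_Lim_measure_incseq) auto
  then show ?thesis unfolding U by (rule LIMSEQ_le_const2) (use le in auto)
qed

text \<open>Summation over unit levels with the tail estimate of exponent \<open>2 * m + 2\<close>: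
  it is even, as \<open>sup_V_tail\<close> requires, and leaves terms that decay at least like an
  inverse square.\<close>

lemma sup_V_moment:
  assumes T: "0 \<le> T"
  shows "integrable M (\<lambda>\<omega>. sup_V T \<omega> ^ m)"
proof (rule integrableI_nonneg)
  note [measurable] = sup_V_measurable[OF T]
  show "(\<lambda>\<omega>. sup_V T \<omega> ^ m) \<in> borel_measurable M" by measurable
  show "AE \<omega> in M. 0 \<le> sup_V T \<omega> ^ m" using sup_V_nonneg[OF _ T] by (intro AE_I2) auto
  define K where "K = expectation (\<lambda>\<omega>. V T \<omega> ^ (2 * m + 2))"
  have K0: "0 \<le> K" unfolding K_def by (intro integral_nonneg_AE AE_I2 zero_le_even_power) simp
  define c where "c N = (if N = 0 then 1 else 0) + 2 ^ m * K * inverse (real N ^ 2)" for N :: nat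
  have c0: "0 \<le> c N" for N using K0 by (simp add: c_def)
  have "summable c"
    unfolding c_def[abs_def]
    by (intro summable_add summable_mult inverse_power_summable summable_single[of 0 "\<lambda>_. 1", simplified]) auto
  have tail: "real (Suc N) ^ m * prob {\<omega> \<in> space M. real N < sup_V T \<omega>} \<le> c N" for N
  proof (cases "N = 0")
    case True
    then show ?thesis using prob_le_1 K0 by (simp add: c_def)
  next
    case False
    then have N: "1 \<le> real N" "0 < real N" by auto
    have "real (Suc N) ^ m \<le> (2 * real N) ^ m" using N by (intro power_mono) auto
    moreover have "prob {\<omega> \<in> space M. real N < sup_V T \<omega>} \<le> K / real N ^ (2 * m + 2)"
      unfolding K_def using sup_V_tail[OF _ N(2) T, of "2 * m + 2"] by simp
    ultimately have "real (Suc N) ^ m * prob {\<omega> \<in> space M. real N < sup_V T \<omega>} \<le>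
        (2 * real N) ^ m * (K / real N ^ (2 * m + 2))"
      using N by (intro mult_mono) auto
    also have "\<dots> = 2 ^ m * K / (real N ^ m * real N ^ 2)"
      using N by (simp add: power_mult_distrib power_add power_mult power2_eq_square field_simps)
    also have "\<dots> \<le> 2 ^ m * K / (1 * real N ^ 2)"
      using N K0 one_le_power[OF N(1), of m] by (intro divide_left_mono mult_right_mono) auto
    finally show ?thesis using False by (simp add: c_def divide_inverse)
  qed
  have "(\<integral>\<^sup>+\<omega>. ennreal (sup_V T \<omega> ^ m) \<partial>M) \<le>
      (\<integral>\<^sup>+\<omega>. 1 + (\<Sum>N. ennreal (real (Suc N) ^ m) * indicator {\<omega> \<in> space M. real N < sup_V T \<omega>} \<omega>) \<partial>M)"
  proof (rule nn_integral_mono)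
    fix \<omega> assume w: "\<omega> \<in> space M"
    let ?s = "sup_V T \<omega>"
    let ?g = "\<lambda>N. ennreal (real (Suc N) ^ m) * indicator {\<omega> \<in> space M. real N < sup_V T \<omega>} \<omega>"
    have s0: "0 \<le> ?s" by (rule sup_V_nonneg[OF w T])
    show "ennreal (?s ^ m) \<le> 1 + (\<Sum>N. ?g N)"
    \<comment> \<open>The value \<open>?s = 0\<close> lies in none of the level sets; the summand
      \<open>1\<close> covers it, including \<open>0 ^ 0 = 1\<close>.\<close>
    proof (cases "?s = 0")
      case True
      then have "?s ^ m \<le> 1" by (simp add: power_le_one)
      then have "ennreal (?s ^ m) \<le> 1" by (metis ennreal_1 ennreal_leI)
      then show ?thesis by (simp add: add_increasing2)
    next
      case False
      \<comment> \<open>The level with \<open>N < ?s\<close> and \<open>?s \<le> N + 1\<close>; the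
        ceiling is taken because the level sets are given by a strict inequality.\<close>
      define N where "N = nat \<lceil>?s\<rceil> - 1"
      have "real N < ?s" "?s \<le> real (Suc N)" using False s0 unfolding N_def by linarith+
      then have "ennreal (?s ^ m) \<le> ?g N" using w s0 by (auto intro!: ennreal_leI power_mono)
      also have "\<dots> \<le> (\<Sum>N. ?g N)" 
        using sum_le_suminf[of ?g "{N}"]
        by (simp only: sum.insert finite.intros empty_iff not_False_eq_True sum.empty add_0_right summableI zero_le simp_thms)
      finally show ?thesis by (simp add: add_increasing)
    qed
  qed
  also have "\<dots> = 1 + (\<Sum>N. ennreal (real (Suc N) ^ m) * emeasure M {\<omega> \<in> space M. real N < sup_V T \<omega>})"
    by (simp add: nn_integral_add nn_integral_suminf nn_integral_cmult emeasure_space_1)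
  also have "\<dots> = 1 + (\<Sum>N. ennreal (real (Suc N) ^ m * prob {\<omega> \<in> space M. real N < sup_V T \<omega>}))"
    by (simp add: emeasure_eq_measure ennreal_mult)
  also have "\<dots> \<le> 1 + (\<Sum>N. ennreal (c N))"
    by (intro add_left_mono suminf_le ennreal_leI tail) auto
  also have "\<dots> < \<infinity>"
    using \<open>summable c\<close> c0 by (simp add: suminf_ennreal2)
  finally show "(\<integral>\<^sup>+\<omega>. ennreal (sup_V T \<omega> ^ m) \<partial>M) < \<infinity>" .
qed

lemma sup_V_powr:
  assumes T: "0 \<le> T" and p: "0 < p"
  shows "integrable M (\<lambda>\<omega>. sup_V T \<omega> powr p)"
proof (rule Bochner_Integration.integrable_bound)
  note [measurable] = sup_V_measurable[OF T]
  show "integrable M (\<lambda>\<omega>. 1 + sup_V T \<omega> ^ nat \<lceil>p\<rceil>)" using sup_V_moment[OF T] by auto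
  show "(\<lambda>\<omega>. sup_V T \<omega> powr p) \<in> borel_measurable M" by measurable
  show "AE \<omega> in M. norm (sup_V T \<omega> powr p) \<le> norm (1 + sup_V T \<omega> ^ nat \<lceil>p\<rceil>)"
  proof (rule AE_I2)
    fix \<omega> assume "\<omega> \<in> space M"
    then have s0: "0 \<le> sup_V T \<omega>" by (rule sup_V_nonneg[OF _ T])
    have "sup_V T \<omega> powr p \<le> 1 + sup_V T \<omega> ^ nat \<lceil>p\<rceil>"
    proof (cases "sup_V T \<omega> \<le> 1")
      case True
      then have "sup_V T \<omega> powr p \<le> 1" using s0 p by (intro powr_le1) auto
      then show ?thesis using s0 by (simp add: add_increasing2)
    next
      case False
      then have "sup_V T \<omega> powr p \<le> sup_V T \<omega> powr (real (nat \<lceil>p\<rceil>))"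
        using p by (intro powr_mono) linarith+
      then show ?thesis using False by (simp add: powr_realpow)
    qed
    then show "norm (sup_V T \<omega> powr p) \<le> norm (1 + sup_V T \<omega> ^ nat \<lceil>p\<rceil>)" using s0 by simp
  qed
qed

end

section \<open>Integrals of smooth deterministic functions\<close>

lemma integral_split_sum:
  fixes f :: "real \<Rightarrow> 'b::euclidean_space" and a :: "nat \<Rightarrow> real"
  assumes mono: "\<And>i. i < n \<Longrightarrow> a i \<le> a (Suc i)" and cont: "continuous_on {a 0..a n} f"
  shows "integral {a 0..a n} f = (\<Sum>i<n. integral {a i..a (Suc i)} f)"
  using assms
proof (induction n)
  case (Suc n)
  have a0: "a 0 \<le> a m" if "m \<le> n" for m
    using that
  proof (induction m)
    case (Suc m)
    then show ?case using Suc.prems \<open>\<And>i. i < Suc n \<Longrightarrow> a i \<le> a (Suc i)\<close>[of m] by simp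
  qed simp
  have an: "a n \<le> a (Suc n)" using Suc.prems(1)[of n] by simp
  have "integral {a 0..a (Suc n)} f = integral {a 0..a n} f + integral {a n..a (Suc n)} f"
    using Henstock_Kurzweil_Integration.integral_combine[OF a0[OF order_refl] an integrable_continuous_real[OF Suc.prems(2)]]
    by simp
  also have "integral {a 0..a n} f = (\<Sum>i<n. integral {a i..a (Suc i)} f)"
    using an by (intro Suc.IH Suc.prems(1) continuous_on_subset[OF Suc.prems(2)]) auto
  finally show ?case by simp
qed simp

context brownian
begin

text \<open>Time is rounded down to the grid of mesh \<open>1 / Suc n\<close>, which leaves
  countably many values, each known by then; path continuity gives the limit.\<close>

lemma continuous_adapted_progressive:
  fixes X :: "real \<Rightarrow> 'a \<Rightarrow> 'b::euclidean_space"
  assumes ad: "\<And>t. t \<in> {0..T} \<Longrightarrow> X t \<in> borel_measurable (F t)"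
    and cont: "\<And>\<omega>. \<omega> \<in> space M \<Longrightarrow> continuous_on {0..T} (\<lambda>t. X t \<omega>)"
  shows "progressively_measurable F T X"
  unfolding progressively_measurable_def
proof
  fix t assume t: "t \<in> {0..T}"
  let ?N = "restrict_space borel {0..t} \<Otimes>\<^sub>M F t"
  define k where "k n x = nat \<lfloor>real (Suc n) * fst x\<rfloor>" for n and x :: "real \<times> 'a"
  \<comment> \<open>For times up to \<open>t\<close> the minimum has no effect. It makes every index
    admissible in the countable composition, also those whose grid point lies beyond
    \<open>t\<close>.\<close>
  define Y where "Y n x = X (min t (real (k n x) / real (Suc n))) (snd x)" for n x
  have "Y n \<in> borel_measurable ?N" for n
  proof -
    have f: "fst \<in> borel_measurable ?N"
      using measurable_compose[OF measurable_fst measurable_restrict_space1[of "\<lambda>x. x" borel borel "{0..t}"]] by simp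
    have 1: "(\<lambda>x. X (min t (real i / real (Suc n))) (snd x)) \<in> borel_measurable ?N" for i
    proof -
      have "X (min t (real i / real (Suc n))) \<in> borel_measurable (F t)"
        using t by (intro measurable_augmented_filtration_mono[OF ad]) auto
      then show ?thesis by (rule measurable_compose[OF measurable_snd])
    qed
    have 2: "k n \<in> measurable ?N (count_space UNIV)"
      unfolding k_def[abs_def] using f by measurable
    show ?thesis unfolding Y_def[abs_def] by (rule measurable_compose_countable[OF 1 2])
  qed
  moreover have "(\<lambda>n. Y n x) \<longlonglongrightarrow> (\<lambda>(s, \<omega>). X s \<omega>) x" if x: "x \<in> space ?N" for x
  proof -
    obtain s \<omega> where xs: "x = (s, \<omega>)" "s \<in> {0..t}" "\<omega> \<in> space M"
      using x by (auto simp: space_pair_measure space_restrict_space)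
    let ?r = "\<lambda>n. min t (real (k n x) / real (Suc n))"
    have b: "s - 1 / real (Suc n) \<le> real (k n x) / real (Suc n) \<and> real (k n x) / real (Suc n) \<le> s" for n
    proof -
      have "0 \<le> real (Suc n) * s" using xs by simp
      then have "real (Suc n) * s - 1 \<le> real (k n x)" "real (k n x) \<le> real (Suc n) * s"
        unfolding k_def xs by simp_all
      then have "s \<le> (real (k n x) + 1) / real (Suc n)" "real (k n x) / real (Suc n) \<le> s"
        by (simp_all add: pos_le_divide_eq pos_divide_le_eq mult.commute del: of_nat_Suc)
      then show ?thesis unfolding add_divide_distrib by simp
    qed
    have r: "s - 1 / real (Suc n) \<le> ?r n \<and> ?r n \<le> s \<and> 0 \<le> ?r n" for n using b[of n] xs by auto
    have "(\<lambda>n. s - 1 / real (Suc n)) \<longlonglongrightarrow> s - 0" by (intro tendsto_intros LIMSEQ_Suc lim_1_over_n)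
    then have "?r \<longlonglongrightarrow> s"
      by (intro tendsto_sandwich[of "\<lambda>n. s - 1 / real (Suc n)" ?r sequentially "\<lambda>_. s"]) (use r in auto)
    moreover have "?r n \<in> {0..T}" for n using r[of n] t xs by auto
    ultimately have "(\<lambda>n. X (?r n) \<omega>) \<longlonglongrightarrow> X s \<omega>"
      using xs t by (intro continuous_on_tendsto_compose[OF cont]) auto
    then show ?thesis by (simp add: Y_def xs)
  qed
  ultimately show "(\<lambda>(s, \<omega>). X s \<omega>) \<in> borel_measurable ?N"
    by (rule borel_measurable_LIMSEQ_metric)
qed

text \<open>\<open>wiener H H'\<close> is \<open>\<integral> H dW\<close> after partial integration, where \<open>H'\<close> is the derivative of \<open>H\<close>.\<close>

definition wiener :: "(real \<Rightarrow> 'b) \<Rightarrow> (real \<Rightarrow> 'b) \<Rightarrow> real \<Rightarrow> 'a \<Rightarrow> 'b::euclidean_space" where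
  "wiener H H' t \<omega> = V t \<omega> *\<^sub>R H t - integral {0..t} (\<lambda>s. V s \<omega> *\<^sub>R H' s)"

text \<open>The left-endpoint sum for the integral of \<open>H\<close> against \<open>V\<close>, on
  \<open>Suc n\<close> equal pieces of \<open>{0..t}\<close>.\<close>

definition wiener_sum :: "(real \<Rightarrow> 'b) \<Rightarrow> real \<Rightarrow> nat \<Rightarrow> 'a \<Rightarrow> 'b::euclidean_space" where
  "wiener_sum H t n \<omega> = (\<Sum>i<Suc n. (V (t * real (Suc i) / real (Suc n)) \<omega> - V (t * real i / real (Suc n)) \<omega>)
      *\<^sub>R H (t * real i / real (Suc n)))"

context
  fixes H H' :: "real \<Rightarrow> 'b::euclidean_space" and T K :: real
  assumes H: "\<And>s. s \<in> {0..T} \<Longrightarrow> (H has_vector_derivative H' s) (at s within {0..T})"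
    and H': "continuous_on {0..T} H'"
    and K: "\<And>s. s \<in> {0..T} \<Longrightarrow> norm (H' s) \<le> K"
begin

lemma increment_H: "0 \<le> a \<Longrightarrow> a \<le> b \<Longrightarrow> b \<le> T \<Longrightarrow> integral {a..b} H' = H b - H a"
  by (intro integral_unique fundamental_theorem_of_calculus has_vector_derivative_within_subset[OF H]) auto

lemma norm_increment_H:
  assumes "0 \<le> a" "a \<le> b" "b \<le> T"
  shows "norm (H b - H a) \<le> K * (b - a)"
  unfolding increment_H[OF assms, symmetric]
  using assms by (intro integral_bound continuous_on_subset[OF H'] K) auto

lemma continuous_wiener_integrand:
  "\<omega> \<in> space M \<Longrightarrow> S \<subseteq> {0..T} \<Longrightarrow> continuous_on S (\<lambda>s. V s \<omega> *\<^sub>R H' s)"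
  by (intro continuous_on_scaleR V_continuous continuous_on_subset[OF H']) auto

lemma continuous_wiener:
  assumes "\<omega> \<in> space M"
  shows "continuous_on {0..T} (\<lambda>t. wiener H H' t \<omega>)"
proof -
  have "continuous_on {0..T} H"
    using has_vector_derivative_continuous[OF H] by (simp add: continuous_on_eq_continuous_within)
  then show ?thesis
    unfolding wiener_def using assms
    by (intro continuous_on_diff continuous_on_scaleR V_continuous indefinite_integral_continuous_1
        integrable_continuous_real continuous_wiener_integrand) auto
qed

text \<open>\<open>H\<close> is bounded by \<open>norm (H 0) + K * T\<close>, and the integral part
  by \<open>K * T\<close> times the running supremum. The bound is pathwise and uniform in
  \<open>t\<close>, so moments of the supremum of the noise reduce to those of
  \<open>sup_V T\<close>.\<close>

lemma norm_wiener_le: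
  assumes w: "\<omega> \<in> space M" and t: "t \<in> {0..T}"
  shows "norm (wiener H H' t \<omega>) \<le> (norm (H 0) + 2 * K * T) * sup_V T \<omega>"
proof -
  have S: "0 \<le> sup_V T \<omega>" using sup_V_nonneg[OF w] t by simp
  have K0: "0 \<le> K" using K[OF t] norm_ge_zero[of "H' t"] by linarith
  have "norm (H t) \<le> norm (H 0) + norm (H t - H 0)" by (metis add.commute diff_add_cancel norm_triangle_ineq)
  also have "\<dots> \<le> norm (H 0) + K * T"
    using norm_increment_H[of 0 t] t K0 mult_left_mono[of t T K] by auto
  finally have Ht: "norm (H t) \<le> norm (H 0) + K * T" .
  have "norm (wiener H H' t \<omega>) \<le> norm (V t \<omega> *\<^sub>R H t) + norm (integral {0..t} (\<lambda>s. V s \<omega> *\<^sub>R H' s))"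
    unfolding wiener_def by (rule norm_triangle_ineq4)
  also have "norm (V t \<omega> *\<^sub>R H t) \<le> sup_V T \<omega> * (norm (H 0) + K * T)"
    using abs_V_le_sup_V[OF w t] Ht S by (simp add: mult_mono)
  also have "norm (integral {0..t} (\<lambda>s. V s \<omega> *\<^sub>R H' s)) \<le> (sup_V T \<omega> * K) * (t - 0)"
    using t w abs_V_le_sup_V[OF w] S K
    by (intro integral_bound continuous_wiener_integrand) (auto intro!: mult_mono)
  also have "(sup_V T \<omega> * K) * (t - 0) \<le> sup_V T \<omega> * K * T"
    using t S K0 by (simp add: mult_left_mono)
  finally show ?thesis by (simp add: algebra_simps)
qed

text \<open>Abel summation moves the increments from \<open>V\<close> to \<open>H\<close>, and
  increments of \<open>H\<close> are integrals of \<open>H'\<close>; up to sign the error is the sum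
  of the integrals of \<open>(V (a (Suc i)) \<omega> - V s \<omega>) *\<^sub>R H' s\<close>. It is
  used with a small \<open>e\<close> from uniform continuity and with
  \<open>e = 2 * sup_V T \<omega>\<close> for domination.\<close>

lemma wiener_sum_error:
  assumes w: "\<omega> \<in> space M" and t: "t \<in> {0..T}"
    and e: "\<And>s s'. s \<in> {0..T} \<Longrightarrow> s' \<in> {0..T} \<Longrightarrow> \<bar>s - s'\<bar> \<le> t / real (Suc n) \<Longrightarrow> \<bar>V s \<omega> - V s' \<omega>\<bar> \<le> e"
  shows "norm (wiener_sum H t n \<omega> - wiener H H' t \<omega>) \<le> e * K * t"
proof -
  define a where "a i = t * real i / real (Suc n)" for i
  have a: "0 \<le> a i" "a i \<le> a (Suc i)" "a (Suc i) - a i = t / real (Suc n)" for i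
    using t by (auto simp: a_def simp flip: diff_divide_distrib right_diff_distrib
        intro!: divide_right_mono mult_left_mono)
  have a0: "a 0 = 0" and an: "a (Suc n) = t" by (simp_all add: a_def)
  have aT: "a i \<le> T" if "i \<le> Suc n" for i
  proof -
    have "a i \<le> t * real (Suc n) / real (Suc n)"
      unfolding a_def using t that by (intro divide_right_mono mult_left_mono) (auto simp del: of_nat_Suc)
    then show ?thesis using t by simp
  qed
  have e0: "0 \<le> e" using e[of 0 0] t by auto
  have int: "integral {a i..a (Suc i)} (\<lambda>s. (V (a (Suc i)) \<omega> - V s \<omega>) *\<^sub>R H' s) =
      V (a (Suc i)) \<omega> *\<^sub>R (H (a (Suc i)) - H (a i)) - integral {a i..a (Suc i)} (\<lambda>s. V s \<omega> *\<^sub>R H' s)" if i: "i < Suc n" for i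
  proof -
    have sub: "{a i..a (Suc i)} \<subseteq> {0..T}" using a aT[of "Suc i"] i by (auto intro: order_trans)
    have "integral {a i..a (Suc i)} (\<lambda>s. (V (a (Suc i)) \<omega> - V s \<omega>) *\<^sub>R H' s) =
        integral {a i..a (Suc i)} (\<lambda>s. V (a (Suc i)) \<omega> *\<^sub>R H' s) - integral {a i..a (Suc i)} (\<lambda>s. V s \<omega> *\<^sub>R H' s)"
      unfolding scaleR_diff_left
      by (intro Henstock_Kurzweil_Integration.integral_diff integrable_continuous_real continuous_wiener_integrand w sub
          continuous_on_scaleR continuous_on_const continuous_on_subset[OF H' sub])
    then show ?thesis using increment_H[of "a i" "a (Suc i)"] a aT[of "Suc i"] i by simp
  qed
  have "(\<Sum>i<Suc n. (V (a (Suc i)) \<omega> - V (a i) \<omega>) *\<^sub>R H (a i)) + (\<Sum>i<Suc n. V (a (Suc i)) \<omega> *\<^sub>R (H (a (Suc i)) - H (a i)))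
      = (\<Sum>i<Suc n. V (a (Suc i)) \<omega> *\<^sub>R H (a (Suc i)) - V (a i) \<omega> *\<^sub>R H (a i))"
    unfolding sum.distrib[symmetric] by (intro sum.cong) (auto simp: algebra_simps)
  also have "\<dots> = V t \<omega> *\<^sub>R H t"
    using sum_lessThan_telescope[of "\<lambda>i. V (a i) \<omega> *\<^sub>R H (a i)" "Suc n"] V_0[OF w] by (simp add: a0 an del: sum.lessThan_Suc)
  finally have abel: "wiener_sum H t n \<omega> = V t \<omega> *\<^sub>R H t - (\<Sum>i<Suc n. V (a (Suc i)) \<omega> *\<^sub>R (H (a (Suc i)) - H (a i)))"
    unfolding wiener_sum_def a_def[symmetric] by (simp add: eq_diff_eq del: sum.lessThan_Suc)
  have "integral {a 0..a (Suc n)} (\<lambda>s. V s \<omega> *\<^sub>R H' s) = (\<Sum>i<Suc n. integral {a i..a (Suc i)} (\<lambda>s. V s \<omega> *\<^sub>R H' s))"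
    by (rule integral_split_sum) (use a w t in \<open>auto simp: a0 an intro!: continuous_wiener_integrand simp del: sum.lessThan_Suc\<close>)
  then have "wiener_sum H t n \<omega> - wiener H H' t \<omega> =
      (\<Sum>i<Suc n. integral {a i..a (Suc i)} (\<lambda>s. V s \<omega> *\<^sub>R H' s)) - (\<Sum>i<Suc n. V (a (Suc i)) \<omega> *\<^sub>R (H (a (Suc i)) - H (a i)))"
    unfolding abel wiener_def by (simp add: a0 an del: sum.lessThan_Suc)
  also have "\<dots> = - (\<Sum>i<Suc n. integral {a i..a (Suc i)} (\<lambda>s. (V (a (Suc i)) \<omega> - V s \<omega>) *\<^sub>R H' s))"
    unfolding sum_subtractf[symmetric] sum_negf[symmetric] by (intro sum.cong) (simp_all add: int)
  also have "norm \<dots> \<le> (\<Sum>i<Suc n. e * K * (a (Suc i) - a i))"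
    unfolding norm_minus_cancel
  proof (rule sum_norm_le)
    fix i assume i: "i \<in> {..<Suc n}"
    have sub: "{a i..a (Suc i)} \<subseteq> {0..T}" using a aT[of "Suc i"] i by (auto intro: order_trans)
    show "norm (integral {a i..a (Suc i)} (\<lambda>s. (V (a (Suc i)) \<omega> - V s \<omega>) *\<^sub>R H' s)) \<le> e * K * (a (Suc i) - a i)"
    proof (rule integral_bound[OF a(2)])
      show "continuous_on {a i..a (Suc i)} (\<lambda>s. (V (a (Suc i)) \<omega> - V s \<omega>) *\<^sub>R H' s)"
        using sub w by (intro continuous_on_scaleR continuous_on_diff continuous_on_const V_continuous continuous_on_subset[OF H' sub]) auto
      fix s assume s: "s \<in> {a i..a (Suc i)}"
      have "\<bar>V (a (Suc i)) \<omega> - V s \<omega>\<bar> \<le> e"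
        using sub s a(3)[of i] by (intro e) auto
      then show "norm ((V (a (Suc i)) \<omega> - V s \<omega>) *\<^sub>R H' s) \<le> e * K"
        using K[of s] sub s e0 by (auto intro!: mult_mono)
    qed
  qed
  also have "\<dots> = e * K * t" unfolding a(3) by simp
  finally show ?thesis .
qed

lemma wiener_sum_limit:
  assumes w: "\<omega> \<in> space M" and t: "t \<in> {0..T}"
  shows "(\<lambda>n. wiener_sum H t n \<omega>) \<longlonglongrightarrow> wiener H H' t \<omega>"
proof (rule LIMSEQ_I)
  fix r :: real assume r: "0 < r"
  have K0: "0 \<le> K" using K[OF t] norm_ge_zero[of "H' t"] by linarith
  \<comment> \<open>The \<open>1\<close> keeps the denominator positive when
    \<open>K * t = 0\<close> and makes the final estimate strict.\<close>
  define e where "e = r / (K * t + 1)"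
  have Kt: "0 \<le> K * t" using K0 t by simp
  have e: "0 < e" using r Kt by (simp add: e_def)
  have "uniformly_continuous_on {0..T} (\<lambda>t. V t \<omega>)"
    using w by (intro compact_uniformly_continuous V_continuous) auto
  then obtain d where d: "0 < d" "\<And>s s'. s \<in> {0..T} \<Longrightarrow> s' \<in> {0..T} \<Longrightarrow> \<bar>s' - s\<bar> < d \<Longrightarrow> \<bar>V s' \<omega> - V s \<omega>\<bar> < e"
    using e unfolding uniformly_continuous_on_def dist_real_def by meson
  obtain N where N: "t / d < real N" using reals_Archimedean2 by auto
  show "\<exists>n0. \<forall>n\<ge>n0. norm (wiener_sum H t n \<omega> - wiener H H' t \<omega>) < r"
  proof (intro exI allI impI)
    fix n assume n: "N \<le> n"
    have "t / d < real (Suc n)" using N n by simp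
    then have td: "t / real (Suc n) < d" using d(1) by (simp add: field_simps)
    have "norm (wiener_sum H t n \<omega> - wiener H H' t \<omega>) \<le> e * K * t"
      by (rule wiener_sum_error[OF w t]) (use d(2) td in \<open>force intro: less_imp_le\<close>)
    also have "\<dots> < e * (K * t + 1)" using e by (simp add: distrib_left)
    also have "\<dots> = r" using Kt by (simp add: e_def)
    finally show "norm (wiener_sum H t n \<omega> - wiener H H' t \<omega>) < r" .
  qed
qed

lemma grid_time: "t \<in> {0..T} \<Longrightarrow> i \<le> Suc n \<Longrightarrow> 0 \<le> t * real i / real (Suc n) \<and> t * real i / real (Suc n) \<le> t"
  by (auto simp: divide_simps mult_left_mono)

lemma wiener_sum_adapted:
  assumes t: "t \<in> {0..T}"
  shows "wiener_sum H t n \<in> borel_measurable (F t)"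
  unfolding wiener_sum_def[abs_def]
proof (intro borel_measurable_sum borel_measurable_scaleR borel_measurable_diff borel_measurable_const)
  fix i assume "i \<in> {..<Suc n}"
  then show "V (t * real (Suc i) / real (Suc n)) \<in> borel_measurable (F t)" "V (t * real i / real (Suc n)) \<in> borel_measurable (F t)"
    using grid_time[OF t, of "Suc i" n] grid_time[OF t, of i n] by (auto intro!: V_adapted)
qed

lemma wiener_adapted: "t \<in> {0..T} \<Longrightarrow> wiener H H' t \<in> borel_measurable (F t)"
  by (rule borel_measurable_LIMSEQ_metric[OF wiener_sum_adapted]) (auto intro: wiener_sum_limit)

text \<open>The simple processes take the value of \<open>H\<close> at the left grid point, so their
  distance to \<open>H\<close> is at most \<open>K\<close> times the mesh. Their integrals agree
  almost surely with \<open>wiener_sum\<close> and converge in mean square by dominated convergence,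
  the majorant being a multiple of the square of \<open>sup_V T\<close>.\<close>

lemma wiener_has_ito_integral:
  assumes t: "t \<in> {0..T}"
  shows "has_ito_integral M F W t (\<lambda>s \<omega>. H s) (wiener H H' t)"
proof -
  have K0: "0 \<le> K" using K[OF t] norm_ge_zero[of "H' t"] by linarith
  have "continuous_on {0..T} H"
    using has_vector_derivative_continuous[OF H] by (simp add: continuous_on_eq_continuous_within)
  then have pm: "progressively_measurable F t (\<lambda>s \<omega>. H s)"
    using t by (intro continuous_adapted_progressive) (auto elim: continuous_on_subset)
  define a where "a n i = t * real i / real (Suc n)" for n i
  define \<eta> where "\<eta> n i = (\<lambda>\<omega>::'a. H (a n i))" for n i
  have sd: "simple_data F t (Suc n) (a n) (\<eta> n)" for n
    unfolding simple_data_def \<eta>_def a_def using t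
    by (auto simp: divide_simps mult_left_mono image_constant_conv)
  have [measurable]: "wiener_sum H t n \<in> borel_measurable M" "wiener H H' t \<in> borel_measurable M" for n
    using measurable_F[OF wiener_sum_adapted[OF t]] measurable_F[OF wiener_adapted[OF t]] by auto
  have err: "(\<integral>\<^sup>+\<omega>. (\<integral>\<^sup>+s\<in>{0..t}. ennreal ((norm (simple_process (Suc n) (a n) (\<eta> n) s \<omega> - H s))\<^sup>2) \<partial>lborel) \<partial>M)
      \<le> ennreal ((K * (t / real (Suc n)))\<^sup>2 * t)" for n
  proof -
    \<comment> \<open>Time \<open>0\<close> is left out: the intervals are open on the left, so the
      simple process is \<open>0\<close> there. A single time does not affect the time
      integral.\<close>
    have le: "norm (simple_process (Suc n) (a n) (\<eta> n) s \<omega> - H s) \<le> K * (t / real (Suc n))" if s: "s \<in> {0..t}" "s \<noteq> 0" for s \<omega>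
    proof -
      have t0: "0 < t" using s by auto
      define x where "x = s * real (Suc n) / t"
      have in_iff: "s \<in> {a n i<..a n (Suc i)} \<longleftrightarrow> real i < x \<and> x \<le> real i + 1" for i
        using t0 unfolding a_def x_def by (auto simp: field_simps)
      define i where "i = nat \<lceil>x\<rceil> - 1"
      have x0: "0 < x" "x \<le> real (Suc n)" using s t0 by (auto simp: x_def divide_le_eq mult.commute mult_left_mono simp del: of_nat_Suc)
      have i: "real i < x" "x \<le> real i + 1" using x0 unfolding i_def by linarith+
      then have iN: "i < Suc n" using x0 by linarith
      have "simple_process (Suc n) (a n) (\<eta> n) s \<omega> = (\<Sum>i'<Suc n. if i' = i then H (a n i') else 0)"
        unfolding simple_process_def \<eta>_def
      proof (rule sum.cong[OF refl])
        fix i'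
        have "s \<in> {a n i'<..a n (Suc i')} \<longleftrightarrow> i' = i"
          unfolding in_iff using i by (cases "i' = i") (simp, linarith)
        then show "indicat_real {a n i'<..a n (Suc i')} s *\<^sub>R H (a n i') = (if i' = i then H (a n i') else 0)"
          by (simp add: indicator_def)
      qed
      also have "\<dots> = H (a n i)" using iN by (simp add: sum.delta del: sum.lessThan_Suc)
      finally have eq: "simple_process (Suc n) (a n) (\<eta> n) s \<omega> = H (a n i)" .
      have si: "a n i < s" "s \<le> a n (Suc i)" using in_iff[of i] i by auto
      have "norm (H s - H (a n i)) \<le> K * (s - a n i)"
        using si s t by (intro norm_increment_H) (auto simp: a_def)
      also have "\<dots> \<le> K * (a n (Suc i) - a n i)" using si K0 by (intro mult_left_mono) auto
      also have "a n (Suc i) - a n i = (t * real (Suc i) - t * real i) / real (Suc n)"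
        by (simp only: a_def diff_divide_distrib)
      also have "t * real (Suc i) - t * real i = t" by (simp add: algebra_simps)
      finally show ?thesis by (simp add: eq norm_minus_commute)
    qed
    have "(\<integral>\<^sup>+s\<in>{0..t}. ennreal ((norm (simple_process (Suc n) (a n) (\<eta> n) s \<omega> - H s))\<^sup>2) \<partial>lborel)
       \<le> (\<integral>\<^sup>+s\<in>{0..t}. ennreal ((K * (t / real (Suc n)))\<^sup>2) \<partial>lborel)" for \<omega>
      by (rule nn_integral_mono_AE, rule AE_mp[OF AE_lborel_singleton[of "0::real"]], rule AE_I2)
        (use le in \<open>auto split: split_indicator intro!: ennreal_leI power_mono\<close>)
    also have "(\<integral>\<^sup>+s\<in>{0..t}. ennreal ((K * (t / real (Suc n)))\<^sup>2) \<partial>lborel) = ennreal ((K * (t / real (Suc n)))\<^sup>2 * t)"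
      using t by (simp add: nn_integral_cmult_indicator ennreal_mult[symmetric])
    finally have "(\<integral>\<^sup>+\<omega>. (\<integral>\<^sup>+s\<in>{0..t}. ennreal ((norm (simple_process (Suc n) (a n) (\<eta> n) s \<omega> - H s))\<^sup>2) \<partial>lborel) \<partial>M)
      \<le> (\<integral>\<^sup>+\<omega>. ennreal ((K * (t / real (Suc n)))\<^sup>2 * t) \<partial>M)" by (intro nn_integral_mono)
    then show ?thesis by (simp add: emeasure_space_1)
  qed
  have "(\<lambda>n. (K * (t * (1 / real (Suc n))))\<^sup>2 * t) \<longlonglongrightarrow> (K * (t * 0))\<^sup>2 * t"
    by (intro tendsto_intros LIMSEQ_Suc lim_1_over_n)
  then have "(\<lambda>n. ennreal ((K * (t / real (Suc n)))\<^sup>2 * t)) \<longlonglongrightarrow> ennreal 0"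
    by (intro tendsto_ennrealI) simp
  then have lim0: "(\<lambda>n. ennreal ((K * (t / real (Suc n)))\<^sup>2 * t)) \<longlonglongrightarrow> 0" by simp
  have P: "(\<lambda>n. \<integral>\<^sup>+\<omega>. (\<integral>\<^sup>+s\<in>{0..t}. ennreal ((norm (simple_process (Suc n) (a n) (\<eta> n) s \<omega> - H s))\<^sup>2) \<partial>lborel) \<partial>M) \<longlonglongrightarrow> 0"
    by (rule tendsto_sandwich[OF _ _ tendsto_const lim0]) (simp_all only: err zero_le eventually_True)
  have eq: "(\<integral>\<^sup>+\<omega>. ennreal ((norm (simple_integral W (Suc n) (a n) (\<eta> n) \<omega> - wiener H H' t \<omega>))\<^sup>2) \<partial>M)
     = (\<integral>\<^sup>+\<omega>. ennreal ((norm (wiener_sum H t n \<omega> - wiener H H' t \<omega>))\<^sup>2) \<partial>M)" for n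
    by (rule nn_integral_cong_AE, rule AE_mp[OF AE_V_eq])
      (simp add: simple_integral_def wiener_sum_def \<eta>_def a_def)
  have "(\<lambda>n. \<integral>\<^sup>+\<omega>. ennreal ((norm (wiener_sum H t n \<omega> - wiener H H' t \<omega>))\<^sup>2) \<partial>M) \<longlonglongrightarrow> (\<integral>\<^sup>+\<omega>. 0 \<partial>M)"
  proof (rule nn_integral_dominated_convergence[where w="\<lambda>\<omega>. ennreal ((2 * K * t)\<^sup>2) * ennreal (sup_V T \<omega> ^ 2)"])
    have T: "0 \<le> T" using t by simp
    note [measurable] = sup_V_measurable[OF T]
    show "(\<lambda>\<omega>. ennreal ((2 * K * t)\<^sup>2) * ennreal (sup_V T \<omega> ^ 2)) \<in> borel_measurable M" by measurable
    show "(\<integral>\<^sup>+\<omega>. ennreal ((2 * K * t)\<^sup>2) * ennreal (sup_V T \<omega> ^ 2) \<partial>M) < \<infinity>"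
      using sup_V_moment[OF T, of 2]
      by (simp add: nn_integral_cmult nn_integral_eq_integral ennreal_mult_less_top)
    show "AE \<omega> in M. ennreal ((norm (wiener_sum H t n \<omega> - wiener H H' t \<omega>))\<^sup>2) \<le> ennreal ((2 * K * t)\<^sup>2) * ennreal (sup_V T \<omega> ^ 2)" for n
    proof (rule AE_I2)
      fix \<omega> assume w: "\<omega> \<in> space M"
      have "norm (wiener_sum H t n \<omega> - wiener H H' t \<omega>) \<le> 2 * sup_V T \<omega> * K * t"
      proof (rule wiener_sum_error[OF w t])
        fix s s' assume "s \<in> {0..T}" "s' \<in> {0..T}"
        from this[THEN abs_V_le_sup_V[OF w]] show "\<bar>V s \<omega> - V s' \<omega>\<bar> \<le> 2 * sup_V T \<omega>" by linarith
      qed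
      then have "(norm (wiener_sum H t n \<omega> - wiener H H' t \<omega>))\<^sup>2 \<le> (2 * sup_V T \<omega> * K * t)\<^sup>2"
        by (intro power_mono) auto
      also have "\<dots> = (2 * K * t)\<^sup>2 * sup_V T \<omega> ^ 2" by (simp add: power_mult_distrib)
      finally show "ennreal ((norm (wiener_sum H t n \<omega> - wiener H H' t \<omega>))\<^sup>2) \<le> ennreal ((2 * K * t)\<^sup>2) * ennreal (sup_V T \<omega> ^ 2)"
        by (simp add: ennreal_mult[symmetric] ennreal_leI)
    qed
    show "AE \<omega> in M. (\<lambda>n. ennreal ((norm (wiener_sum H t n \<omega> - wiener H H' t \<omega>))\<^sup>2)) \<longlonglongrightarrow> 0"
    proof (rule AE_I2)
      fix \<omega> assume w: "\<omega> \<in> space M"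
      have "(\<lambda>n. (norm (wiener_sum H t n \<omega> - wiener H H' t \<omega>))\<^sup>2) \<longlonglongrightarrow> (norm (wiener H H' t \<omega> - wiener H H' t \<omega>))\<^sup>2"
        by (intro tendsto_intros wiener_sum_limit[OF w t])
      then have "(\<lambda>n. ennreal ((norm (wiener_sum H t n \<omega> - wiener H H' t \<omega>))\<^sup>2)) \<longlonglongrightarrow> ennreal 0"
        by (intro tendsto_ennrealI) simp
      then show "(\<lambda>n. ennreal ((norm (wiener_sum H t n \<omega> - wiener H H' t \<omega>))\<^sup>2)) \<longlonglongrightarrow> 0" by simp
    qed
  qed measurable
  then show ?thesis
    unfolding has_ito_integral_def using pm sd P
    by (intro conjI exI[of _ Suc] exI[of _ a] exI[of _ \<eta>]) (simp_all add: eq)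
qed

end

end

section \<open>Density of the information before the terminal time\<close>

text \<open>Bounding the sum by twice the maximum works for every positive exponent;
  \<open>Lp_norm_sum\<close> applies it with \<open>1 / p\<close>, which may lie below
  \<open>1\<close>.\<close>

lemma powr_add_le:
  fixes a b p :: real
  assumes "0 \<le> a" "0 \<le> b" "0 < p"
  shows "(a + b) powr p \<le> 2 powr p * (a powr p + b powr p)"
proof -
  have "(a + b) powr p \<le> (2 * max a b) powr p" using assms by (intro powr_mono2) auto
  also have "\<dots> = 2 powr p * max a b powr p" using assms by (simp add: powr_mult)
  also have "max a b powr p \<le> a powr p + b powr p" by (simp add: max_def)
  finally show ?thesis by simp
qed

lemma le_one_plus_powr:
  fixes x p :: real
  assumes "0 \<le> x" "1 \<le> p"
  shows "x \<le> 1 + x powr p"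
proof (cases "x \<le> 1")
  case False
  then have "x powr 1 \<le> x powr p" using assms by (intro powr_mono) auto
  then show ?thesis using False by simp
qed (simp add: add_increasing2)

context prob_space
begin

lemma integrable_Lp:
  fixes f :: "'a \<Rightarrow> 'b::euclidean_space"
  assumes "f \<in> borel_measurable M" "integrable M (\<lambda>\<omega>. norm (f \<omega>) powr p)" "1 \<le> p"
  shows "integrable M f"
proof (rule Bochner_Integration.integrable_bound)
  show "integrable M (\<lambda>\<omega>. 1 + norm (f \<omega>) powr p)" using assms by auto
  show "AE \<omega> in M. norm (f \<omega>) \<le> norm (1 + norm (f \<omega>) powr p)"
    using le_one_plus_powr[of "norm (f _)" p] assms by (intro AE_I2) (simp add: add_nonneg_nonneg)
qed (rule assms)

lemma Lp_sum:
  fixes f g :: "'a \<Rightarrow> 'b::euclidean_space"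
  assumes [measurable]: "f \<in> borel_measurable M" "g \<in> borel_measurable M"
    and f: "integrable M (\<lambda>\<omega>. norm (f \<omega>) powr p)" and g: "integrable M (\<lambda>\<omega>. norm (g \<omega>) powr p)" and p: "0 < p"
  shows "integrable M (\<lambda>\<omega>. norm (f \<omega> + g \<omega>) powr p)"
    "expectation (\<lambda>\<omega>. norm (f \<omega> + g \<omega>) powr p) \<le>
      2 powr p * (expectation (\<lambda>\<omega>. norm (f \<omega>) powr p) + expectation (\<lambda>\<omega>. norm (g \<omega>) powr p))"
proof -
  have le: "norm (f \<omega> + g \<omega>) powr p \<le> 2 powr p * (norm (f \<omega>) powr p + norm (g \<omega>) powr p)" for \<omega>
    using powr_mono2[of p "norm (f \<omega> + g \<omega>)" "norm (f \<omega>) + norm (g \<omega>)"] norm_triangle_ineq[of "f \<omega>" "g \<omega>"]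
      powr_add_le[of "norm (f \<omega>)" "norm (g \<omega>)" p] p by simp
  have i: "integrable M (\<lambda>\<omega>. 2 powr p * (norm (f \<omega>) powr p + norm (g \<omega>) powr p))" using f g by auto
  show fg: "integrable M (\<lambda>\<omega>. norm (f \<omega> + g \<omega>) powr p)"
    by (rule Bochner_Integration.integrable_bound[OF i]) (use le in \<open>auto intro!: AE_I2 intro: order_trans\<close>)
  have "expectation (\<lambda>\<omega>. norm (f \<omega> + g \<omega>) powr p) \<le> expectation (\<lambda>\<omega>. 2 powr p * (norm (f \<omega>) powr p + norm (g \<omega>) powr p))"
    by (intro integral_mono fg i le)
  then show "expectation (\<lambda>\<omega>. norm (f \<omega> + g \<omega>) powr p) \<le>
      2 powr p * (expectation (\<lambda>\<omega>. norm (f \<omega>) powr p) + expectation (\<lambda>\<omega>. norm (g \<omega>) powr p))"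
    using f g by simp
qed

lemma Lp_diff:
  fixes f g :: "'a \<Rightarrow> 'b::euclidean_space"
  assumes "f \<in> borel_measurable M" "g \<in> borel_measurable M"
    and "integrable M (\<lambda>\<omega>. norm (f \<omega>) powr p)" and "integrable M (\<lambda>\<omega>. norm (g \<omega>) powr p)" and "0 < p"
  shows "integrable M (\<lambda>\<omega>. norm (f \<omega> - g \<omega>) powr p)"
    "expectation (\<lambda>\<omega>. norm (f \<omega> - g \<omega>) powr p) \<le>
      2 powr p * (expectation (\<lambda>\<omega>. norm (f \<omega>) powr p) + expectation (\<lambda>\<omega>. norm (g \<omega>) powr p))"
  using Lp_sum[of f "\<lambda>\<omega>. - g \<omega>" p] assms by auto

text \<open>Splitting at level \<open>d\<close>: a value above \<open>d\<close> is at most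
  \<open>d powr (1 - p)\<close> times its \<open>p\<close>-th power. Each of the two parts
  contributes at most \<open>d\<close>.\<close>

lemma expectation_norm_le_of_Lp:
  fixes f :: "'a \<Rightarrow> 'b::euclidean_space"
  assumes f: "f \<in> borel_measurable M" "integrable M (\<lambda>\<omega>. norm (f \<omega>) powr p)" and p: "1 \<le> p"
    and d: "0 < d" "expectation (\<lambda>\<omega>. norm (f \<omega>) powr p) \<le> d powr p"
  shows "expectation (\<lambda>\<omega>. norm (f \<omega>)) \<le> 2 * d"
proof -
  have le: "norm (f \<omega>) \<le> d + d powr (1 - p) * norm (f \<omega>) powr p" for \<omega>
  proof (cases "norm (f \<omega>) \<le> d")
    case False
    then have "norm (f \<omega>) powr (1 - p) \<le> d powr (1 - p)" using p d by (intro powr_mono2') auto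
    then have "norm (f \<omega>) powr (1 - p) * norm (f \<omega>) powr p \<le> d powr (1 - p) * norm (f \<omega>) powr p"
      by (intro mult_right_mono) auto
    moreover have "norm (f \<omega>) powr (1 - p) * norm (f \<omega>) powr p = norm (f \<omega>)"
      using False d by (simp add: powr_add[symmetric])
    ultimately show ?thesis using d by simp
  qed (simp add: add_increasing2)
  have "expectation (\<lambda>\<omega>. norm (f \<omega>)) \<le> expectation (\<lambda>\<omega>. d + d powr (1 - p) * norm (f \<omega>) powr p)"
    using integrable_Lp[OF f p] f(2) le by (intro integral_mono) auto
  also have "\<dots> = d + d powr (1 - p) * expectation (\<lambda>\<omega>. norm (f \<omega>) powr p)"
    using f(2) by (simp add: prob_space)
  also have "\<dots> \<le> d + d powr (1 - p) * d powr p" by (intro add_left_mono mult_left_mono d(2)) auto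
  also have "\<dots> = 2 * d" using d(1) by (simp add: powr_add[symmetric])
  finally show ?thesis .
qed

text \<open>The preceding estimate asks for a positive level, so it is applied slightly above the
  norm, at \<open>?n + e / 2\<close>; this also covers a norm equal to \<open>0\<close>.\<close>

lemma expectation_norm_le_Lp_norm:
  fixes f :: "'a \<Rightarrow> 'b::euclidean_space"
  assumes f: "f \<in> borel_measurable M" "integrable M (\<lambda>\<omega>. norm (f \<omega>) powr p)" and p: "1 \<le> p"
  shows "expectation (\<lambda>\<omega>. norm (f \<omega>)) \<le> 2 * expectation (\<lambda>\<omega>. norm (f \<omega>) powr p) powr (1 / p)"
proof (rule field_le_epsilon)
  fix e :: real assume e: "0 < e"
  let ?n = "expectation (\<lambda>\<omega>. norm (f \<omega>) powr p) powr (1 / p)"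
  have E0: "0 \<le> expectation (\<lambda>\<omega>. norm (f \<omega>) powr p)" by simp
  then have "expectation (\<lambda>\<omega>. norm (f \<omega>) powr p) = ?n powr p" using p by (simp add: powr_powr)
  also have "\<dots> \<le> (?n + e / 2) powr p" using e p by (intro powr_mono2) auto
  finally have "expectation (\<lambda>\<omega>. norm (f \<omega>)) \<le> 2 * (?n + e / 2)"
    using e by (intro expectation_norm_le_of_Lp[OF f p]) (auto simp: add_nonneg_pos)
  then show "expectation (\<lambda>\<omega>. norm (f \<omega>)) \<le> 2 * ?n + e" by (simp add: field_simps)
qed

end

section \<open>Approximation of terminal events by earlier ones\<close>

context brownian
begin

text \<open>The closure of the union of all \<open>F t\<close> with \<open>0 \<le> t\<close> and
  \<open>t < T\<close>, for the distance given by the probability of the symmetric difference. It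
  turns out to be a \<sigma>-algebra, so that only the generators of \<open>F T\<close> have to be
  checked.\<close>

definition approximable :: "real \<Rightarrow> 'a set set" where
  "approximable T = {A \<in> sets M. \<forall>e>0. \<exists>t\<in>{0..<T}. \<exists>B\<in>sets (F t). prob ((A - B) \<union> (B - A)) < e}"

lemma approximable_if_earlier: "t \<in> {0..<T} \<Longrightarrow> A \<in> sets (F t) \<Longrightarrow> A \<in> approximable T"
  using sets_F_subset[of t] by (auto simp: approximable_def intro!: bexI[of _ t] bexI[of _ A])

text \<open>Cutting the union to \<open>N\<close> sets loses less than \<open>e / 2\<close>; each of
  them is replaced by an earlier event at error \<open>e / (2 * Suc N)\<close>, and finitely many
  times below \<open>T\<close> have a maximum below \<open>T\<close>.\<close>

lemma approximable_Union:
  fixes A :: "nat \<Rightarrow> 'a set"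
  assumes T: "0 < T" and A: "\<And>i. A i \<in> approximable T"
  shows "(\<Union>i. A i) \<in> approximable T"
  unfolding approximable_def
proof (intro CollectI conjI allI impI)
  have AM[measurable]: "A i \<in> sets M" for i using A[of i] by (simp add: approximable_def)
  show "(\<Union>i. A i) \<in> events" by auto
  fix e :: real assume e: "0 < e"
  let ?U = "\<lambda>n. \<Union>i<n. A i"
  have "(\<lambda>n. prob (?U n)) \<longlonglongrightarrow> prob (\<Union>n. ?U n)"
    by (intro finite_Lim_measure_incseq) (auto simp: incseq_def intro: less_le_trans)
  moreover have UU: "(\<Union>n. ?U n) = (\<Union>i. A i)" by auto
  ultimately have "\<forall>\<^sub>F n in sequentially. prob (\<Union>i. A i) - e / 2 < prob (?U n)"
    using e by (intro order_tendstoD(1)) auto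
  then obtain N where N: "prob (\<Union>i. A i) - e / 2 < prob (?U N)" by (auto simp: eventually_sequentially)
  have "\<exists>t B. t \<in> {0..<T} \<and> B \<in> sets (F t) \<and> prob ((A i - B) \<union> (B - A i)) < e / (2 * real (Suc N))" for i
  proof -
    have "0 < e / (2 * real (Suc N))" using e by simp
    then show ?thesis using A[of i] unfolding approximable_def by blast
  qed
  then obtain t B where tB: "\<And>i. t i \<in> {0..<T}" "\<And>i. B i \<in> sets (F (t i))"
    "\<And>i. prob ((A i - B i) \<union> (B i - A i)) < e / (2 * real (Suc N))" by metis
  have BM[measurable]: "B i \<in> sets M" for i using tB(2)[of i] sets_F_subset by auto
  \<comment> \<open>\<open>0\<close> is inserted because \<open>N\<close> may be
    \<open>0\<close>.\<close>
  define u where "u = Max (insert 0 (t ` {..<N}))"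
  have u: "u \<in> {0..<T}" unfolding u_def using tB(1) T by auto
  have "(\<Union>i<N. B i) \<in> sets (F u)"
  proof (intro sets.finite_UN)
    fix i assume "i \<in> {..<N}"
    then have "t i \<le> u" unfolding u_def by (intro Max_ge) auto
    then show "B i \<in> sets (F u)" using tB(2)[of i] sets_augmented_filtration_mono by blast
  qed auto
  moreover have "prob (((\<Union>i. A i) - (\<Union>i<N. B i)) \<union> ((\<Union>i<N. B i) - (\<Union>i. A i))) < e"
  proof -
    have "prob (((\<Union>i. A i) - (\<Union>i<N. B i)) \<union> ((\<Union>i<N. B i) - (\<Union>i. A i))) \<le>
        prob (((\<Union>i. A i) - ?U N) \<union> (\<Union>i<N. (A i - B i) \<union> (B i - A i)))"
      by (intro finite_measure_mono) auto
    also have "\<dots> \<le> prob ((\<Union>i. A i) - ?U N) + prob (\<Union>i<N. (A i - B i) \<union> (B i - A i))"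
      by (intro measure_Un_le) auto
    also have "prob ((\<Union>i. A i) - ?U N) = prob (\<Union>i. A i) - prob (?U N)"
      by (intro finite_measure_Diff) auto
    also have "prob (\<Union>i<N. (A i - B i) \<union> (B i - A i)) \<le> (\<Sum>i<N. prob ((A i - B i) \<union> (B i - A i)))"
      by (intro finite_measure_subadditive_finite) auto
    also have "\<dots> \<le> (\<Sum>i<N. e / (2 * real (Suc N)))"
      by (intro sum_mono less_imp_le tB(3))
    also have "\<dots> \<le> e / 2" using e by (simp add: field_simps)
    finally show ?thesis using N by simp
  qed
  ultimately show "\<exists>t\<in>{0..<T}. \<exists>B\<in>sets (F t). prob (((\<Union>i. A i) - B) \<union> (B - (\<Union>i. A i))) < e"
    using u by blast
qed

lemma sigma_algebra_approximable:
  assumes T: "0 < T"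
  shows "sigma_algebra (space M) (approximable T)"
  unfolding sigma_algebra_iff2
proof (intro conjI ballI allI impI)
  show "approximable T \<subseteq> Pow (space M)" using sets.sets_into_space by (auto simp: approximable_def)
  show "{} \<in> approximable T" using T by (intro approximable_if_earlier[of 0]) auto
  show "(\<Union>i. A i) \<in> approximable T" if "range A \<subseteq> approximable T" for A :: "nat \<Rightarrow> 'a set"
    using approximable_Union[OF T] that by auto
  fix A assume A: "A \<in> approximable T"
  show "space M - A \<in> approximable T"
    unfolding approximable_def
  proof (intro CollectI conjI allI impI)
    show "space M - A \<in> events" using A by (auto simp: approximable_def)
    fix e :: real assume "0 < e"
    then obtain t B where tB: "t \<in> {0..<T}" "B \<in> sets (F t)" "prob ((A - B) \<union> (B - A)) < e"
      using A by (auto simp: approximable_def)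
    have "A \<subseteq> space M" "B \<subseteq> space M"
      using A sets.sets_into_space[of A M] sets.sets_into_space[OF tB(2)] by (auto simp: approximable_def)
    then have "((space M - A) - (space M - B)) \<union> ((space M - B) - (space M - A)) = (A - B) \<union> (B - A)" by auto
    moreover have "space M - B \<in> sets (F t)" using sets.compl_sets[OF tB(2)] by simp
    ultimately show "\<exists>t\<in>{0..<T}. \<exists>B\<in>sets (F t). prob (space M - A - B \<union> (B - (space M - A))) < e"
      using tB by (intro bexI[of _ t] bexI[of _ "space M - B"]) auto
  qed
qed

text \<open>Continuity at the terminal time: \<open>V T\<close> is the limit of
  \<open>V (T - T / Suc n)\<close>, hence measurable for the approximable sets. The other generators
  belong to earlier times, and the null sets already to \<open>F 0\<close>.\<close>

lemma sets_F_approximable: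
  assumes T: "0 < T"
  shows "sets (F T) \<subseteq> approximable T"
proof -
  interpret S: sigma_algebra "space M" "approximable T" by (rule sigma_algebra_approximable[OF T])
  define N where "N = sigma (space M) (approximable T)"
  have N: "sets N = approximable T" "space N = space M"
    unfolding N_def using S.sigma_sets_eq S.space_closed by (simp_all add: sets_measure_of space_measure_of_conv)
  have null: "A \<in> approximable T" if "A \<in> null_sets M" for A
    using null_sets_augmented_filtration[OF that, of W 0] T by (intro approximable_if_earlier[of 0]) auto
  have early: "V s \<in> borel_measurable N" if "s \<in> {0..<T}" for s
    using V_adapted[of s s] that approximable_if_earlier[OF that] by (auto simp: measurable_def N)
  have VT: "V T \<in> borel_measurable N"
  proof (rule borel_measurable_LIMSEQ_metric)
    fix n
    show "V (T - T / real (Suc n)) \<in> borel_measurable N"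
      using T by (intro early) (auto simp: field_simps)
  next
    fix \<omega> assume "\<omega> \<in> space N"
    then have w: "\<omega> \<in> space M" by (simp add: N)
    have "(\<lambda>n. T - T * (1 / real (Suc n))) \<longlonglongrightarrow> T - T * 0"
      by (intro tendsto_intros LIMSEQ_Suc lim_1_over_n)
    then show "(\<lambda>n. V (T - T / real (Suc n)) \<omega>) \<longlonglongrightarrow> V T \<omega>"
      using T by (intro continuous_on_tendsto_compose[OF V_continuous[OF w order_refl]]) (auto simp: field_simps)
  qed
  have gen: "W s -` A \<inter> space M \<in> approximable T" if s: "0 \<le> s" "s \<le> T" and A: "A \<in> sets borel" for s A
  proof (cases "s = T")
    case False
    with s have "s \<in> {0..<T}" by auto
    moreover have "W s -` A \<inter> space M \<in> sets (F s)"
      using measurable_sets[OF W_adapted[of s s] A] s by simp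
    ultimately show ?thesis by (rule approximable_if_earlier)
  next
    \<comment> \<open>Off the exceptional set \<open>W T\<close> is \<open>V T\<close>; on it the
      preimage is a null set.\<close>
    case True
    have 1: "V T -` A \<inter> space M \<in> approximable T"
      using measurable_sets[OF VT A] by (simp add: N)
    have "W T -` A \<inter> space M \<inter> exceptional \<in> null_sets M"
      using T by (intro null_set_Int1[OF exceptional(1)] measurable_sets[OF W_measurable[of T] A]) simp
    then have 2: "W T -` A \<inter> space M \<inter> exceptional \<in> approximable T" by (rule null)
    have 3: "exceptional \<in> approximable T" by (rule null[OF exceptional(1)])
    have "W T -` A \<inter> space M = (V T -` A \<inter> space M - exceptional) \<union> (W T -` A \<inter> space M \<inter> exceptional)"
      by (auto simp: V_def)
    also have "\<dots> \<in> approximable T" using 1 2 3 by (intro S.Un S.Diff)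
    finally show ?thesis using True by simp
  qed
  have "sets (natural_filtration M W T) \<subseteq> approximable T"
    unfolding sets_natural_filtration by (rule S.sigma_sets_subset) (use gen in auto)
  then show ?thesis
    unfolding sets_augmented_filtration by (intro S.sigma_sets_subset) (use null in auto)
qed

text \<open>Each level set is replaced by an event from a common earlier time. The new function
  differs from \<open>s\<close> only on the symmetric differences, where the distance is at most
  \<open>C\<close>.\<close>

lemma simple_function_approx:
  fixes s :: "'a \<Rightarrow> 'b::euclidean_space"
  assumes T: "0 < T" and s: "simple_function (F T) s" and p: "0 < p" and e: "0 < e"
  shows "\<exists>t\<in>{0..<T}. \<exists>\<eta>\<in>borel_measurable (F t). (\<exists>C. \<forall>\<omega>. norm (\<eta> \<omega>) \<le> C) \<and>
    expectation (\<lambda>\<omega>. norm (s \<omega> - \<eta> \<omega>) powr p) < e"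
proof -
  let ?Y = "s ` space M"
  define A where "A y = s -` {y} \<inter> space M" for y
  have fin: "finite ?Y" using s by (simp add: simple_function_def)
  have AF: "A y \<in> sets (F T)" if "y \<in> ?Y" for y using s that by (auto simp: simple_function_def A_def)
  have AM: "A y \<in> sets M" if "y \<in> ?Y" for y using AF[OF that] sets_F_subset by auto
  \<comment> \<open>The replacing events may overlap, so \<open>\<eta>\<close> is bounded by the sum
    of the norms of the values.\<close>
  define C where "C = (\<Sum>y\<in>?Y. norm y)"
  have C0: "0 \<le> C" by (simp add: C_def sum_nonneg)
  \<comment> \<open>Makes \<open>C powr p\<close> times the number of values times \<open>d\<close>
    at most \<open>e / 2\<close>; the added ones exclude vanishing factors.\<close>
  define d where "d = e / (2 * (C powr p + 1) * (real (card ?Y) + 1))"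
  have Cp: "0 \<le> C powr p" by simp
  have d0: "0 < d" unfolding d_def using e Cp by (intro divide_pos_pos mult_pos_pos) (auto simp: add_nonneg_pos)
  have "\<forall>y\<in>?Y. \<exists>t B. t \<in> {0..<T} \<and> B \<in> sets (F t) \<and> prob ((A y - B) \<union> (B - A y)) < d"
  proof
    fix y assume "y \<in> ?Y"
    then have "A y \<in> approximable T" using sets_F_approximable[OF T] AF by blast
    then show "\<exists>t B. t \<in> {0..<T} \<and> B \<in> sets (F t) \<and> prob ((A y - B) \<union> (B - A y)) < d"
      using d0 unfolding approximable_def by blast
  qed
  then obtain t B where tB: "\<And>y. y \<in> ?Y \<Longrightarrow> t y \<in> {0..<T}" "\<And>y. y \<in> ?Y \<Longrightarrow> B y \<in> sets (F (t y))"
    "\<And>y. y \<in> ?Y \<Longrightarrow> prob ((A y - B y) \<union> (B y - A y)) < d" by metis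
  define u where "u = Max (insert 0 (t ` ?Y))"
  have u: "u \<in> {0..<T}" unfolding u_def using tB(1) T fin by auto
  have BF: "B y \<in> sets (F u)" if "y \<in> ?Y" for y
  proof -
    have "t y \<le> u" unfolding u_def using that fin by (intro Max_ge) auto
    then show "B y \<in> sets (F u)" using tB(2)[OF that] sets_augmented_filtration_mono by blast
  qed
  have BM: "B y \<in> sets M" if "y \<in> ?Y" for y using BF[OF that] sets_F_subset by auto
  define \<eta> where "\<eta> \<omega> = (\<Sum>y\<in>?Y. indicator (B y) \<omega> *\<^sub>R y)" for \<omega>
  have \<eta>m: "\<eta> \<in> borel_measurable (F u)"
    unfolding \<eta>_def[abs_def] using BF by (intro borel_measurable_sum borel_measurable_scaleR) auto
  have \<eta>b: "norm (\<eta> \<omega>) \<le> C" for \<omega>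
    unfolding \<eta>_def C_def by (intro sum_norm_le) (auto simp: indicator_def)
  have s_eq: "s \<omega> = (\<Sum>y\<in>?Y. indicator (A y) \<omega> *\<^sub>R y)" if "\<omega> \<in> space M" for \<omega>
  proof -
    have "(\<Sum>y\<in>?Y. indicator (A y) \<omega> *\<^sub>R y) = (\<Sum>y\<in>?Y. if y = s \<omega> then y else 0)"
      using that by (intro sum.cong) (auto simp: A_def indicator_def)
    also have "\<dots> = s \<omega>" using fin that by simp
    finally show ?thesis by simp
  qed
  let ?D = "\<lambda>y. (A y - B y) \<union> (B y - A y)"
  have DM: "?D y \<in> sets M" if "y \<in> ?Y" for y using AM[OF that] BM[OF that] by auto
  have le: "norm (s \<omega> - \<eta> \<omega>) powr p \<le> C powr p * (\<Sum>y\<in>?Y. indicator (?D y) \<omega>)" if w: "\<omega> \<in> space M" for \<omega>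
  proof (cases "\<exists>y\<in>?Y. \<omega> \<in> ?D y")
    case True
    have "norm (s \<omega> - \<eta> \<omega>) \<le> C"
      unfolding s_eq[OF w] \<eta>_def sum_subtractf[symmetric] scaleR_diff_left[symmetric] C_def
      by (intro sum_norm_le) (auto simp: indicator_def)
    then have 1: "norm (s \<omega> - \<eta> \<omega>) powr p \<le> C powr p" using p by (intro powr_mono2) auto
    obtain y where y: "y \<in> ?Y" "\<omega> \<in> ?D y" using True by auto
    have "indicator (?D y) \<omega> \<le> (\<Sum>y\<in>?Y. indicator (?D y) \<omega> :: real)"
      using fin y(1) by (intro member_le_sum) auto
    then have "1 \<le> (\<Sum>y\<in>?Y. indicator (?D y) \<omega> :: real)" using y(2) by simp
    from mult_left_mono[OF this Cp] 1 show ?thesis by simp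
  next
    case False
    then have "indicator (A y) \<omega> = (indicator (B y) \<omega> :: real)" if "y \<in> ?Y" for y using that by (auto simp: indicator_def)
    then have "s \<omega> = \<eta> \<omega>" unfolding s_eq[OF w] \<eta>_def by (intro sum.cong) auto
    then show ?thesis using Cp by (auto intro!: mult_nonneg_nonneg sum_nonneg)
  qed
  have sM: "s \<in> borel_measurable M" using measurable_F[OF borel_measurable_simple_function[OF s]] .
  have int: "integrable M (\<lambda>\<omega>. C powr p * (\<Sum>y\<in>?Y. indicator (?D y) \<omega>))"
    using DM by (intro integrable_mult_right Bochner_Integration.integrable_sum integrable_real_indicator) (auto simp: less_top[symmetric])
  have "expectation (\<lambda>\<omega>. norm (s \<omega> - \<eta> \<omega>) powr p) \<le> expectation (\<lambda>\<omega>. C powr p * (\<Sum>y\<in>?Y. indicator (?D y) \<omega>))"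
  proof (rule integral_mono_AE[OF _ int])
    show "integrable M (\<lambda>\<omega>. norm (s \<omega> - \<eta> \<omega>) powr p)"
      by (rule Bochner_Integration.integrable_bound[OF int])
        (use sM measurable_F[OF \<eta>m] in \<open>simp_all add: AE_I2 order_trans[OF le abs_ge_self]\<close>)
  qed (use le in auto)
  also have "\<dots> = C powr p * (\<Sum>y\<in>?Y. prob (?D y))"
    using DM by (simp add: Bochner_Integration.integral_sum less_top[symmetric] Int_absorb2 sets.sets_into_space)
  also have "\<dots> \<le> C powr p * (\<Sum>y\<in>?Y. d)"
    using tB(3) by (intro mult_left_mono sum_mono) (auto intro: less_imp_le)
  also have "\<dots> \<le> (C powr p + 1) * ((real (card ?Y) + 1) * d)"
    using d0 Cp by (intro mult_mono) (auto simp: mult_right_mono)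
  also have "\<dots> = e / 2"
  proof -
    have "C powr p + 1 \<noteq> 0" "real (card ?Y) + 1 \<noteq> 0" using Cp by linarith+
    moreover have "a * (b * (e / (2 * a * b))) = e / 2" if "a \<noteq> 0" "b \<noteq> 0" for a b :: real
      using that by (simp add: field_simps)
    ultimately show ?thesis unfolding d_def by blast
  qed
  also have "\<dots> < e" using e by simp
  finally show ?thesis using u \<eta>m \<eta>b by blast
qed

text \<open>Simple functions and then earlier level sets give a bounded approximant, which is
  finally recentred. As \<open>\<xi>\<close> has mean zero, the mean of the approximant is at most
  \<open>2 * d\<close> in norm, so recentring costs an error of the same order. The zero mean is
  handed on to the integrand in \<open>Lp_representation\<close>.\<close>

lemma Lp_approx:
  fixes \<xi> :: "'a \<Rightarrow> 'b::euclidean_space"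
  assumes T: "0 < T" and p: "1 \<le> p" and \<xi>: "\<xi> \<in> borel_measurable (F T)" "integrable M (\<lambda>\<omega>. norm (\<xi> \<omega>) powr p)"
    and mean: "expectation \<xi> = 0" and e: "0 < e"
  shows "\<exists>t \<eta>. t \<in> {0..<T} \<and> \<eta> \<in> borel_measurable (F t) \<and> integrable M (\<lambda>\<omega>. norm (\<eta> \<omega>) powr p) \<and>
    expectation \<eta> = 0 \<and> expectation (\<lambda>\<omega>. norm (\<xi> \<omega> - \<eta> \<omega>) powr p) \<le> e"
proof -
  \<comment> \<open>Solves \<open>2 powr p * (d powr p + (2 * d) powr p) = e\<close>, the estimate
    reached after recentring.\<close>
  define d where "d = (e / (2 powr p * (1 + 2 powr p))) powr (1 / p)"
  have c0: "0 < 2 powr p * (1 + 2 powr p)" by (intro mult_pos_pos add_pos_pos) auto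
  have q0: "0 < e / (2 powr p * (1 + 2 powr p))" using e c0 by (rule divide_pos_pos)
  from q0 have d0: "0 < d" unfolding d_def powr_gt_zero by (rule less_imp_neq[THEN not_sym])
  have dp: "d powr p = e / (2 powr p * (1 + 2 powr p))"
  proof -
    have "1 / p * p = 1" using p by simp
    then show ?thesis using powr_one[OF less_imp_le[OF q0]] by (simp only: d_def powr_powr)
  qed
  \<comment> \<open>Two errors of size \<open>e1\<close>, combined with the factor
    \<open>2 powr p\<close> from \<open>Lp_sum\<close>, give \<open>d powr p\<close>.\<close>
  define e1 where "e1 = d powr p / (2 powr p * 2)"
  have e1: "0 < e1" using d0 by (simp add: e1_def)
  have [measurable]: "\<xi> \<in> borel_measurable M" by (rule measurable_F[OF \<xi>(1)])
  obtain s where s0: "\<forall>i. simple_function (F T) (s i)" "\<forall>\<omega>\<in>space (F T). (\<lambda>i. s i \<omega>) \<longlonglongrightarrow> \<xi> \<omega>"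
    "\<forall>i. \<forall>\<omega>\<in>space (F T). dist (s i \<omega>) 0 \<le> 2 * dist (\<xi> \<omega>) 0"
    using borel_measurable_implies_sequence_metric[OF \<xi>(1), of 0] by blast
  then have s: "simple_function (F T) (s i)" "\<omega> \<in> space M \<Longrightarrow> (\<lambda>i. s i \<omega>) \<longlonglongrightarrow> \<xi> \<omega>"
    "\<omega> \<in> space M \<Longrightarrow> norm (s i \<omega>) \<le> 2 * norm (\<xi> \<omega>)" for i \<omega>
    by simp_all
  have [measurable]: "s i \<in> borel_measurable M" for i
    using measurable_F[OF borel_measurable_simple_function[OF s(1)]] .
  have "(\<lambda>i. expectation (\<lambda>\<omega>. norm (\<xi> \<omega> - s i \<omega>) powr p)) \<longlonglongrightarrow> expectation (\<lambda>\<omega>. 0)"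
  proof (rule integral_dominated_convergence[where w="\<lambda>\<omega>. 3 powr p * norm (\<xi> \<omega>) powr p"])
    show "integrable M (\<lambda>\<omega>. 3 powr p * norm (\<xi> \<omega>) powr p)" using \<xi>(2) by simp
    show "AE \<omega> in M. (\<lambda>i. norm (\<xi> \<omega> - s i \<omega>) powr p) \<longlonglongrightarrow> 0"
    proof (rule AE_I2)
      fix \<omega> assume w: "\<omega> \<in> space M"
      have "(\<lambda>i. norm (\<xi> \<omega> - s i \<omega>)) \<longlonglongrightarrow> norm (\<xi> \<omega> - \<xi> \<omega>)" by (intro tendsto_intros s(2) w)
      then have "(\<lambda>i. norm (\<xi> \<omega> - s i \<omega>) powr p) \<longlonglongrightarrow> 0 powr p"
        using p by (intro tendsto_powr') (auto intro: tendsto_const)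
      then show "(\<lambda>i. norm (\<xi> \<omega> - s i \<omega>) powr p) \<longlonglongrightarrow> 0" by simp
    qed
    show "AE \<omega> in M. norm (norm (\<xi> \<omega> - s i \<omega>) powr p) \<le> 3 powr p * norm (\<xi> \<omega>) powr p" for i
    proof (rule AE_I2)
      fix \<omega> assume w: "\<omega> \<in> space M"
      have "norm (\<xi> \<omega> - s i \<omega>) \<le> 3 * norm (\<xi> \<omega>)"
        using norm_triangle_ineq4[of "\<xi> \<omega>" "s i \<omega>"] s(3)[OF w, of i] by simp
      then have "norm (\<xi> \<omega> - s i \<omega>) powr p \<le> (3 * norm (\<xi> \<omega>)) powr p" using p by (intro powr_mono2) auto
      then show "norm (norm (\<xi> \<omega> - s i \<omega>) powr p) \<le> 3 powr p * norm (\<xi> \<omega>) powr p" by (simp add: powr_mult)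
    qed
  qed auto
  then have "\<forall>\<^sub>F i in sequentially. expectation (\<lambda>\<omega>. norm (\<xi> \<omega> - s i \<omega>) powr p) < e1"
    using e1 by (intro order_tendstoD(2)) auto
  then obtain i where i: "expectation (\<lambda>\<omega>. norm (\<xi> \<omega> - s i \<omega>) powr p) < e1" by (auto simp: eventually_sequentially)
  have p0: "0 < p" using p by simp
  obtain t \<eta> C where \<eta>: "t \<in> {0..<T}" "\<eta> \<in> borel_measurable (F t)" "\<forall>\<omega>. norm (\<eta> \<omega>) \<le> C"
    "expectation (\<lambda>\<omega>. norm (s i \<omega> - \<eta> \<omega>) powr p) < e1"
    using simple_function_approx[OF T s(1)[of i] p0 e1] by blast
  have [measurable]: "\<eta> \<in> borel_measurable M" by (rule measurable_F[OF \<eta>(2)])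
  have \<eta>p: "integrable M (\<lambda>\<omega>. norm (\<eta> \<omega>) powr p)"
    by (rule integrable_const_bound[of _ "C powr p"]) (use \<eta>(3) p in \<open>auto intro!: powr_mono2\<close>)
  have sp: "integrable M (\<lambda>\<omega>. norm (s i \<omega>) powr p)"
  proof (rule Bochner_Integration.integrable_bound)
    show "integrable M (\<lambda>\<omega>. 2 powr p * norm (\<xi> \<omega>) powr p)" using \<xi>(2) by simp
    show "AE \<omega> in M. norm (norm (s i \<omega>) powr p) \<le> norm (2 powr p * norm (\<xi> \<omega>) powr p)"
      using powr_mono2[of p "norm (s i _)", OF _ _ s(3)[of _ i]] p by (intro AE_I2) (simp add: powr_mult)
  qed measurable
  have p0: "0 < p" using p by simp
  have d1: "integrable M (\<lambda>\<omega>. norm (\<xi> \<omega> - s i \<omega>) powr p)" "integrable M (\<lambda>\<omega>. norm (s i \<omega> - \<eta> \<omega>) powr p)"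
    using Lp_diff(1)[OF _ _ \<xi>(2) sp p0] Lp_diff(1)[OF _ _ sp \<eta>p p0] by auto
  have d2: "integrable M (\<lambda>\<omega>. norm (\<xi> \<omega> - \<eta> \<omega>) powr p)" using Lp_diff(1)[OF _ _ \<xi>(2) \<eta>p p0] by auto
  have "expectation (\<lambda>\<omega>. norm (\<xi> \<omega> - \<eta> \<omega>) powr p) \<le> 2 powr p * (e1 + e1)"
  proof -
    have "expectation (\<lambda>\<omega>. norm (\<xi> \<omega> - \<eta> \<omega>) powr p) \<le> 2 powr p *
        (expectation (\<lambda>\<omega>. norm (\<xi> \<omega> - s i \<omega>) powr p) + expectation (\<lambda>\<omega>. norm (s i \<omega> - \<eta> \<omega>) powr p))"
      using Lp_sum(2)[OF _ _ d1 p0] by simp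
    also have "\<dots> \<le> 2 powr p * (e1 + e1)"
      using i \<eta>(4) by (intro mult_left_mono add_mono) auto
    finally show ?thesis .
  qed
  also have "\<dots> = d powr p" by (simp add: e1_def)
  finally have e2: "expectation (\<lambda>\<omega>. norm (\<xi> \<omega> - \<eta> \<omega>) powr p) \<le> d powr p" .
  have \<eta>i: "integrable M \<eta>" by (rule integrable_Lp[OF _ \<eta>p p]) measurable
  have \<xi>i: "integrable M \<xi>" by (rule integrable_Lp[OF _ \<xi>(2) p]) measurable
  have "norm (expectation (\<lambda>\<omega>. \<xi> \<omega> - \<eta> \<omega>)) \<le> 2 * d"
    by (rule order_trans[OF integral_norm_bound expectation_norm_le_of_Lp[OF _ d2 p d0 e2]]) measurable
  then have m: "norm (expectation \<eta>) \<le> 2 * d" using \<eta>i \<xi>i mean by simp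
  let ?\<eta> = "\<lambda>\<omega>. \<eta> \<omega> - expectation \<eta>"
  have cp: "integrable M (\<lambda>\<omega>::'a. norm (expectation \<eta>) powr p)" by simp
  have "expectation (\<lambda>\<omega>. norm (\<xi> \<omega> - ?\<eta> \<omega>) powr p) = expectation (\<lambda>\<omega>. norm ((\<xi> \<omega> - \<eta> \<omega>) + expectation \<eta>) powr p)"
    by (simp add: algebra_simps)
  also have "\<dots> \<le> 2 powr p * (expectation (\<lambda>\<omega>. norm (\<xi> \<omega> - \<eta> \<omega>) powr p) + norm (expectation \<eta>) powr p)"
    using Lp_sum(2)[OF _ _ d2 cp p0] by (simp add: prob_space)
  also have "\<dots> \<le> 2 powr p * (d powr p + (2 * d) powr p)"
    using e2 m p by (intro mult_left_mono add_mono powr_mono2) auto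
  also have "\<dots> = 2 powr p * (1 + 2 powr p) * d powr p" using d0 by (simp add: powr_mult algebra_simps)
  also have "\<dots> = e"
    unfolding dp times_divide_eq_right by (rule nonzero_mult_div_cancel_left[OF less_imp_neq[OF c0, THEN not_sym]])
  finally have "expectation (\<lambda>\<omega>. norm (\<xi> \<omega> - ?\<eta> \<omega>) powr p) \<le> e" .
  moreover have "integrable M (\<lambda>\<omega>. norm (?\<eta> \<omega>) powr p)" using Lp_diff(1)[OF _ _ \<eta>p cp p0] by simp
  moreover have "expectation ?\<eta> = 0" using \<eta>i by (simp add: prob_space)
  ultimately show ?thesis using \<eta>(1,2) by (intro exI[of _ t] exI[of _ ?\<eta>]) auto
qed

end

section \<open>Random variables as time integrals of adapted processes\<close>

context brownian
begin

text \<open>With height \<open>c k / l k\<close> on an interval of length \<open>l k\<close>, the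
  term \<open>c k\<close> contributes exactly \<open>N k\<close> to the time integral of
  \<open>L^p\<close> norms, however close to \<open>T\<close> the interval lies. The accuracy
  \<open>(1 / 2) ^ k\<close> of the approximants makes \<open>N\<close> summable.\<close>

lemma Lp_representation:
  fixes \<xi> :: "'a \<Rightarrow> 'b::euclidean_space"
  assumes T: "0 < T" and p: "1 < p" and \<xi>: "\<xi> \<in> borel_measurable (F T)" "integrable M (\<lambda>\<omega>. norm (\<xi> \<omega>) powr p)"
    and mean: "expectation \<xi> = 0"
  obtains g where "progressively_measurable F T g"
    "\<And>s. integrable M (\<lambda>\<omega>. norm (g s \<omega>) powr p)" "\<And>s. integrable M (g s)" "\<And>s. expectation (g s) = 0"
    "set_integrable lborel {0..T} (\<lambda>s. (LINT \<omega>|M. norm (g s \<omega>) powr p) powr (1 / p))"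
    "AE \<omega> in M. set_integrable lborel {0..T} (\<lambda>s. g s \<omega>) \<and> (LINT s:{0..T}|lborel. g s \<omega>) = \<xi> \<omega>"
proof -
  have p0: "0 < p" "1 \<le> p" using p by auto
  have [measurable]: "\<xi> \<in> borel_measurable M" by (rule measurable_F[OF \<xi>(1)])
  define Q where "Q k t \<eta> \<longleftrightarrow> t \<in> {0..<T} \<and> \<eta> \<in> borel_measurable (F t) \<and> integrable M (\<lambda>\<omega>. norm (\<eta> \<omega>) powr p) \<and>
    expectation \<eta> = 0 \<and> expectation (\<lambda>\<omega>. norm (\<xi> \<omega> - \<eta> \<omega>) powr p) \<le> ((1 / 2) ^ k) powr p"
    for k :: nat and t and \<eta> :: "'a \<Rightarrow> 'b"
  have "\<exists>t \<eta>. Q k t \<eta>" for k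
    unfolding Q_def by (rule Lp_approx[OF T p0(2) \<xi> mean]) simp
  then obtain \<tau> \<eta> where Q: "\<And>k. Q k (\<tau> k) (\<eta> k)" by metis
  have \<tau>: "\<tau> k \<in> {0..<T}" and \<eta>F: "\<eta> k \<in> borel_measurable (F (\<tau> k))"
    and \<eta>p: "integrable M (\<lambda>\<omega>. norm (\<eta> k \<omega>) powr p)" and \<eta>0: "expectation (\<eta> k) = 0"
    and \<eta>e: "expectation (\<lambda>\<omega>. norm (\<xi> \<omega> - \<eta> k \<omega>) powr p) \<le> ((1 / 2) ^ k) powr p" for k
    using Q[of k] unfolding Q_def by blast+
  have [measurable]: "\<eta> k \<in> borel_measurable M" for k by (rule measurable_F[OF \<eta>F])
  \<comment> \<open>\<open>c k\<close> involves \<open>\<eta> k\<close> and its predecessor, and the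
    times \<open>\<tau>\<close> need not be ordered; at time \<open>m k\<close> all of
    \<open>\<eta> 0\<close> to \<open>\<eta> k\<close> are known.\<close>
  define m where "m k = Max (\<tau> ` {..k})" for k
  have m\<tau>: "\<tau> j \<le> m k" if "j \<le> k" for j k unfolding m_def using that by (intro Max_ge) auto
  have mT: "m k \<in> {0..<T}" for k
  proof -
    have "0 \<le> m k" using \<tau>[of 0] m\<tau>[of 0 k] by auto
    moreover have "m k < T" unfolding m_def using \<tau> by (subst Max_less_iff) auto
    ultimately show ?thesis by simp
  qed
  have mS: "m k \<le> m (Suc k)" for k unfolding m_def by (intro Max_mono) auto
  \<comment> \<open>At least \<open>m k\<close>, so that \<open>c k\<close> is known; within
    \<open>T / 2 ^ k\<close> of \<open>T\<close>, so that the intervals exhaust the time up to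
    \<open>T\<close>; and, by the halving, strictly increasing even where \<open>m\<close> is
    constant.\<close>
  define t where "t k = T - (T - m k) / 2 ^ k" for k
  have tT: "t k < T" "m k \<le> t k" "T - T / 2 ^ k \<le> t k" for k
  proof -
    have "0 < T - m k" "T - m k \<le> T" using mT[of k] by auto
    then show "t k < T" "T - T / 2 ^ k \<le> t k" by (auto simp: t_def intro!: divide_right_mono)
    have "(T - m k) / 2 ^ k \<le> (T - m k) / 1" using \<open>0 < T - m k\<close> by (intro divide_left_mono) auto
    then show "m k \<le> t k" by (simp add: t_def)
  qed
  have tS: "t k < t (Suc k)" for k
  proof -
    have "(T - m (Suc k)) / 2 ^ Suc k < (T - m (Suc k)) / 2 ^ k" using mT[of "Suc k"] by (intro divide_strict_left_mono) auto
    also have "\<dots> \<le> (T - m k) / 2 ^ k" using mS[of k] by (intro divide_right_mono) auto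
    finally show ?thesis by (simp add: t_def)
  qed
  have tmono: "t j \<le> t k" if "j \<le> k" for j k
    by (rule lift_Suc_mono_le[of t, OF less_imp_le[OF tS] that])
  have t0: "0 \<le> t k" for k using tT(2)[of k] mT[of k] by auto
  have tlim: "\<exists>k. s < t k" if "s < T" for s
  proof -
    have "(\<lambda>k. T * (1 / 2) ^ k) \<longlonglongrightarrow> T * 0" by (intro tendsto_intros LIMSEQ_power_zero) simp
    then have "\<forall>\<^sub>F k in sequentially. T * (1 / 2) ^ k < T - s" using that by (intro order_tendstoD(2)) auto
    then obtain k where "T * (1 / 2) ^ k < T - s" by (auto simp: eventually_sequentially)
    then have "s < T - T / 2 ^ k" by (simp add: power_one_over)
    with tT(3)[of k] show ?thesis by (intro exI[of _ k]) simp
  qed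
  define c where "c k = (case k of 0 \<Rightarrow> \<eta> 0 | Suc j \<Rightarrow> (\<lambda>\<omega>. \<eta> (Suc j) \<omega> - \<eta> j \<omega>))" for k
  define l where "l k = t (Suc k) - t k" for k
  have l0: "0 < l k" for k using tS[of k] by (simp add: l_def)
  have cF: "c k \<in> borel_measurable (F u)" if "t k \<le> u" for k u
  proof -
    have "\<eta> j \<in> borel_measurable (F u)" if "j \<le> k" for j
      using m\<tau>[OF that] tT(2)[of k] \<open>t k \<le> u\<close> by (intro measurable_augmented_filtration_mono[OF \<eta>F]) auto
    then show ?thesis by (cases k) (auto simp: c_def)
  qed
  have [measurable]: "c k \<in> borel_measurable M" for k by (rule measurable_F[OF cF[OF order_refl]])
  have cp: "integrable M (\<lambda>\<omega>. norm (c k \<omega>) powr p)" for k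
    using \<eta>p Lp_diff(1)[OF _ _ \<eta>p \<eta>p p0(1)] by (cases k) (auto simp: c_def)
  have ci: "integrable M (c k)" for k by (rule integrable_Lp[OF _ cp p0(2)]) measurable
  have \<eta>i: "integrable M (\<eta> k)" for k by (rule integrable_Lp[OF _ \<eta>p p0(2)]) measurable
  have c0: "expectation (c k) = 0" for k
    using \<eta>0 \<eta>i by (cases k) (auto simp: c_def)
  have csum: "(\<Sum>k<Suc n. c k \<omega>) = \<eta> n \<omega>" for n \<omega>
    by (induction n) (simp_all add: c_def)
  define N where "N k = (expectation (\<lambda>\<omega>. norm (c k \<omega>) powr p)) powr (1 / p)" for k
  have N0: "0 \<le> N k" for k by (simp add: N_def)
  have Nle: "N (Suc k) \<le> (2 powr p * 2) powr (1 / p) * (1 / 2) ^ k" for k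
  proof -
    have i: "integrable M (\<lambda>\<omega>. norm (\<xi> \<omega> - \<eta> k \<omega>) powr p)" for k
      using Lp_diff(1)[OF _ _ \<xi>(2) \<eta>p p0(1)] by simp
    have "c (Suc k) \<omega> = (\<xi> \<omega> - \<eta> k \<omega>) - (\<xi> \<omega> - \<eta> (Suc k) \<omega>)" for \<omega> by (simp add: c_def)
    then have "expectation (\<lambda>\<omega>. norm (c (Suc k) \<omega>) powr p) \<le>
        2 powr p * (expectation (\<lambda>\<omega>. norm (\<xi> \<omega> - \<eta> k \<omega>) powr p) + expectation (\<lambda>\<omega>. norm (\<xi> \<omega> - \<eta> (Suc k) \<omega>) powr p))"
      using Lp_diff(2)[OF _ _ i[of k] i[of "Suc k"] p0(1)] by simp
    also have "\<dots> \<le> 2 powr p * (((1 / 2) ^ k) powr p + ((1 / 2) ^ Suc k) powr p)"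
      by (intro mult_left_mono add_mono \<eta>e) auto
    also have "\<dots> \<le> 2 powr p * (((1 / 2) ^ k) powr p + ((1 / 2) ^ k) powr p)"
      using p0 by (intro mult_left_mono add_left_mono powr_mono2) auto
    also have "\<dots> = (2 powr p * 2) * ((1 / 2) ^ k) powr p" by simp
    finally have "N (Suc k) \<le> ((2 powr p * 2) * ((1 / 2) ^ k) powr p) powr (1 / p)"
      unfolding N_def using p0 by (intro powr_mono2) auto
    also have "\<dots> = (2 powr p * 2) powr (1 / p) * (((1 / 2) ^ k) powr p) powr (1 / p)"
      by (rule powr_mult)
    also have "(((1 / 2) ^ k) powr p) powr (1 / p) = (1 / 2 :: real) ^ k" using p0 by (simp add: powr_powr)
    finally show ?thesis .
  qed
  have "summable (\<lambda>k. N (Suc k))"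
    by (rule summable_comparison_test'[where g="\<lambda>k. (2 powr p * 2) powr (1 / p) * (1 / 2) ^ k"])
      (use Nle N0 in \<open>auto intro!: summable_mult summable_geometric\<close>)
  then have Nsum: "summable N" by (simp only: summable_Suc_iff)

  \<comment> \<open>The index of the interval that contains \<open>s\<close>. It presents
    \<open>g\<close> as a countable composition, which settles joint measurability.\<close>
  define K where "K s = (LEAST k. s \<le> t (Suc k))" for s
  define g where "g s \<omega> = (if t 0 < s \<and> s < T then (1 / l (K s)) *\<^sub>R c (K s) \<omega> else 0)" for s \<omega>
  have K1: "s \<in> {t (K s)<..t (Suc (K s))}" if s: "t 0 < s" "s < T" for s
  proof -
    obtain k where "s < t k" using tlim[OF s(2)] by auto
    then have "s \<le> t (Suc k)" using tS[of k] by simp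
    then have 1: "s \<le> t (Suc (K s))" unfolding K_def by (rule LeastI)
    have "t (K s) < s"
    proof (cases "K s")
      case (Suc j)
      then have "\<not> s \<le> t (Suc j)" using not_less_Least[of j "\<lambda>k. s \<le> t (Suc k)"] by (simp add: K_def)
      then show ?thesis by (simp add: Suc)
    qed (use s in simp)
    with 1 show ?thesis by simp
  qed
  have K2: "t 0 < s" "s < T" "K s = k" if s: "s \<in> {t k<..t (Suc k)}" for s k
  proof -
    show s1: "t 0 < s" "s < T" using s tmono[of 0 k] tT(1)[of "Suc k"] by auto
    have "K s \<le> k" unfolding K_def using s by (intro Least_le) auto
    moreover have "\<not> K s < k"
    proof
      assume "K s < k"
      then have "t (Suc (K s)) \<le> t k" by (intro tmono) simp
      with K1[OF s1] s show False by simp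
    qed
    ultimately show "K s = k" by simp
  qed
  have gk: "g s \<omega> = (1 / l k) *\<^sub>R c k \<omega>" if "s \<in> {t k<..t (Suc k)}" for s k \<omega>
    using K2[OF that] by (simp add: g_def)

  have pm: "progressively_measurable F T g"
    unfolding progressively_measurable_def
  proof
    fix u assume u: "u \<in> {0..T}"
    let ?R = "restrict_space borel {0..u} \<Otimes>\<^sub>M F u"
    have fst': "fst \<in> borel_measurable ?R"
      using measurable_compose[OF measurable_fst measurable_restrict_space1[of "\<lambda>x. x" borel borel "{0..u}"]] by simp
    \<comment> \<open>The condition \<open>t k < fst x\<close> holds anyway for
      \<open>k = K (fst x)\<close>. For other \<open>k\<close> it makes the function vanish on
      \<open>{0..u}\<close> when \<open>t k\<close> lies beyond \<open>u\<close> and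
      \<open>c k\<close> may not yet be known.\<close>
    have f: "(\<lambda>x. if t 0 < fst x \<and> fst x < T \<and> t k < fst x then (1 / l k) *\<^sub>R c k (snd x) else 0) \<in> borel_measurable ?R" for k
    proof (cases "t k \<le> u")
      case True
      have "(\<lambda>x. c k (snd x)) \<in> borel_measurable ?R" by (rule measurable_compose[OF measurable_snd cF[OF True]])
      then show ?thesis using fst' by measurable
    next
      case False
      have "(\<lambda>x. 0) \<in> borel_measurable ?R" by simp
      then show ?thesis
        by (rule measurable_cong[THEN iffD1, rotated])
          (use False in \<open>auto simp: space_pair_measure space_restrict_space\<close>)
    qed
    have "K \<in> measurable borel (count_space UNIV)" unfolding K_def[abs_def] by measurable
    then have K: "(\<lambda>x. K (fst x)) \<in> measurable ?R (count_space UNIV)" by (rule measurable_compose[OF fst'])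
    have "(\<lambda>x. if t 0 < fst x \<and> fst x < T \<and> t (K (fst x)) < fst x then (1 / l (K (fst x))) *\<^sub>R c (K (fst x)) (snd x) else 0)
        \<in> borel_measurable ?R"
      by (rule measurable_compose_countable[OF f K])
    moreover have "(if t 0 < s \<and> s < T \<and> t (K s) < s then (1 / l (K s)) *\<^sub>R c (K s) \<omega> else 0) = g s \<omega>" for s \<omega>
      using K1[of s] by (auto simp: g_def)
    ultimately show "(\<lambda>(s, \<omega>). g s \<omega>) \<in> borel_measurable ?R" by (simp add: case_prod_beta')
  qed
  have gp: "integrable M (\<lambda>\<omega>. norm (g s \<omega>) powr p)" for s
    using cp[of "K s"] l0[of "K s"] p0 by (cases "t 0 < s \<and> s < T") (auto simp: g_def powr_mult powr_divide)
  have gi: "integrable M (g s)" for s using ci[of "K s"] by (cases "t 0 < s \<and> s < T") (auto simp: g_def[abs_def])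
  have g0: "expectation (g s) = 0" for s using c0[of "K s"] by (cases "t 0 < s \<and> s < T") (auto simp: g_def[abs_def])
  have gN: "(LINT \<omega>|M. norm (g s \<omega>) powr p) powr (1 / p) = N k / l k" if "s \<in> {t k<..t (Suc k)}" for s k
  proof -
    have "(LINT \<omega>|M. norm (g s \<omega>) powr p) = (1 / l k) powr p * (LINT \<omega>|M. norm (c k \<omega>) powr p)"
      using l0[of k] unfolding gk[OF that] by (simp add: powr_divide)
    also have "\<dots> powr (1 / p) = ((1 / l k) powr p) powr (1 / p) * (LINT \<omega>|M. norm (c k \<omega>) powr p) powr (1 / p)"
      by (rule powr_mult)
    also have "((1 / l k) powr p) powr (1 / p) = 1 / l k" using p0 l0[of k] by (simp add: powr_powr)
    finally show ?thesis by (simp add: N_def)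
  qed
  define h where "h s = (LINT \<omega>|M. norm (g s \<omega>) powr p) powr (1 / p)" for s
  have gc[measurable]: "(\<lambda>x. g (clamp_time T (fst x)) (snd x)) \<in> borel_measurable (lborel \<Otimes>\<^sub>M M)"
    using progressively_measurable_clamp[OF pm] T by auto
  have "(\<lambda>s. (LINT \<omega>|M. norm (g (clamp_time T s) \<omega>) powr p) powr (1 / p)) \<in> borel_measurable lborel"
    by (measurable; simp add: case_prod_beta')
  then have hc[measurable]: "(\<lambda>s. indicator {0..T} s * h (clamp_time T s)) \<in> borel_measurable lborel"
    unfolding h_def by measurable
  have hs: "set_integrable lborel {0..T} h"
    unfolding set_integrable_def real_scaleR_def
  proof (rule integrableI_nonneg)
    have eq: "indicator {0..T} s * h (clamp_time T s) = indicator {0..T} s * h s" for s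
      by (auto simp: indicator_def)
    show "(\<lambda>s. indicator {0..T} s * h s) \<in> borel_measurable lborel" using hc unfolding eq .
    show "AE s in lborel. 0 \<le> indicator {0..T} s * h s" by (simp add: h_def)
    have "(\<integral>\<^sup>+s. ennreal (indicator {0..T} s * h s) \<partial>lborel) \<le>
        (\<integral>\<^sup>+s. (\<Sum>k. ennreal (N k / l k) * indicator {t k<..t (Suc k)} s) \<partial>lborel)"
    proof (rule nn_integral_mono)
      fix s
      let ?f = "\<lambda>k. ennreal (N k / l k) * indicator {t k<..t (Suc k)} s"
      show "ennreal (indicator {0..T} s * h s) \<le> (\<Sum>k. ?f k)"
      proof (cases "t 0 < s \<and> s < T")
        case True
        then have "ennreal (indicator {0..T} s * h s) \<le> ?f (K s)"
          using K1[of s] gN[of s "K s"] by (auto simp: h_def indicator_def)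
        also have "\<dots> \<le> (\<Sum>k. ?f k)"
          using sum_le_suminf[of ?f "{K s}"]
          by (simp only: sum.insert finite.intros empty_iff not_False_eq_True sum.empty add_0_right summableI zero_le simp_thms)
        finally show ?thesis .
      next
        case False
        then have "g s = (\<lambda>\<omega>. 0)" by (auto simp: g_def fun_eq_iff)
        then show ?thesis using p0 by (simp add: h_def)
      qed
    qed
    also have "\<dots> = (\<Sum>k. ennreal (N k / l k) * ennreal (l k))"
      using tS by (simp add: nn_integral_suminf nn_integral_cmult emeasure_lborel_Ioc less_imp_le l_def)
    also have "\<dots> = (\<Sum>k. ennreal (N k))"
    proof (rule suminf_cong)
      fix k
      have "N k / l k * l k = N k" using l0[of k] by simp
      then show "ennreal (N k / l k) * ennreal (l k) = ennreal (N k)"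
        using l0[of k] N0[of k] by (simp only: ennreal_mult[symmetric] divide_nonneg_pos less_imp_le)
    qed
    also have "\<dots> < \<infinity>" using Nsum N0 by (simp add: suminf_ennreal2)
    finally show "(\<integral>\<^sup>+s. ennreal (indicator {0..T} s * h s) \<partial>lborel) < \<infinity>" .
  qed
  have "AE \<omega> in M. set_integrable lborel {0..T} (\<lambda>s. norm (g (clamp_time T s) \<omega>))"
  proof (rule minkowski_integral_finite(1)[OF _ _ p T])
    show "set_integrable lborel {0..T} (\<lambda>s. (LINT \<omega>|M. norm (g (clamp_time T s) \<omega>) powr p) powr (1 / p))"
      using hs by (subst set_integrable_cong[OF refl refl, of _ _ h]) (simp_all add: h_def)
  qed (use gp in auto)
  then have AEint: "AE \<omega> in M. set_integrable lborel {0..T} (\<lambda>s. g s \<omega>)"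
    using AE_space
  proof eventually_elim
    fix \<omega> assume i: "set_integrable lborel {0..T} (\<lambda>s. norm (g (clamp_time T s) \<omega>))" and w: "\<omega> \<in> space M"
    have m: "(\<lambda>s. g (clamp_time T s) \<omega>) \<in> borel_measurable lborel"
      using measurable_compose[OF measurable_Pair2'[OF w] gc] by simp
    have "integrable lborel (\<lambda>s. indicator {0..T} s *\<^sub>R g (clamp_time T s) \<omega>)"
      by (rule Bochner_Integration.integrable_bound[OF i[unfolded set_integrable_def]]) (use m in auto)
    moreover have "indicator {0..T} s *\<^sub>R g (clamp_time T s) \<omega> = indicator {0..T} s *\<^sub>R g s \<omega>" for s
      by (auto simp: indicator_def)
    ultimately show "set_integrable lborel {0..T} (\<lambda>s. g s \<omega>)" by (simp add: set_integrable_def)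
  qed
  define A where "A \<omega> = (LINT s:{0..T}|lborel. g s \<omega>)" for \<omega>
  \<comment> \<open>The integral up to \<open>t n\<close> telescopes to a partial sum of the
    \<open>c k\<close>, that is to one of the \<open>\<eta>\<close>; dominated convergence extends
    this to \<open>T\<close>.\<close>
  have lim: "(\<lambda>n. \<eta> n \<omega>) \<longlonglongrightarrow> A \<omega>" if i: "set_integrable lborel {0..T} (\<lambda>s. g s \<omega>)" for \<omega>
  proof -
    have isub: "set_integrable lborel {a<..b} (\<lambda>s. g s \<omega>)" if "0 \<le> a" "b \<le> T" for a b
      by (rule set_integrable_subset[OF i]) (use that in auto)
    have I: "(LINT s:{t 0<..t n}|lborel. g s \<omega>) = (\<Sum>k<n. c k \<omega>)" for n
    proof (induction n)
      case 0
      then show ?case by (simp add: set_lebesgue_integral_def)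
    next
      case (Suc n)
      have "{t 0<..t (Suc n)} = {t 0<..t n} \<union> {t n<..t (Suc n)}"
        using tmono[of 0 n] tS[of n] by auto
      then have "(LINT s:{t 0<..t (Suc n)}|lborel. g s \<omega>) =
          (LINT s:{t 0<..t n}|lborel. g s \<omega>) + (LINT s:{t n<..t (Suc n)}|lborel. g s \<omega>)"
        using t0 tT(1) by (simp only:) (intro set_integral_Un isub; auto intro: less_imp_le)
      also have "(LINT s:{t n<..t (Suc n)}|lborel. g s \<omega>) = (LINT s:{t n<..t (Suc n)}|lborel. (1 / l n) *\<^sub>R c n \<omega>)"
        by (intro set_lebesgue_integral_cong) (auto simp: gk)
      also have "\<dots> = c n \<omega>"
        using tS[of n] l0[of n] by (simp add: set_lebesgue_integral_def l_def measure_lborel_Ioc less_imp_le)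
      finally show ?case by (simp add: Suc.IH)
    qed
    have "(\<lambda>n. LINT s|lborel. indicator {t 0<..t n} s *\<^sub>R g s \<omega>) \<longlonglongrightarrow> (LINT s|lborel. indicator {0..T} s *\<^sub>R g s \<omega>)"
    proof (rule integral_dominated_convergence[where w="\<lambda>s. norm (indicator {0..T} s *\<^sub>R g s \<omega>)"])
      show "(\<lambda>s. indicator {0..T} s *\<^sub>R g s \<omega>) \<in> borel_measurable lborel"
        using i unfolding set_integrable_def by auto
      show "integrable lborel (\<lambda>s. norm (indicator {0..T} s *\<^sub>R g s \<omega>))"
        using i unfolding set_integrable_def by (rule integrable_norm)
      show "(\<lambda>s. indicator {t 0<..t n} s *\<^sub>R g s \<omega>) \<in> borel_measurable lborel" for n
        using isub[of "t 0" "t n"] t0 tT(1)[of n] unfolding set_integrable_def by auto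
      show "AE s in lborel. norm (indicator {t 0<..t n} s *\<^sub>R g s \<omega>) \<le> norm (indicator {0..T} s *\<^sub>R g s \<omega>)" for n
        using t0[of 0] tT(1)[of n] by (intro AE_I2) (auto simp: indicator_def)
      show "AE s in lborel. (\<lambda>n. indicator {t 0<..t n} s *\<^sub>R g s \<omega>) \<longlonglongrightarrow> indicator {0..T} s *\<^sub>R g s \<omega>"
      proof (rule AE_I2)
        fix s
        show "(\<lambda>n. indicator {t 0<..t n} s *\<^sub>R g s \<omega>) \<longlonglongrightarrow> indicator {0..T} s *\<^sub>R g s \<omega>"
        proof (cases "t 0 < s \<and> s < T")
          case True
          then obtain k where k: "s < t k" using tlim by auto
          have "indicator {t 0<..t n} s *\<^sub>R g s \<omega> = indicator {0..T} s *\<^sub>R g s \<omega>" if "k \<le> n" for n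
            using True k tmono[OF that] t0[of 0] by (auto simp: indicator_def)
          then show ?thesis
            by (intro tendsto_eventually) (auto simp: eventually_sequentially)
        next
          case False
          then have "g s \<omega> = 0" by (auto simp: g_def)
          then show ?thesis by simp
        qed
      qed
    qed
    then have "(\<lambda>n. \<Sum>k<n. c k \<omega>) \<longlonglongrightarrow> A \<omega>" by (simp only: A_def set_lebesgue_integral_def[symmetric] I)
    from LIMSEQ_Suc[OF this] show ?thesis unfolding csum .
  qed
  have "AE \<omega> in M. A \<omega> = \<xi> \<omega>"
  proof -
    have [measurable]: "(\<lambda>\<omega>. lim (\<lambda>n. \<eta> n \<omega>)) \<in> borel_measurable M" by measurable
    \<comment> \<open>\<open>?L\<close> is measurable by construction and agrees with
      \<open>A\<close> almost surely. Fatou's lemma identifies it with \<open>\<xi>\<close>, to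
      which the \<open>\<eta> n\<close> converge in \<open>L^p\<close>.\<close>
    let ?L = "\<lambda>\<omega>. lim (\<lambda>n. \<eta> n \<omega>)"
    have AL: "AE \<omega> in M. (\<lambda>n. \<eta> n \<omega>) \<longlonglongrightarrow> A \<omega> \<and> ?L \<omega> = A \<omega>"
      using AEint by eventually_elim (use lim limI in blast)
    have "(\<integral>\<^sup>+\<omega>. ennreal (norm (\<xi> \<omega> - ?L \<omega>) powr p) \<partial>M) =
        (\<integral>\<^sup>+\<omega>. liminf (\<lambda>n. ennreal (norm (\<xi> \<omega> - \<eta> n \<omega>) powr p)) \<partial>M)"
    proof (rule nn_integral_cong_AE, use AL in eventually_elim)
      fix \<omega> assume a: "(\<lambda>n. \<eta> n \<omega>) \<longlonglongrightarrow> A \<omega> \<and> ?L \<omega> = A \<omega>"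
      have "(\<lambda>n. norm (\<xi> \<omega> - \<eta> n \<omega>) powr p) \<longlonglongrightarrow> norm (\<xi> \<omega> - A \<omega>) powr p"
        using a p0 by (intro tendsto_powr' tendsto_intros) auto
      then have "(\<lambda>n. ennreal (norm (\<xi> \<omega> - \<eta> n \<omega>) powr p)) \<longlonglongrightarrow> ennreal (norm (\<xi> \<omega> - A \<omega>) powr p)"
        by (rule tendsto_ennrealI)
      then show "ennreal (norm (\<xi> \<omega> - ?L \<omega>) powr p) = liminf (\<lambda>n. ennreal (norm (\<xi> \<omega> - \<eta> n \<omega>) powr p))"
        using a lim_imp_Liminf[OF sequentially_bot] by metis
    qed
    also have "\<dots> \<le> liminf (\<lambda>n. \<integral>\<^sup>+\<omega>. ennreal (norm (\<xi> \<omega> - \<eta> n \<omega>) powr p) \<partial>M)"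
      by (rule nn_integral_liminf) measurable
    also have "\<dots> \<le> liminf (\<lambda>n. ennreal (((1 / 2) ^ n) powr p))"
    proof (intro Liminf_mono always_eventually allI)
      fix n
      have "integrable M (\<lambda>\<omega>. norm (\<xi> \<omega> - \<eta> n \<omega>) powr p)"
        using Lp_diff(1)[OF _ _ \<xi>(2) \<eta>p p0(1)] by simp
      then show "(\<integral>\<^sup>+\<omega>. ennreal (norm (\<xi> \<omega> - \<eta> n \<omega>) powr p) \<partial>M) \<le> ennreal (((1 / 2) ^ n) powr p)"
        using \<eta>e[of n] by (subst nn_integral_eq_integral) (auto intro: ennreal_leI)
    qed
    also have "\<dots> = 0"
    proof -
      have "(\<lambda>n. ((1 / 2) ^ n) powr p) \<longlonglongrightarrow> (0::real) powr p"
        using p0 by (intro tendsto_powr' LIMSEQ_power_zero tendsto_const) auto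
      then have "(\<lambda>n. ennreal (((1 / 2) ^ n) powr p)) \<longlonglongrightarrow> 0"
        using tendsto_ennrealI by fastforce
      then show ?thesis using lim_imp_Liminf[OF sequentially_bot] by metis
    qed
    finally have "AE \<omega> in M. ennreal (norm (\<xi> \<omega> - ?L \<omega>) powr p) = 0"
      by (subst (asm) le_zero_eq, subst (asm) nn_integral_0_iff_AE) auto
    with AL show ?thesis by eventually_elim (use p0 in auto)
  qed
  with AEint have "AE \<omega> in M. set_integrable lborel {0..T} (\<lambda>s. g s \<omega>) \<and> (LINT s:{0..T}|lborel. g s \<omega>) = \<xi> \<omega>"
    by eventually_elim (simp add: A_def)
  then show thesis using that[OF pm gp gi g0 hs[unfolded h_def[abs_def]]] by blast
qed

end

section \<open>Uniqueness of solutions\<close>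

text \<open>Stated for bounded integrable functions, the regularity available for the means and
  \<open>L^1\<close> norms of differences of solutions. The supremum \<open>S\<close> of the
  weighted function satisfies \<open>S \<le> S / 2\<close>.\<close>

lemma gronwall_zero:
  fixes \<phi> :: "real \<Rightarrow> real"
  assumes bd: "\<And>t. t \<in> {0..T} \<Longrightarrow> 0 \<le> \<phi> t \<and> \<phi> t \<le> b"
    and int: "set_integrable lborel {0..T} \<phi>" and c: "0 \<le> c"
    and le: "\<And>t. t \<in> {0..T} \<Longrightarrow> \<phi> t \<le> c * (LINT s:{0..t}|lborel. \<phi> s)"
    and t: "t \<in> {0..T}"
  shows "\<phi> t = 0"
proof -
  \<comment> \<open>The \<open>1\<close> makes \<open>k\<close> positive also for
    \<open>c = 0\<close>, as the division by \<open>2 * k\<close> requires.\<close>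
  define k where "k = c + 1"
  \<comment> \<open>In the norm \<open>sup \<bar>\<phi> s\<bar> exp (- 2 k s)\<close> the integral operator is a contraction with constant \<open>1 / 2\<close>.\<close>
  define \<psi> where "\<psi> s = \<phi> s * exp (- 2 * k * s)" for s
  define S where "S = (SUP s\<in>{0..T}. \<psi> s)"
  have k0: "0 < k" using c by (simp add: k_def)
  have "\<psi> s \<le> b" if s: "s \<in> {0..T}" for s
  proof -
    have "\<phi> s * exp (- 2 * k * s) \<le> \<phi> s * 1"
      using bd[OF s] s k0 by (intro mult_left_mono) auto
    then show ?thesis using bd[OF s] by (simp add: \<psi>_def)
  qed
  then have bdd: "bdd_above (\<psi> ` {0..T})" by (auto intro: bdd_aboveI[of _ b])
  have \<psi>S: "\<psi> s \<le> S" if "s \<in> {0..T}" for s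
    unfolding S_def by (rule cSUP_upper[OF that bdd])
  have "0 \<le> \<psi> t" using bd[OF t] by (simp add: \<psi>_def)
  then have S0: "0 \<le> S" using \<psi>S[OF t] by simp
  have \<phi>S: "\<phi> s \<le> S * exp (2 * k * s)" if s: "s \<in> {0..T}" for s
  proof -
    have "\<phi> s = \<psi> s * exp (2 * k * s)" by (simp add: \<psi>_def mult.assoc flip: exp_add)
    also have "\<dots> \<le> S * exp (2 * k * s)" using \<psi>S[OF s] by (intro mult_right_mono) auto
    finally show ?thesis .
  qed
  have half: "\<psi> r \<le> S / 2" if r: "r \<in> {0..T}" for r
  proof -
    have ir: "set_integrable lborel {0..r} \<phi>" by (rule set_integrable_subset[OF int]) (use r in auto)
    have ce: "continuous_on {0..r} (\<lambda>s. S * exp (2 * k * s))" by (intro continuous_intros)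
    have I0: "0 \<le> (LINT s:{0..r}|lborel. \<phi> s)"
      unfolding set_lebesgue_integral_def using bd r by (intro integral_nonneg_AE AE_I2) (auto simp: indicator_def)
    have "\<phi> r \<le> k * (LINT s:{0..r}|lborel. \<phi> s)"
      using le[OF r] I0 mult_right_mono[of c k "LINT s:{0..r}|lborel. \<phi> s"] by (simp add: k_def)
    also have "\<dots> \<le> k * (LINT s:{0..r}|lborel. S * exp (2 * k * s))"
      using \<phi>S r k0 by (intro mult_left_mono set_integral_mono ir borel_integrable_atLeastAtMost'[OF ce]) auto
    also have "(LINT s:{0..r}|lborel. S * exp (2 * k * s)) = S * exp (2 * k * r) / (2 * k) - S * exp (2 * k * 0) / (2 * k)"
      unfolding set_lebesgue_integral_def
    proof (rule integral_FTC_atLeastAtMost[OF _ _ ce])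
      fix s
      have "((\<lambda>s. S * exp (2 * k * s) / (2 * k)) has_real_derivative S * exp (2 * k * s)) (at s within {0..r})"
        using k0 by (auto intro!: derivative_eq_intros)
      then show "((\<lambda>s. S * exp (2 * k * s) / (2 * k)) has_vector_derivative S * exp (2 * k * s)) (at s within {0..r})"
        by (simp add: has_real_derivative_iff_has_vector_derivative)
    qed (use r in auto)
    also have "k * (S * exp (2 * k * r) / (2 * k) - S * exp (2 * k * 0) / (2 * k)) = S / 2 * exp (2 * k * r) - S / 2"
      using k0 by (simp add: field_simps)
    also have "\<dots> \<le> S / 2 * exp (2 * k * r)" using S0 by simp
    finally have "\<phi> r * exp (- 2 * k * r) \<le> S / 2 * exp (2 * k * r) * exp (- 2 * k * r)"
      by (intro mult_right_mono) auto
    then show ?thesis by (simp add: \<psi>_def mult.assoc flip: exp_add)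
  qed
  have "S \<le> S / 2" using half t unfolding S_def by (intro cSUP_least) auto
  then have "\<phi> t \<le> 0" using \<phi>S[OF t] S0 by simp
  then show ?thesis using bd[OF t] by simp
qed

lemma norm_matrix_vector_le: "norm (A *v x) \<le> onorm ((*v) A) * norm x" for A :: "real ^ 'n ^ 'm"
  by (rule onorm) simp

lemma onorm_matrix_nonneg: "0 \<le> onorm ((*v) A)" for A :: "real ^ 'n ^ 'm"
  by (rule onorm_pos_le) simp

section \<open>Expectations along solutions, and uniqueness\<close>

context brownian
begin

text \<open>Fubini for the process cut off by the indicator of \<open>{0..t}\<close>: clamping the
  time supplies joint measurability, and the finite time integral of the \<open>L^1\<close> norms
  supplies integrability on the product.\<close>

lemma fubini_process:
  fixes D :: "real \<Rightarrow> 'a \<Rightarrow> 'b::euclidean_space"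
  assumes meas: "(\<lambda>x. D (clamp_time T (fst x)) (snd x)) \<in> borel_measurable (lborel \<Otimes>\<^sub>M M)"
    and int: "\<And>s. s \<in> {0..T} \<Longrightarrow> integrable M (D s)"
    and nint: "set_integrable lborel {0..T} (\<lambda>s. expectation (\<lambda>\<omega>. norm (D s \<omega>)))"
    and t: "t \<in> {0..T}"
  shows "AE \<omega> in M. set_integrable lborel {0..t} (\<lambda>s. D s \<omega>)"
    and "integrable M (\<lambda>\<omega>. LINT s:{0..t}|lborel. D s \<omega>)"
    and "expectation (\<lambda>\<omega>. LINT s:{0..t}|lborel. D s \<omega>) = (LINT s:{0..t}|lborel. expectation (D s))"
proof -
  interpret P: pair_sigma_finite lborel M ..
  define f where "f s \<omega> = indicator {0..t} s *\<^sub>R D (clamp_time T s) \<omega>" for s \<omega>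
  have feq: "f s \<omega> = indicator {0..t} s *\<^sub>R D s \<omega>" for s \<omega>
    using t by (auto simp: f_def indicator_def)
  note [measurable] = meas
  have fm: "(\<lambda>x. f (fst x) (snd x)) \<in> borel_measurable (lborel \<Otimes>\<^sub>M M)" unfolding f_def by measurable
  have fi: "integrable M (f s)" for s
    using int[of s] t by (cases "s \<in> {0..t}") (auto simp: feq[abs_def])
  have "set_integrable lborel {0..t} (\<lambda>s. expectation (\<lambda>\<omega>. norm (D s \<omega>)))"
    by (rule set_integrable_subset[OF nint]) (use t in auto)
  moreover have "indicator {0..t} s *\<^sub>R expectation (\<lambda>\<omega>. norm (D s \<omega>)) = expectation (\<lambda>\<omega>. norm (f s \<omega>))" for s
    by (auto simp: feq indicator_def)
  ultimately have n: "integrable lborel (\<lambda>s. expectation (\<lambda>\<omega>. norm (f s \<omega>)))"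
    by (simp add: set_integrable_def)
  have F: "integrable (lborel \<Otimes>\<^sub>M M) (\<lambda>x. f (fst x) (snd x))"
    by (rule P.Fubini_integrable[OF fm]) (use n fi in auto)
  then have F': "integrable (lborel \<Otimes>\<^sub>M M) (case_prod f)" by (simp add: case_prod_beta')
  show "AE \<omega> in M. set_integrable lborel {0..t} (\<lambda>s. D s \<omega>)"
    using P.AE_integrable_snd[OF F'] unfolding feq set_integrable_def by simp
  show "integrable M (\<lambda>\<omega>. LINT s:{0..t}|lborel. D s \<omega>)"
    using P.integrable_snd[OF F'] unfolding feq set_lebesgue_integral_def by simp
  have "expectation (\<lambda>\<omega>. LINT s:{0..t}|lborel. D s \<omega>) = (LINT s|lborel. expectation (f s))"
    using P.Fubini_integral[OF F'] unfolding feq[symmetric] set_lebesgue_integral_def .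
  also have "\<dots> = (LINT s|lborel. indicator {0..t} s *\<^sub>R expectation (D s))"
    by (simp add: feq[abs_def])
  finally show "expectation (\<lambda>\<omega>. LINT s:{0..t}|lborel. D s \<omega>) = (LINT s:{0..t}|lborel. expectation (D s))"
    unfolding set_lebesgue_integral_def .
qed

lemma progressively_measurable_section:
  assumes "progressively_measurable F T X" "t \<in> {0..T}"
  shows "X t \<in> borel_measurable (F t)"
proof -
  have T: "0 \<le> t" "t \<le> T" using assms(2) by auto
  have "(\<lambda>\<omega>. X (clamp_time t (fst (t, \<omega>))) (snd (t, \<omega>))) \<in> borel_measurable (F t)"
    by (rule measurable_compose[OF measurable_Pair1' progressively_measurable_clamp(1)[OF assms(1) T]]) simp
  then show ?thesis using T by simp
qed

text \<open>The supremum condition in \<open>is_solution\<close> yields one bound for all times,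
  which is the boundedness that \<open>gronwall_zero\<close> asks for.\<close>

lemma solution_integrable:
  assumes sol: "is_solution M F W T A1 A2 B1 B2 C p x u X" and p: "1 \<le> p"
  shows "\<exists>k. \<forall>t\<in>{0..T}. integrable M (X t) \<and> expectation (\<lambda>\<omega>. norm (X t \<omega>)) \<le> k"
proof (intro exI ballI)
  fix t assume t: "t \<in> {0..T}"
  let ?S = "\<integral>\<^sup>+\<omega>. (SUP t\<in>{0..T}. ennreal (norm (X t \<omega>) powr p)) \<partial>M"
  have fin: "?S < \<infinity>" and pm: "progressively_measurable F T X" using sol by (auto simp: is_solution_def)
  have m[measurable]: "X t \<in> borel_measurable M" by (rule measurable_F[OF progressively_measurable_section[OF pm t]])
  have le: "(\<integral>\<^sup>+\<omega>. ennreal (norm (X t \<omega>)) \<partial>M) \<le> 1 + ?S"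
  proof -
    have "(\<integral>\<^sup>+\<omega>. ennreal (norm (X t \<omega>)) \<partial>M) \<le> (\<integral>\<^sup>+\<omega>. 1 + ennreal (norm (X t \<omega>) powr p) \<partial>M)"
    proof (rule nn_integral_mono)
      fix \<omega>
      have "ennreal (norm (X t \<omega>)) \<le> ennreal (1 + norm (X t \<omega>) powr p)"
        by (intro ennreal_leI le_one_plus_powr p) simp
      then show "ennreal (norm (X t \<omega>)) \<le> 1 + ennreal (norm (X t \<omega>) powr p)" by simp
    qed
    also have "\<dots> = 1 + (\<integral>\<^sup>+\<omega>. ennreal (norm (X t \<omega>) powr p) \<partial>M)"
      by (simp add: nn_integral_add emeasure_space_1)
    also have "\<dots> \<le> 1 + ?S" using t by (intro add_left_mono nn_integral_mono SUP_upper)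
    finally show ?thesis .
  qed
  also have top: "1 + ?S < \<infinity>" using fin by simp
  finally have int: "integrable M (X t)" by (intro integrableI_bounded m)
  have "ennreal (expectation (\<lambda>\<omega>. norm (X t \<omega>))) \<le> 1 + ?S"
    using le int by (subst nn_integral_eq_integral[symmetric]) auto
  also have "1 + ?S = ennreal (enn2real (1 + ?S))"
    using top by (intro ennreal_enn2real[symmetric]) simp
  finally have "expectation (\<lambda>\<omega>. norm (X t \<omega>)) \<le> enn2real (1 + ?S)"
    by (simp only: ennreal_le_iff[OF enn2real_nonneg])
  with int show "integrable M (X t) \<and> expectation (\<lambda>\<omega>. norm (X t \<omega>)) \<le> enn2real (1 + ?S)" by simp
qed

text \<open>Taking expectations removes the Ito integrals, so the difference of the means solves a
  homogeneous linear equation and vanishes. The noise coefficient depends on the mean alone; both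
  solutions then have the same Ito integral, and their difference satisfies an inequality free of
  noise.\<close>

lemma solution_unique:
  fixes u :: "real \<Rightarrow> 'a \<Rightarrow> real ^ 'n" and X X' :: "real \<Rightarrow> 'a \<Rightarrow> real ^ 'd"
  assumes sol: "is_solution M F W T A1 A2 B1 B2 C p x u X" "is_solution M F W T A1 A2 B1 B2 C p x u X'"
    and p: "1 \<le> p" and t: "t \<in> {0..T}"
  shows "AE \<omega> in M. X t \<omega> = X' t \<omega>"
proof -
  have T: "0 \<le> T" using t by simp
  have pm: "progressively_measurable F T X" "progressively_measurable F T X'"
    using sol by (auto simp: is_solution_def)
  obtain k k' where k: "\<And>t. t \<in> {0..T} \<Longrightarrow> integrable M (X t) \<and> expectation (\<lambda>\<omega>. norm (X t \<omega>)) \<le> k"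
    and k': "\<And>t. t \<in> {0..T} \<Longrightarrow> integrable M (X' t) \<and> expectation (\<lambda>\<omega>. norm (X' t \<omega>)) \<le> k'"
    using solution_integrable[OF sol(1) p] solution_integrable[OF sol(2) p] by blast
  define D where "D s \<omega> = X s \<omega> - X' s \<omega>" for s \<omega>
  define \<delta> where "\<delta> s = expectation (D s)" for s
  define \<phi> where "\<phi> s = expectation (\<lambda>\<omega>. norm (D s \<omega>))" for s
  have Dm[measurable]: "(\<lambda>x. D (clamp_time T (fst x)) (snd x)) \<in> borel_measurable (lborel \<Otimes>\<^sub>M M)"
    unfolding D_def using progressively_measurable_clamp(2)[OF pm(1) T] progressively_measurable_clamp(2)[OF pm(2) T]
    by (intro borel_measurable_diff) auto
  have Di: "integrable M (D s)" if "s \<in> {0..T}" for s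
    using k[OF that] k'[OF that] by (auto simp: D_def[abs_def])
  have \<phi>le: "0 \<le> \<phi> s \<and> \<phi> s \<le> k + k'" if s: "s \<in> {0..T}" for s
  proof -
    have "\<phi> s \<le> expectation (\<lambda>\<omega>. norm (X s \<omega>) + norm (X' s \<omega>))"
      unfolding \<phi>_def using k[OF s] k'[OF s] Di[OF s] by (intro integral_mono) (auto simp: D_def intro: norm_triangle_ineq4)
    also have "\<dots> \<le> k + k'" using k[OF s] k'[OF s] by simp
    finally show ?thesis by (simp add: \<phi>_def)
  qed
  have "(\<lambda>s. expectation (\<lambda>\<omega>. norm (D (clamp_time T s) \<omega>))) \<in> borel_measurable lborel"
    by (measurable; simp add: case_prod_beta')
  then have [measurable]: "(\<lambda>s. \<phi> (clamp_time T s)) \<in> borel_measurable lborel" by (simp add: \<phi>_def)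
  have "(\<lambda>s. expectation (D (clamp_time T s))) \<in> borel_measurable lborel"
    by (measurable; simp add: case_prod_beta')
  then have [measurable]: "(\<lambda>s. \<delta> (clamp_time T s)) \<in> borel_measurable lborel" by (simp add: \<delta>_def)
  have bounded_int: "set_integrable lborel {0..T} f"
    if m: "(\<lambda>s. f (clamp_time T s)) \<in> borel_measurable lborel" and b: "\<And>s. s \<in> {0..T} \<Longrightarrow> norm (f s) \<le> b" for f :: "real \<Rightarrow> 'z::euclidean_space" and b
  proof -
    have "set_integrable lborel {0..T} (\<lambda>s. b)" by (rule borel_integrable_atLeastAtMost') simp
    then have "integrable lborel (\<lambda>s. indicator {0..T} s *\<^sub>R f (clamp_time T s))"
      unfolding set_integrable_def
      by (rule Bochner_Integration.integrable_bound) (use m b in \<open>auto simp: indicator_def intro: order_trans[OF _ abs_ge_self]\<close>)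
    moreover have "indicator {0..T} s *\<^sub>R f (clamp_time T s) = indicator {0..T} s *\<^sub>R f s" for s by (auto simp: indicator_def)
    ultimately show ?thesis by (simp add: set_integrable_def)
  qed
  have \<phi>i: "set_integrable lborel {0..T} \<phi>"
    by (rule bounded_int[of _ "k + k'"]) (use \<phi>le in auto)
  have n\<delta>: "norm (\<delta> s) \<le> \<phi> s" for s unfolding \<delta>_def \<phi>_def by (rule integral_norm_bound)
  have \<delta>i: "set_integrable lborel {0..T} \<delta>"
    by (rule bounded_int[of _ "k + k'"]) (use \<phi>le n\<delta> in \<open>auto intro: order_trans\<close>)
  have sub: "set_integrable lborel {0..r} f" if "set_integrable lborel {0..T} f" "r \<in> {0..T}" for r and f :: "real \<Rightarrow> 'z::euclidean_space"
    by (rule set_integrable_subset[OF that(1)]) (use that(2) in auto)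
  have \<phi>i': "set_integrable lborel {0..T} (\<lambda>s. expectation (\<lambda>\<omega>. norm (D s \<omega>)))"
    using \<phi>i by (simp add: \<phi>_def[abs_def])
  have FD: "AE \<omega> in M. set_integrable lborel {0..r} (\<lambda>s. D s \<omega>)"
    "integrable M (\<lambda>\<omega>. LINT s:{0..r}|lborel. D s \<omega>)"
    "expectation (\<lambda>\<omega>. LINT s:{0..r}|lborel. D s \<omega>) = (LINT s:{0..r}|lborel. \<delta> s)" if "r \<in> {0..T}" for r
    unfolding \<delta>_def by (rule fubini_process[OF Dm Di \<phi>i' that]; assumption)+
  have nD: "(\<lambda>x. norm (D (clamp_time T (fst x)) (snd x))) \<in> borel_measurable (lborel \<Otimes>\<^sub>M M)" by measurable

  \<comment> \<open>The initial value and all terms with the control cancel in the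
    difference.\<close>
  have eqD: "\<exists>Y Y'. has_ito_integral M F W r (\<lambda>s \<omega>. C *v expectation (X s)) Y \<and>
      has_ito_integral M F W r (\<lambda>s \<omega>. C *v expectation (X' s)) Y' \<and>
      (AE \<omega> in M. D r \<omega> = A1 *v (LINT s:{0..r}|lborel. D s \<omega>) + A2 *v (LINT s:{0..r}|lborel. \<delta> s) + (Y \<omega> - Y' \<omega>))"
    if r: "r \<in> {0..T}" for r
  proof -
    obtain Y where Y: "has_ito_integral M F W r (\<lambda>s \<omega>. C *v expectation (X s)) Y"
      "AE \<omega> in M. X r \<omega> = x + (LINT s:{0..r}|lborel. drift M A1 A2 B1 B2 u X s \<omega>) + Y \<omega>"
      using sol(1) r unfolding is_solution_def by blast
    obtain Y' where Y': "has_ito_integral M F W r (\<lambda>s \<omega>. C *v expectation (X' s)) Y'"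
      "AE \<omega> in M. X' r \<omega> = x + (LINT s:{0..r}|lborel. drift M A1 A2 B1 B2 u X' s \<omega>) + Y' \<omega>"
      using sol(2) r unfolding is_solution_def by blast
    have dr: "AE \<omega> in M. set_integrable lborel {0..T} (\<lambda>s. drift M A1 A2 B1 B2 u X s \<omega>)"
      "AE \<omega> in M. set_integrable lborel {0..T} (\<lambda>s. drift M A1 A2 B1 B2 u X' s \<omega>)"
      using sol by (auto simp: is_solution_def)
    note FDr = FD(1)[OF r]
    have dd: "drift M A1 A2 B1 B2 u X s \<omega> - drift M A1 A2 B1 B2 u X' s \<omega> = A1 *v D s \<omega> + A2 *v \<delta> s" if "s \<in> {0..r}" for s \<omega>
    proof -
      have "\<delta> s = expectation (X s) - expectation (X' s)"
        unfolding \<delta>_def D_def using k[of s] k'[of s] that r by (intro Bochner_Integration.integral_diff) auto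
      then show ?thesis by (simp add: drift_def D_def matrix_vector_mult_diff_distrib)
    qed
    have "AE \<omega> in M. D r \<omega> = A1 *v (LINT s:{0..r}|lborel. D s \<omega>) + A2 *v (LINT s:{0..r}|lborel. \<delta> s) + (Y \<omega> - Y' \<omega>)"
      using Y(2) Y'(2) dr FDr
    proof eventually_elim
      case (elim \<omega>)
      have "D r \<omega> = ((LINT s:{0..r}|lborel. drift M A1 A2 B1 B2 u X s \<omega>) - (LINT s:{0..r}|lborel. drift M A1 A2 B1 B2 u X' s \<omega>)) + (Y \<omega> - Y' \<omega>)"
        using elim(1,2) by (simp add: D_def)
      also have "(LINT s:{0..r}|lborel. drift M A1 A2 B1 B2 u X s \<omega>) - (LINT s:{0..r}|lborel. drift M A1 A2 B1 B2 u X' s \<omega>) =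
          (LINT s:{0..r}|lborel. drift M A1 A2 B1 B2 u X s \<omega> - drift M A1 A2 B1 B2 u X' s \<omega>)"
        by (rule set_integral_diff(2)[OF sub[OF elim(3) r] sub[OF elim(4) r], symmetric])
      also have "\<dots> = (LINT s:{0..r}|lborel. A1 *v D s \<omega> + A2 *v \<delta> s)"
        using dd by (intro set_lebesgue_integral_cong) auto
      also have "\<dots> = (LINT s:{0..r}|lborel. A1 *v D s \<omega>) + (LINT s:{0..r}|lborel. A2 *v \<delta> s)"
        using integrable_bounded_linear[OF matrix_vector_mul_bounded_linear elim(5)[unfolded set_integrable_def], of A1]
          integrable_bounded_linear[OF matrix_vector_mul_bounded_linear sub[OF \<delta>i r, unfolded set_integrable_def], of A2]
        by (intro set_integral_add(2)) (auto simp: set_integrable_def matrix_vector_mult_scaleR)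
      also have "(LINT s:{0..r}|lborel. A1 *v D s \<omega>) = A1 *v (LINT s:{0..r}|lborel. D s \<omega>)"
        using integral_bounded_linear[OF matrix_vector_mul_bounded_linear elim(5)[unfolded set_integrable_def], of A1]
        by (simp add: set_lebesgue_integral_def matrix_vector_mult_scaleR)
      also have "(LINT s:{0..r}|lborel. A2 *v \<delta> s) = A2 *v (LINT s:{0..r}|lborel. \<delta> s)"
        using integral_bounded_linear[OF matrix_vector_mul_bounded_linear sub[OF \<delta>i r, unfolded set_integrable_def], of A2]
        by (simp add: set_lebesgue_integral_def matrix_vector_mult_scaleR)
      finally show ?case .
    qed
    with Y(1) Y'(1) show ?thesis by blast
  qed
  have \<delta>0: "\<delta> s = 0" if s: "s \<in> {0..T}" for s
  proof -
    have "norm (\<delta> s) = 0"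
    proof (rule gronwall_zero[OF _ _ _ _ s])
      show "0 \<le> norm (\<delta> r) \<and> norm (\<delta> r) \<le> k + k'" if "r \<in> {0..T}" for r
        using \<phi>le[OF that] n\<delta>[of r] by auto
      show n\<delta>i: "set_integrable lborel {0..T} (\<lambda>s. norm (\<delta> s))" by (rule set_integrable_norm[OF \<delta>i])
      show "0 \<le> onorm ((*v) A1) + onorm ((*v) A2)" by (intro add_nonneg_nonneg onorm_matrix_nonneg)
      fix r assume r: "r \<in> {0..T}"
      obtain Y Y' where Y: "has_ito_integral M F W r (\<lambda>s \<omega>. C *v expectation (X s)) Y"
        "has_ito_integral M F W r (\<lambda>s \<omega>. C *v expectation (X' s)) Y'"
        "AE \<omega> in M. D r \<omega> = A1 *v (LINT s:{0..r}|lborel. D s \<omega>) + A2 *v (LINT s:{0..r}|lborel. \<delta> s) + (Y \<omega> - Y' \<omega>)"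
        using eqD[OF r] by blast
      let ?J = "\<lambda>\<omega>. LINT s:{0..r}|lborel. D s \<omega>" and ?j = "LINT s:{0..r}|lborel. \<delta> s"
      have J: "integrable M ?J" "expectation ?J = ?j" using FD(2,3)[OF r] .
      note AJ = integrable_bounded_linear[OF matrix_vector_mul_bounded_linear J(1), of A1]
        integral_bounded_linear[OF matrix_vector_mul_bounded_linear J(1), of A1]
      note ito = ito_integral_mean[OF Y(1)] ito_integral_mean[OF Y(2)]
      have R: "integrable M (\<lambda>\<omega>. A1 *v ?J \<omega> + A2 *v ?j + (Y \<omega> - Y' \<omega>))"
        using AJ(1) ito by auto
      have "expectation (D r) = expectation (\<lambda>\<omega>. A1 *v ?J \<omega> + A2 *v ?j + (Y \<omega> - Y' \<omega>))"
        by (rule integral_cong_AE[OF borel_measurable_integrable[OF Di[OF r]] borel_measurable_integrable[OF R] Y(3)])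
      then have "\<delta> r = expectation (\<lambda>\<omega>. A1 *v ?J \<omega> + A2 *v ?j + (Y \<omega> - Y' \<omega>))" by (simp only: \<delta>_def)
      also have "\<dots> = A1 *v ?j + A2 *v ?j"
        using AJ ito J(2) by (simp add: prob_space)
      finally have "norm (\<delta> r) \<le> norm (A1 *v ?j) + norm (A2 *v ?j)" by (simp add: norm_triangle_ineq)
      also have "\<dots> \<le> (onorm ((*v) A1) + onorm ((*v) A2)) * norm ?j"
        using norm_matrix_vector_le[of A1 ?j] norm_matrix_vector_le[of A2 ?j] by (simp add: distrib_right)
      also have "\<dots> \<le> (onorm ((*v) A1) + onorm ((*v) A2)) * (LINT s:{0..r}|lborel. norm (\<delta> s))"
        by (intro mult_left_mono set_integral_norm_bound sub[OF \<delta>i r] add_nonneg_nonneg onorm_matrix_nonneg)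
      finally show "norm (\<delta> r) \<le> (onorm ((*v) A1) + onorm ((*v) A2)) * (LINT s:{0..r}|lborel. norm (\<delta> s))" .
    qed
    then show ?thesis by simp
  qed
  have "\<phi> t = 0"
  proof (rule gronwall_zero[OF \<phi>le \<phi>i onorm_matrix_nonneg _ t])
    fix r assume r: "r \<in> {0..T}"
    obtain Y Y' where Y: "has_ito_integral M F W r (\<lambda>s \<omega>. C *v expectation (X s)) Y"
      "has_ito_integral M F W r (\<lambda>s \<omega>. C *v expectation (X' s)) Y'"
      "AE \<omega> in M. D r \<omega> = A1 *v (LINT s:{0..r}|lborel. D s \<omega>) + A2 *v (LINT s:{0..r}|lborel. \<delta> s) + (Y \<omega> - Y' \<omega>)"
      using eqD[OF r] by blast
    have YY: "AE \<omega> in M. Y \<omega> = Y' \<omega>"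
    proof (rule ito_integral_unique[OF Y(1,2)])
      fix s \<omega> assume s: "s \<in> {0..r}"
      have "\<delta> s = expectation (X s) - expectation (X' s)"
        unfolding \<delta>_def D_def using k[of s] k'[of s] s r by (intro Bochner_Integration.integral_diff) auto
      then show "C *v expectation (X s) = C *v expectation (X' s)" using \<delta>0[of s] s r by simp
    qed
    have d0: "(LINT s:{0..r}|lborel. \<delta> s) = (LINT s:{0..r}|lborel. 0)"
      using \<delta>0 r by (intro set_lebesgue_integral_cong) auto
    have le: "AE \<omega> in M. norm (D r \<omega>) \<le> onorm ((*v) A1) * (LINT s:{0..r}|lborel. norm (D s \<omega>))"
      using YY FD(1)[OF r] Y(3)
    proof eventually_elim
      case (elim \<omega>)
      then have "D r \<omega> = A1 *v (LINT s:{0..r}|lborel. D s \<omega>)" unfolding d0 by (simp add: set_lebesgue_integral_def)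
      then have "norm (D r \<omega>) \<le> onorm ((*v) A1) * norm (LINT s:{0..r}|lborel. D s \<omega>)"
        using norm_matrix_vector_le by metis
      also have "\<dots> \<le> onorm ((*v) A1) * (LINT s:{0..r}|lborel. norm (D s \<omega>))"
        by (intro mult_left_mono set_integral_norm_bound elim onorm_matrix_nonneg)
      finally show ?case .
    qed
    have N: "integrable M (\<lambda>\<omega>. LINT s:{0..r}|lborel. norm (D s \<omega>))"
      "expectation (\<lambda>\<omega>. LINT s:{0..r}|lborel. norm (D s \<omega>)) = (LINT s:{0..r}|lborel. \<phi> s)"
      unfolding \<phi>_def
      by (rule fubini_process(2,3)[of "\<lambda>s \<omega>. norm (D s \<omega>)", OF nD _ _ r]; use Di \<phi>i' in simp)+
    have "\<phi> r \<le> expectation (\<lambda>\<omega>. onorm ((*v) A1) * (LINT s:{0..r}|lborel. norm (D s \<omega>)))"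
      unfolding \<phi>_def using Di[OF r] N(1) le by (intro integral_mono_AE) auto
    then show "\<phi> r \<le> onorm ((*v) A1) * (LINT s:{0..r}|lborel. \<phi> s)" using N by simp
  qed
  then have "AE \<omega> in M. norm (D t \<omega>) = 0"
    unfolding \<phi>_def using Di[OF t] by (subst (asm) integral_nonneg_eq_0_iff_AE) auto
  then show ?thesis by eventually_elim (simp add: D_def)
qed

end

section \<open>Exact controllability\<close>

lemma continuous_on_Icc_bounded:
  fixes f :: "real \<Rightarrow> 'b::real_normed_vector"
  assumes "continuous_on {a..b} f"
  obtains k where "\<And>t. t \<in> {a..b} \<Longrightarrow> norm (f t) \<le> k"
  using compact_imp_bounded[OF compact_continuous_image[OF assms compact_Icc]] unfolding bounded_iff by blast

lemma continuous_on_matrix_vector_mult: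
  fixes A :: "real ^ 'n ^ 'm"
  shows "continuous_on S f \<Longrightarrow> continuous_on S (\<lambda>t. A *v f t)"
  by (rule bounded_linear.continuous_on[OF matrix_vector_mul_bounded_linear])

context prob_space
begin

text \<open>The factor \<open>2\<close> comes from \<open>2 powr p\<close> under the root, the
  factor \<open>2 powr (1 / p)\<close> from splitting the root of a sum. The constant is harmless,
  since these norms enter only through integrability in time.\<close>

lemma Lp_norm_sum:
  fixes f g :: "'a \<Rightarrow> 'b::euclidean_space"
  assumes "f \<in> borel_measurable M" "g \<in> borel_measurable M"
    and "integrable M (\<lambda>\<omega>. norm (f \<omega>) powr p)" "integrable M (\<lambda>\<omega>. norm (g \<omega>) powr p)" and p: "0 < p"
  shows "expectation (\<lambda>\<omega>. norm (f \<omega> + g \<omega>) powr p) powr (1 / p) \<le> 2 * 2 powr (1 / p) *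
    (expectation (\<lambda>\<omega>. norm (f \<omega>) powr p) powr (1 / p) + expectation (\<lambda>\<omega>. norm (g \<omega>) powr p) powr (1 / p))"
proof -
  let ?f = "expectation (\<lambda>\<omega>. norm (f \<omega>) powr p)" and ?g = "expectation (\<lambda>\<omega>. norm (g \<omega>) powr p)"
  have "expectation (\<lambda>\<omega>. norm (f \<omega> + g \<omega>) powr p) powr (1 / p) \<le> (2 powr p * (?f + ?g)) powr (1 / p)"
    using p by (intro powr_mono2 Lp_sum(2) assms) auto
  also have "\<dots> = 2 * (?f + ?g) powr (1 / p)" using p by (simp add: powr_mult powr_powr)
  also have "\<dots> \<le> 2 * (2 powr (1 / p) * (?f powr (1 / p) + ?g powr (1 / p)))"
    using p by (intro mult_left_mono powr_add_le) auto
  finally show ?thesis by (simp add: mult.assoc)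
qed

lemma Lp_dominated:
  fixes f :: "'a \<Rightarrow> 'b::euclidean_space"
  assumes [measurable]: "f \<in> borel_measurable M" and g: "integrable M (\<lambda>\<omega>. g \<omega> powr p)"
    and le: "AE \<omega> in M. norm (f \<omega>) \<le> g \<omega>" and p: "0 < p"
  shows "integrable M (\<lambda>\<omega>. norm (f \<omega>) powr p)"
    "expectation (\<lambda>\<omega>. norm (f \<omega>) powr p) powr (1 / p) \<le> expectation (\<lambda>\<omega>. g \<omega> powr p) powr (1 / p)"
proof -
  have le': "AE \<omega> in M. norm (f \<omega>) powr p \<le> g \<omega> powr p"
    using le by eventually_elim (use p in \<open>auto intro: powr_mono2\<close>)
  show i: "integrable M (\<lambda>\<omega>. norm (f \<omega>) powr p)"
    by (rule Bochner_Integration.integrable_bound[OF g]) (use le' in auto)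
  show "expectation (\<lambda>\<omega>. norm (f \<omega>) powr p) powr (1 / p) \<le> expectation (\<lambda>\<omega>. g \<omega> powr p) powr (1 / p)"
    using p by (intro powr_mono2 integral_mono_AE i g le') auto
qed

end

section \<open>Construction of the steering control\<close>

context brownian
begin

lemma progressively_measurable_add:
  "progressively_measurable F T X \<Longrightarrow> progressively_measurable F T Y \<Longrightarrow>
    progressively_measurable F T (\<lambda>t \<omega>. X t \<omega> + Y t \<omega>)"
  unfolding progressively_measurable_def case_prod_beta' by (auto intro: borel_measurable_add)

lemma progressively_measurable_diff:
  "progressively_measurable F T X \<Longrightarrow> progressively_measurable F T Y \<Longrightarrow>
    progressively_measurable F T (\<lambda>t \<omega>. X t \<omega> - Y t \<omega>)"
  unfolding progressively_measurable_def case_prod_beta' by (auto intro: borel_measurable_diff)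

lemma progressively_measurable_matrix:
  fixes A :: "real ^ 'n ^ 'm"
  shows "progressively_measurable F T X \<Longrightarrow> progressively_measurable F T (\<lambda>t \<omega>. A *v X t \<omega>)"
  unfolding progressively_measurable_def case_prod_beta' by (auto intro: matrix_vector_measurable)

lemma progressively_measurable_deterministic:
  fixes f :: "real \<Rightarrow> 'b::euclidean_space"
  shows "continuous_on {0..T} f \<Longrightarrow> progressively_measurable F T (\<lambda>t \<omega>. f t)"
  by (rule continuous_adapted_progressive) auto

text \<open>The integral is written over the whole line with an indicator that depends on the upper
  limit, and time is clamped at \<open>r\<close>, so that the parametrised integral draws only on
  \<open>F r\<close>.\<close>

lemma progressively_measurable_integral:
  fixes g :: "real \<Rightarrow> 'a \<Rightarrow> 'b::euclidean_space"
  assumes pm: "progressively_measurable F T g"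
  shows "progressively_measurable F T (\<lambda>t \<omega>. LINT s:{0..t}|lborel. g s \<omega>)"
  unfolding progressively_measurable_def
proof
  fix r assume r: "r \<in> {0..T}"
  let ?R = "restrict_space borel {0..r} \<Otimes>\<^sub>M F r"
  let ?f = "\<lambda>x q. (if 0 \<le> q \<and> q \<le> fst x then 1 else 0) *\<^sub>R g (clamp_time r q) (snd x)"
  have gm: "(\<lambda>x. g (clamp_time r (fst x)) (snd x)) \<in> borel_measurable (lborel \<Otimes>\<^sub>M F r)"
    using progressively_measurable_clamp(1)[OF pm] r by auto
  have fst': "fst \<in> borel_measurable ?R"
    using measurable_compose[OF measurable_fst measurable_restrict_space1[of "\<lambda>x. x" borel borel "{0..r}"]] by simp
  have [measurable]: "(\<lambda>y. fst (fst y)) \<in> borel_measurable (?R \<Otimes>\<^sub>M lborel)"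
    by (rule measurable_compose[OF measurable_fst fst'])
  have [measurable]: "(\<lambda>y. snd y) \<in> borel_measurable (?R \<Otimes>\<^sub>M lborel)"
    using measurable_snd[of ?R lborel] by simp
  have "(\<lambda>y. (snd y, snd (fst y))) \<in> measurable (?R \<Otimes>\<^sub>M lborel) (lborel \<Otimes>\<^sub>M F r)"
    by (intro measurable_Pair measurable_snd measurable_compose[OF measurable_fst measurable_snd])
  from measurable_compose[OF this gm]
  have [measurable]: "(\<lambda>y. g (clamp_time r (snd y)) (snd (fst y))) \<in> borel_measurable (?R \<Otimes>\<^sub>M lborel)" by simp
  have "(\<lambda>y. ?f (fst y) (snd y)) \<in> borel_measurable (?R \<Otimes>\<^sub>M lborel)" by measurable
  then have "(\<lambda>x. LINT q|lborel. ?f x q) \<in> borel_measurable ?R"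
    by (intro lborel.borel_measurable_lebesgue_integral) (simp add: case_prod_beta')
  moreover have "(LINT q|lborel. ?f x q) = (\<lambda>(t, \<omega>). LINT s:{0..t}|lborel. g s \<omega>) x" if "x \<in> space ?R" for x
    using that unfolding set_lebesgue_integral_def
    by (auto simp: space_pair_measure space_restrict_space indicator_def intro!: Bochner_Integration.integral_cong)
  ultimately show "(\<lambda>(t, \<omega>). LINT s:{0..t}|lborel. g s \<omega>) \<in> borel_measurable ?R"
    by (rule measurable_cong[THEN iffD1, rotated])
qed

text \<open>The mean of the process constructed in \<open>steering\<close> equals \<open>m\<close>
  only on \<open>{0..T}\<close>, so the integrand is exchanged on the time interval alone.\<close>

lemma has_ito_integral_cong:
  fixes H H' :: "real \<Rightarrow> 'b::euclidean_space"
  assumes "has_ito_integral M F W t (\<lambda>s \<omega>. H s) Y" and eq: "\<And>s. s \<in> {0..t} \<Longrightarrow> H s = H' s"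
  shows "has_ito_integral M F W t (\<lambda>s \<omega>. H' s) Y"
proof -
  have "progressively_measurable F t (\<lambda>s \<omega>. H' s)"
    unfolding progressively_measurable_def
  proof
    fix r assume r: "r \<in> {0..t}"
    have "(\<lambda>(s, \<omega>). H s) \<in> borel_measurable (restrict_space borel {0..r} \<Otimes>\<^sub>M F r)"
      using assms(1) r by (auto simp: has_ito_integral_def progressively_measurable_def)
    then show "(\<lambda>(s, \<omega>). H' s) \<in> borel_measurable (restrict_space borel {0..r} \<Otimes>\<^sub>M F r)"
      by (rule measurable_cong[THEN iffD1, rotated])
        (use eq r in \<open>auto simp: space_pair_measure space_restrict_space\<close>)
  qed
  moreover have "(\<integral>\<^sup>+s\<in>{0..t}. ennreal ((norm (S s - H s))\<^sup>2) \<partial>lborel) = (\<integral>\<^sup>+s\<in>{0..t}. ennreal ((norm (S s - H' s))\<^sup>2) \<partial>lborel)" for S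
    using eq by (intro nn_integral_cong) (auto split: split_indicator)
  ultimately show ?thesis using assms(1) unfolding has_ito_integral_def by simp
qed

text \<open>No equation is solved for \<open>X\<close>: the deviation \<open>Y\<close> is prescribed
  as the time integral of \<open>g\<close> plus the noise, and the control is read off from it.
  Since \<open>B1 ** R\<close> is the identity, the feedback cancels \<open>A1 *v Y\<close>; since
  \<open>g\<close> and \<open>Y\<close> have mean zero, \<open>u\<close> has mean \<open>v\<close>
  and the equation for \<open>m\<close> is undisturbed.\<close>

lemma steering:
  fixes A1 A2 C :: "real ^ 'd ^ 'd" and B1 B2 :: "real ^ 'n ^ 'd" and R :: "real ^ 'd ^ 'n"
  assumes T: "0 < T" and p: "1 < p" and \<xi>: "\<xi> \<in> Lp_rv M (F T) p" and R: "B1 ** R = mat 1"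
    and v: "continuous_on {0..T} v" and m0: "m 0 = x" and mT: "m T = expectation \<xi>"
    and m: "\<And>t. t \<in> {0..T} \<Longrightarrow>
      (m has_vector_derivative ((A1 + A2) *v m t + (B1 + B2) *v v t)) (at t within {0..T})"
  shows "\<exists>u\<in>controls_r M F T B1 B2 p. \<exists>X. is_solution M F W T A1 A2 B1 B2 C p x u X \<and> (AE \<omega> in M. X T \<omega> = \<xi> \<omega>)"
proof -
  have p0: "0 < p" "1 \<le> p" and T0: "0 \<le> T" "T \<in> {0..T}" using p T by auto
  have cm: "continuous_on {0..T} m"
    using has_vector_derivative_continuous[OF m] by (simp add: continuous_on_eq_continuous_within)
  define m' where "m' t = (A1 + A2) *v m t + (B1 + B2) *v v t" for t
  have cm': "continuous_on {0..T} m'"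
    unfolding m'_def by (intro continuous_on_add continuous_on_matrix_vector_mult cm v)
  define H where "H t = C *v m t" for t
  define H' where "H' t = C *v m' t" for t
  have dH: "(H has_vector_derivative H' t) (at t within {0..T})" if "t \<in> {0..T}" for t
    unfolding H_def[abs_def] H'_def m'_def
    by (rule bounded_linear.has_vector_derivative[OF matrix_vector_mul_bounded_linear m[OF that]])
  have cH': "continuous_on {0..T} H'"
    unfolding H'_def by (intro continuous_on_matrix_vector_mult cm')
  obtain K where K: "\<And>t. t \<in> {0..T} \<Longrightarrow> norm (H' t) \<le> K" using continuous_on_Icc_bounded[OF cH'] by blast
  have K0: "0 \<le> K" using K[OF T0(2)] norm_ge_zero order_trans by blast
  \<comment> \<open>The noise depends only on \<open>m\<close>, so it is fixed before
    \<open>g\<close> is chosen and the choice of \<open>g\<close> involves no circularity.\<close>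
  define Z where "Z = wiener H H'"
  define kz where "kz = norm (H 0) + 2 * K * T"
  have kz0: "0 \<le> kz" unfolding kz_def using K0 T0 by simp
  have Zle: "norm (Z t \<omega>) \<le> kz * sup_V T \<omega>" if "\<omega> \<in> space M" "t \<in> {0..T}" for t \<omega>
    unfolding Z_def kz_def by (rule norm_wiener_le[OF dH cH' K that])
  have ZF: "Z t \<in> borel_measurable (F t)" if "t \<in> {0..T}" for t
    unfolding Z_def by (rule wiener_adapted[OF dH cH' K that])
  have Zc: "continuous_on {0..T} (\<lambda>t. Z t \<omega>)" if "\<omega> \<in> space M" for \<omega>
    unfolding Z_def by (rule continuous_wiener[OF dH cH' K that])
  have Zito: "has_ito_integral M F W t (\<lambda>s \<omega>. H s) (Z t)" if "t \<in> {0..T}" for t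
    unfolding Z_def by (rule wiener_has_ito_integral[OF dH cH' K that])
  have Zpm: "progressively_measurable F T Z" by (rule continuous_adapted_progressive[OF ZF Zc])
  have supp: "integrable M (\<lambda>\<omega>. norm (kz * sup_V T \<omega>) powr p)"
  proof -
    have "integrable M (\<lambda>\<omega>. kz powr p * sup_V T \<omega> powr p)" using sup_V_powr[OF T0(1) p0(1)] by simp
    moreover have "kz powr p * sup_V T \<omega> powr p = norm (kz * sup_V T \<omega>) powr p" if "\<omega> \<in> space M" for \<omega>
      using kz0 sup_V_nonneg[OF that T0(1)] by (simp add: powr_mult abs_mult)
    ultimately show ?thesis by (subst Bochner_Integration.integrable_cong[OF refl, of M _ "\<lambda>\<omega>. kz powr p * sup_V T \<omega> powr p"]) simp_all
  qed
  have ZM: "Z t \<in> borel_measurable M" if "t \<in> {0..T}" for t by (rule measurable_F[OF ZF[OF that]])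

  have \<xi>F: "\<xi> \<in> borel_measurable (F T)" and \<xi>p: "integrable M (\<lambda>\<omega>. norm (\<xi> \<omega>) powr p)" using \<xi> by (auto simp: Lp_rv_def)
  have \<xi>M[measurable]: "\<xi> \<in> borel_measurable M" by (rule measurable_F[OF \<xi>F])
  have \<xi>i: "integrable M \<xi>" by (rule integrable_Lp[OF \<xi>M \<xi>p p0(2)])
  \<comment> \<open>What the time integral of \<open>g\<close> has to supply at \<open>T\<close>
    once the mean and the noise are in place. It has mean zero, as \<open>Lp_representation\<close>
    demands.\<close>
  define \<zeta> where "\<zeta> \<omega> = \<xi> \<omega> - expectation \<xi> - Z T \<omega>" for \<omega>
  have ZTp: "integrable M (\<lambda>\<omega>. norm (Z T \<omega>) powr p)"
    using supp Zle[OF _ T0(2)] kz0 by (intro Lp_dominated(1)[OF ZM[OF T0(2)] _ _ p0(1), of "\<lambda>\<omega>. norm (kz * sup_V T \<omega>)"])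
      (auto intro!: AE_I2 intro: order_trans[OF _ abs_ge_self])
  have \<zeta>F: "\<zeta> \<in> borel_measurable (F T)" unfolding \<zeta>_def[abs_def] using \<xi>F ZF[OF T0(2)] by auto
  have \<zeta>p: "integrable M (\<lambda>\<omega>. norm (\<zeta> \<omega>) powr p)"
  proof -
    have "integrable M (\<lambda>\<omega>. norm (\<xi> \<omega> - expectation \<xi>) powr p)" by (rule Lp_diff(1)[OF _ _ \<xi>p _ p0(1)]) auto
    then show ?thesis unfolding \<zeta>_def using ZM[OF T0(2)] by (intro Lp_diff(1)[OF _ _ _ ZTp p0(1)]) auto
  qed
  have \<zeta>0: "expectation \<zeta> = 0"
    unfolding \<zeta>_def[abs_def] using \<xi>i ito_integral_mean[OF Zito[OF T0(2)]] by (simp add: prob_space)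
  obtain g where gpm: "progressively_measurable F T g"
    and gp: "\<And>s. integrable M (\<lambda>\<omega>. norm (g s \<omega>) powr p)" and gi: "\<And>s. integrable M (g s)" and g0: "\<And>s. expectation (g s) = 0"
    and gn: "set_integrable lborel {0..T} (\<lambda>s. (LINT \<omega>|M. norm (g s \<omega>) powr p) powr (1 / p))"
    and g\<zeta>: "AE \<omega> in M. set_integrable lborel {0..T} (\<lambda>s. g s \<omega>) \<and> (LINT s:{0..T}|lborel. g s \<omega>) = \<zeta> \<omega>"
    by (rule Lp_representation[OF T p \<zeta>F \<zeta>p \<zeta>0]) blast
  have [measurable]: "g s \<in> borel_measurable M" for s by (rule borel_measurable_integrable[OF gi])
  have gc[measurable]: "(\<lambda>x. g (clamp_time T (fst x)) (snd x)) \<in> borel_measurable (lborel \<Otimes>\<^sub>M M)"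
    using progressively_measurable_clamp[OF gpm] T by auto

  define G where "G t \<omega> = (LINT s:{0..t}|lborel. g s \<omega>)" for t \<omega>
  define Y where "Y t \<omega> = G t \<omega> + Z t \<omega>" for t \<omega>
  define X where "X t \<omega> = m t + Y t \<omega>" for t \<omega>
  define u where "u t \<omega> = v t + R *v (g t \<omega> - A1 *v Y t \<omega>)" for t \<omega>
  have Ypm: "progressively_measurable F T Y"
    unfolding Y_def G_def by (intro progressively_measurable_add progressively_measurable_integral gpm Zpm)
  have Xpm: "progressively_measurable F T X"
    unfolding X_def by (intro progressively_measurable_add progressively_measurable_deterministic cm Ypm)
  have upm: "progressively_measurable F T u"
    unfolding u_def by (intro progressively_measurable_add progressively_measurable_deterministic
        progressively_measurable_matrix progressively_measurable_diff v gpm Ypm)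
  have YM: "Y t \<in> borel_measurable M" if "t \<in> {0..T}" for t
    by (rule measurable_F[OF progressively_measurable_section[OF Ypm that]])

  define S0 where "S0 \<omega> = (LINT s:{0..T}|lborel. norm (g s \<omega>))" for \<omega>
  \<comment> \<open>Dominates \<open>norm (Y t \<omega>)\<close> for all \<open>t\<close> at once,
    almost surely. Its \<open>p\<close>-th moment is finite by Minkowski's inequality and the
    moments of \<open>sup_V T\<close>; it serves the supremum condition on \<open>X\<close> and the
    feedback part of \<open>u\<close>.\<close>
  define S where "S \<omega> = S0 \<omega> + kz * sup_V T \<omega>" for \<omega>
  have S0eq: "S0 \<omega> = (LINT s:{0..T}|lborel. norm (g (clamp_time T s) \<omega>))" for \<omega>
    unfolding S0_def by (intro set_lebesgue_integral_cong) auto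
  have S0p: "integrable M (\<lambda>\<omega>. S0 \<omega> powr p)"
    unfolding S0eq
  proof (rule minkowski_integral_finite(2)[OF _ _ p T])
    show "set_integrable lborel {0..T} (\<lambda>s. (LINT \<omega>|M. norm (g (clamp_time T s) \<omega>) powr p) powr (1 / p))"
      using gn by (subst set_integrable_cong[OF refl refl, of _ _ "\<lambda>s. (LINT \<omega>|M. norm (g s \<omega>) powr p) powr (1 / p)"]) simp_all
  qed (use gp in auto)
  have S00: "0 \<le> S0 \<omega>" for \<omega> unfolding S0_def set_lebesgue_integral_def by (intro integral_nonneg_AE) auto
  have S0M[measurable]: "S0 \<in> borel_measurable M"
  proof -
    have "(\<lambda>y. norm (g (clamp_time T (snd y)) (fst y))) \<in> borel_measurable (M \<Otimes>\<^sub>M lborel)"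
      using measurable_compose[OF measurable_pair_swap' gc] by (simp add: case_prod_beta')
    then show ?thesis
      unfolding S0eq[abs_def] set_lebesgue_integral_def
      by (intro lborel.borel_measurable_lebesgue_integral) (simp add: case_prod_beta')
  qed
  note [measurable] = sup_V_measurable[OF T0(1)]
  have SM[measurable]: "S \<in> borel_measurable M" unfolding S_def[abs_def] by measurable
  have S_nonneg: "0 \<le> S \<omega>" if "\<omega> \<in> space M" for \<omega>
    unfolding S_def using S00[of \<omega>] kz0 sup_V_nonneg[OF that T0(1)] by simp
  have Sp': "integrable M (\<lambda>\<omega>. norm (S \<omega>) powr p)"
    unfolding S_def by (rule Lp_sum(1)[OF _ _ _ supp p0(1)]) (use S0p S00 in \<open>simp_all add: S0M\<close>)
  have Sp: "integrable M (\<lambda>\<omega>. (c * S \<omega>) powr p)" if "0 \<le> c" for c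
  proof -
    have "integrable M (\<lambda>\<omega>. c powr p * norm (S \<omega>) powr p)" using Sp' by simp
    then show ?thesis
      by (subst Bochner_Integration.integrable_cong[OF refl, of M _ "\<lambda>\<omega>. c powr p * norm (S \<omega>) powr p"])
        (use S_nonneg that in \<open>simp_all add: powr_mult\<close>)
  qed
  have YS: "AE \<omega> in M. \<forall>t\<in>{0..T}. norm (Y t \<omega>) \<le> S \<omega>"
    using g\<zeta> AE_space
  proof eventually_elim
    case (elim \<omega>)
    then have i: "set_integrable lborel {0..T} (\<lambda>s. g s \<omega>)" by simp
    show ?case
    proof
      fix t assume t: "t \<in> {0..T}"
      have it: "set_integrable lborel {0..t} (\<lambda>s. g s \<omega>)" by (rule set_integrable_subset[OF i]) (use t in auto)
      have "norm (G t \<omega>) \<le> (LINT s:{0..t}|lborel. norm (g s \<omega>))" unfolding G_def by (rule set_integral_norm_bound[OF it])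
      also have "\<dots> \<le> S0 \<omega>"
        unfolding S0_def set_lebesgue_integral_def
      proof (rule integral_mono)
        show "integrable lborel (\<lambda>s. indicator {0..t} s *\<^sub>R norm (g s \<omega>))" "integrable lborel (\<lambda>s. indicator {0..T} s *\<^sub>R norm (g s \<omega>))"
          using set_integrable_norm[OF it] set_integrable_norm[OF i] unfolding set_integrable_def by auto
      qed (use t in \<open>auto simp: indicator_def\<close>)
      finally show "norm (Y t \<omega>) \<le> S \<omega>"
        unfolding Y_def S_def using Zle[OF elim(2) t] norm_triangle_ineq[of "G t \<omega>" "Z t \<omega>"] by linarith
    qed
  qed
  have YSt: "AE \<omega> in M. norm (Y t \<omega>) \<le> 1 * S \<omega>" if "t \<in> {0..T}" for t using YS by eventually_elim (use that in auto)
  have Yi: "integrable M (Y t)" if t: "t \<in> {0..T}" for t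
    by (rule integrable_Lp[OF YM[OF t] Lp_dominated(1)[OF YM[OF t] Sp YSt[OF t] p0(1)] p0(2)]) simp
  \<comment> \<open>The \<open>L^1\<close> norms are at most twice the \<open>L^p\<close> norms.
    This licenses Fubini, by which the time integrals \<open>G t\<close> have mean zero.\<close>
  have gint: "set_integrable lborel {0..T} (\<lambda>s. expectation (\<lambda>\<omega>. norm (g s \<omega>)))"
    unfolding set_integrable_def
  proof (rule Bochner_Integration.integrable_bound)
    let ?b = "\<lambda>s. indicator {0..T} s *\<^sub>R (2 * (LINT \<omega>|M. norm (g s \<omega>) powr p) powr (1 / p))"
    show "integrable lborel ?b"
      using set_integrable_mult_right[OF gn, of 2] unfolding set_integrable_def by simp
    have "(\<lambda>s. expectation (\<lambda>\<omega>. norm (g (clamp_time T s) \<omega>))) \<in> borel_measurable lborel"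
      by (measurable; simp add: case_prod_beta')
    then have "(\<lambda>s. indicator {0..T} s *\<^sub>R expectation (\<lambda>\<omega>. norm (g (clamp_time T s) \<omega>))) \<in> borel_measurable lborel" by measurable
    moreover have "indicator {0..T} s *\<^sub>R expectation (\<lambda>\<omega>. norm (g (clamp_time T s) \<omega>)) = indicator {0..T} s *\<^sub>R expectation (\<lambda>\<omega>. norm (g s \<omega>))" for s
      by (auto simp: indicator_def)
    ultimately show "(\<lambda>s. indicator {0..T} s *\<^sub>R expectation (\<lambda>\<omega>. norm (g s \<omega>))) \<in> borel_measurable lborel" by (simp only:)
    show "AE s in lborel. norm (indicator {0..T} s *\<^sub>R expectation (\<lambda>\<omega>. norm (g s \<omega>))) \<le> norm (?b s)"
      using expectation_norm_le_Lp_norm[OF _ gp p0(2)] by (intro AE_I2) (auto simp: indicator_def)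
  qed
  have Y0: "expectation (Y t) = 0" if t: "t \<in> {0..T}" for t
  proof -
    have "integrable M (G t)" "expectation (G t) = 0"
      unfolding G_def[abs_def] using fubini_process(2,3)[OF gc _ gint t] gi g0 by (auto simp: set_lebesgue_integral_def)
    then show ?thesis
      unfolding Y_def[abs_def] using ito_integral_mean[OF Zito[OF t]] by simp
  qed
  have Xm: "expectation (X t) = m t" if t: "t \<in> {0..T}" for t
    unfolding X_def[abs_def] using Yi[OF t] Y0[OF t] by (simp add: prob_space)
  have AYi: "integrable M (\<lambda>\<omega>. g t \<omega> - A1 *v Y t \<omega>)" "expectation (\<lambda>\<omega>. g t \<omega> - A1 *v Y t \<omega>) = 0" if t: "t \<in> {0..T}" for t
    using integrable_bounded_linear[OF matrix_vector_mul_bounded_linear Yi[OF t], of A1]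
      integral_bounded_linear[OF matrix_vector_mul_bounded_linear Yi[OF t], of A1] gi[of t] g0[of t] Y0[OF t] by auto
  have ui: "integrable M (u t)" and um: "expectation (u t) = v t" if t: "t \<in> {0..T}" for t
    unfolding u_def[abs_def]
    using integrable_bounded_linear[OF matrix_vector_mul_bounded_linear AYi(1)[OF t], of R]
      integral_bounded_linear[OF matrix_vector_mul_bounded_linear AYi(1)[OF t], of R] AYi(2)[OF t]
    by (auto simp: prob_space)
  have B1u: "B1 *v u t \<omega> = B1 *v v t + (g t \<omega> - A1 *v Y t \<omega>)" for t \<omega>
    by (simp add: u_def matrix_vector_right_distrib matrix_vector_mul_assoc R)

  define N where "N f = expectation (\<lambda>\<omega>. norm (f \<omega>) powr p) powr (1 / p)" for f :: "'a \<Rightarrow> real ^ 'd"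
  define c where "c = 2 * 2 powr (1 / p)"
  have c0: "0 \<le> c" by (simp add: c_def)
  define a where "a = onorm ((*v) A1)"
  have a0: "0 \<le> a" unfolding a_def by (rule onorm_matrix_nonneg)
  define s0 where "s0 = expectation (\<lambda>\<omega>. (a * S \<omega>) powr p) powr (1 / p)"
  have B1up: "integrable M (\<lambda>\<omega>. norm (B1 *v u t \<omega>) powr p)"
    "N (\<lambda>\<omega>. B1 *v u t \<omega>) \<le> c * (norm (B1 *v v t) + c * (N (g t) + s0))" if t: "t \<in> {0..T}" for t
  proof -
    have AYm: "(\<lambda>\<omega>. - (A1 *v Y t \<omega>)) \<in> borel_measurable M" using YM[OF t] by measurable
    have ae: "AE \<omega> in M. norm (- (A1 *v Y t \<omega>)) \<le> a * S \<omega>"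
      using YSt[OF t]
    proof eventually_elim
      case (elim \<omega>)
      have "norm (A1 *v Y t \<omega>) \<le> a * norm (Y t \<omega>)" unfolding a_def by (rule norm_matrix_vector_le)
      also have "\<dots> \<le> a * S \<omega>" using elim a0 by (intro mult_left_mono) auto
      finally show ?case by simp
    qed
    note AY = Lp_dominated[OF AYm Sp[OF a0] ae p0(1)]
    have gAYm: "(\<lambda>\<omega>. g t \<omega> + - (A1 *v Y t \<omega>)) \<in> borel_measurable M" using AYm by (intro borel_measurable_add) auto
    have gAY: "integrable M (\<lambda>\<omega>. norm (g t \<omega> + - (A1 *v Y t \<omega>)) powr p)"
      by (rule Lp_sum(1)[OF _ AYm gp AY(1) p0(1)]) measurable
    have n1: "N (\<lambda>\<omega>. g t \<omega> + - (A1 *v Y t \<omega>)) \<le> c * (N (g t) + s0)"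
    proof -
      have "N (\<lambda>\<omega>. g t \<omega> + - (A1 *v Y t \<omega>)) \<le> c * (N (g t) + N (\<lambda>\<omega>. - (A1 *v Y t \<omega>)))"
        unfolding N_def c_def by (rule Lp_norm_sum[OF _ AYm gp AY(1) p0(1)]) measurable
      also have "\<dots> \<le> c * (N (g t) + s0)"
        using AY(2) c0 by (intro mult_left_mono add_left_mono) (auto simp: N_def s0_def)
      finally show ?thesis .
    qed
    have cp: "integrable M (\<lambda>\<omega>::'a. norm (B1 *v v t) powr p)" by simp
    have eq: "B1 *v u t \<omega> = B1 *v v t + (g t \<omega> + - (A1 *v Y t \<omega>))" for \<omega> by (simp add: B1u)
    show "integrable M (\<lambda>\<omega>. norm (B1 *v u t \<omega>) powr p)"
      unfolding eq by (rule Lp_sum(1)[OF _ gAYm cp gAY p0(1)]) measurable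
    have "N (\<lambda>\<omega>. B1 *v u t \<omega>) \<le> c * (N (\<lambda>\<omega>. B1 *v v t) + N (\<lambda>\<omega>. g t \<omega> + - (A1 *v Y t \<omega>)))"
      unfolding N_def c_def eq by (rule Lp_norm_sum[OF _ gAYm cp gAY p0(1)]) measurable
    also have "N (\<lambda>\<omega>. B1 *v v t) = norm (B1 *v v t)" using p0 by (simp add: N_def prob_space powr_powr)
    also have "c * (norm (B1 *v v t) + N (\<lambda>\<omega>. g t \<omega> + - (A1 *v Y t \<omega>))) \<le> c * (norm (B1 *v v t) + c * (N (g t) + s0))"
      using n1 c0 by (intro mult_left_mono add_left_mono) auto
    finally show "N (\<lambda>\<omega>. B1 *v u t \<omega>) \<le> c * (norm (B1 *v v t) + c * (N (g t) + s0))" .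
  qed
  have u_norms: "set_integrable lborel {0..T} (\<lambda>t. N (\<lambda>\<omega>. B1 *v u t \<omega>))"
    unfolding set_integrable_def
  proof (rule Bochner_Integration.integrable_bound)
    let ?b = "\<lambda>t. c * (norm (B1 *v v t) + c * (N (g t) + s0))"
    have "set_integrable lborel {0..T} ?b"
    proof (intro set_integrable_mult_right set_integral_add(1))
      show "set_integrable lborel {0..T} (\<lambda>t. norm (B1 *v v t))"
        by (intro borel_integrable_atLeastAtMost' continuous_on_norm continuous_on_matrix_vector_mult v)
      show "set_integrable lborel {0..T} (\<lambda>t. N (g t))" using gn unfolding N_def .
      show "set_integrable lborel {0..T} (\<lambda>t. s0)" by (intro borel_integrable_atLeastAtMost' continuous_on_const)
    qed
    then show "integrable lborel (\<lambda>t. indicator {0..T} t *\<^sub>R ?b t)" unfolding set_integrable_def .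
    have [measurable]: "(\<lambda>x. u (clamp_time T (fst x)) (snd x)) \<in> borel_measurable (lborel \<Otimes>\<^sub>M M)"
      using progressively_measurable_clamp[OF upm] T by auto
    have "(\<lambda>t. N (\<lambda>\<omega>. B1 *v u (clamp_time T t) \<omega>)) \<in> borel_measurable lborel"
      unfolding N_def by (measurable; simp add: case_prod_beta')
    then have "(\<lambda>t. indicator {0..T} t *\<^sub>R N (\<lambda>\<omega>. B1 *v u (clamp_time T t) \<omega>)) \<in> borel_measurable lborel" by measurable
    moreover have "indicator {0..T} t *\<^sub>R N (\<lambda>\<omega>. B1 *v u (clamp_time T t) \<omega>) = indicator {0..T} t *\<^sub>R N (\<lambda>\<omega>. B1 *v u t \<omega>)" for t
      by (auto simp: indicator_def)
    ultimately show "(\<lambda>t. indicator {0..T} t *\<^sub>R N (\<lambda>\<omega>. B1 *v u t \<omega>)) \<in> borel_measurable lborel" by (simp only:)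
    have N0: "0 \<le> N f" for f by (simp add: N_def)
    show "AE t in lborel. norm (indicator {0..T} t *\<^sub>R N (\<lambda>\<omega>. B1 *v u t \<omega>)) \<le> norm (indicator {0..T} t *\<^sub>R ?b t)"
      using B1up(2) N0 by (intro AE_I2) (auto simp: indicator_def intro: order_trans[OF _ abs_ge_self])
  qed
  have u_ctrl: "u \<in> controls_r M F T B1 B2 p"
    unfolding controls_r_def
  proof (intro CollectI conjI)
    show "AE t in lborel. t \<in> {0..T} \<longrightarrow> integrable M (u t)" using ui by (intro AE_I2) auto
    show "AE t in lborel. t \<in> {0..T} \<longrightarrow> integrable M (\<lambda>\<omega>. norm (B1 *v u t \<omega>) powr p)" using B1up(1) by (intro AE_I2) auto
    show "set_integrable lborel {0..T} (\<lambda>t. expectation (\<lambda>\<omega>. norm (B1 *v u t \<omega>) powr p) powr (1 / p))"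
      using u_norms unfolding N_def .
    have "set_integrable lborel {0..T} (\<lambda>t. norm (B2 *v v t))"
      by (intro borel_integrable_atLeastAtMost' continuous_on_norm continuous_on_matrix_vector_mult v)
    then show "set_integrable lborel {0..T} (\<lambda>t. norm (B2 *v expectation (u t)))"
      by (subst set_integrable_cong[OF refl refl, of _ _ "\<lambda>t. norm (B2 *v v t)"]) (simp_all add: um)
  qed (rule upm)

  \<comment> \<open>\<open>A1 *v Y\<close> from the state cancels against the feedback, while
    \<open>A2\<close> and \<open>B2\<close> meet only the means \<open>m\<close> and
    \<open>v\<close>.\<close>
  have drift: "drift M A1 A2 B1 B2 u X s \<omega> = m' s + g s \<omega>" if s: "s \<in> {0..T}" for s \<omega>
    unfolding drift_def Xm[OF s] um[OF s] B1u
    by (simp add: X_def m'_def matrix_vector_right_distrib matrix_vector_mult_add_rdistrib algebra_simps)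
  have m'i: "set_integrable lborel {0..t} m'" if "t \<in> {0..T}" for t
    by (rule borel_integrable_atLeastAtMost', rule continuous_on_subset[OF cm']) (use that in auto)
  have Xeq: "AE \<omega> in M. X t \<omega> = x + (LINT s:{0..t}|lborel. drift M A1 A2 B1 B2 u X s \<omega>) + Z t \<omega>" if t: "t \<in> {0..T}" for t
    using g\<zeta>
  proof eventually_elim
    case (elim \<omega>)
    have it: "set_integrable lborel {0..t} (\<lambda>s. g s \<omega>)" by (rule set_integrable_subset[of _ "{0..T}"]) (use elim t in auto)
    have "(LINT s:{0..t}|lborel. drift M A1 A2 B1 B2 u X s \<omega>) = (LINT s:{0..t}|lborel. m' s + g s \<omega>)"
      using t by (intro set_lebesgue_integral_cong) (auto simp: drift)
    also have "\<dots> = (LINT s:{0..t}|lborel. m' s) + G t \<omega>"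
      unfolding G_def by (rule set_integral_add(2)[OF m'i[OF t] it])
    also have "(LINT s:{0..t}|lborel. m' s) = m t - m 0"
      unfolding set_lebesgue_integral_def
    proof (rule integral_FTC_atLeastAtMost)
      show "(m has_vector_derivative m' s) (at s within {0..t})" if "0 \<le> s" "s \<le> t" for s
        unfolding m'_def by (rule has_vector_derivative_within_subset[OF m]) (use that t in auto)
    qed (use t in \<open>auto intro: continuous_on_subset[OF cm']\<close>)
    finally have "(LINT s:{0..t}|lborel. drift M A1 A2 B1 B2 u X s \<omega>) = m t - m 0 + G t \<omega>" .
    moreover have "X t \<omega> = m t + (G t \<omega> + Z t \<omega>)" by (simp only: X_def Y_def)
    ultimately show ?case by (simp only: m0) simp
  qed
  obtain km where km: "\<And>t. t \<in> {0..T} \<Longrightarrow> norm (m t) \<le> km" using continuous_on_Icc_bounded[OF cm] by blast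
  have km0: "0 \<le> km" using km[OF T0(2)] norm_ge_zero order_trans by blast
  have "is_solution M F W T A1 A2 B1 B2 C p x u X"
    unfolding is_solution_def
  proof (intro conjI ballI)
    show "progressively_measurable F T X" by (rule Xpm)
    show "AE \<omega> in M. continuous_on {0..T} (\<lambda>t. X t \<omega>)"
      using g\<zeta> AE_space
    proof eventually_elim
      case (elim \<omega>)
      have i: "set_integrable lborel {0..T} (\<lambda>s. g s \<omega>)" using elim by simp
      have Geq: "G t \<omega> = integral {0..t} (\<lambda>s. g s \<omega>)" if "t \<in> {0..T}" for t
        unfolding G_def
        by (rule set_borel_integral_eq_integral(2), rule set_integrable_subset[OF i]) (use that in auto)
      have "continuous_on {0..T} (\<lambda>t. integral {0..t} (\<lambda>s. g s \<omega>))"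
        by (rule indefinite_integral_continuous_1[OF set_borel_integral_eq_integral(1)[OF i]])
      then have "continuous_on {0..T} (\<lambda>t. G t \<omega>)"
        by (rule continuous_on_eq) (simp add: Geq)
      then show ?case
        unfolding X_def Y_def using Zc[OF elim(2)] cm by (intro continuous_on_add)
    qed
    have sup: "AE \<omega> in M. (SUP t\<in>{0..T}. ennreal (norm (X t \<omega>) powr p)) \<le> ennreal (norm (norm km + S \<omega>) powr p)"
      using YS AE_space
    proof eventually_elim
      case (elim \<omega>)
      show ?case
      proof (rule SUP_least)
        fix t assume t: "t \<in> {0..T}"
        have "norm (X t \<omega>) \<le> norm (m t) + norm (Y t \<omega>)" unfolding X_def by (rule norm_triangle_ineq)
        also have "\<dots> \<le> norm (norm km + S \<omega>)" using km[OF t] elim(1) t S_nonneg[OF elim(2)] km0 by force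
        finally show "ennreal (norm (X t \<omega>) powr p) \<le> ennreal (norm (norm km + S \<omega>) powr p)"
          using p0 by (intro ennreal_leI powr_mono2) auto
      qed
    qed
    have "integrable M (\<lambda>\<omega>. norm (norm km + S \<omega>) powr p)"
      by (rule Lp_sum(1)[OF _ _ _ Sp' p0(1)]) auto
    then have "(\<integral>\<^sup>+\<omega>. ennreal (norm (norm km + S \<omega>) powr p) \<partial>M) < \<infinity>"
      by (subst nn_integral_eq_integral) auto
    with nn_integral_mono_AE[OF sup]
    show "(\<integral>\<^sup>+\<omega>. (SUP t\<in>{0..T}. ennreal (norm (X t \<omega>) powr p)) \<partial>M) < \<infinity>" by (rule le_less_trans)
    show "AE \<omega> in M. set_integrable lborel {0..T} (\<lambda>s. drift M A1 A2 B1 B2 u X s \<omega>)"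
      using g\<zeta>
    proof eventually_elim
      case (elim \<omega>)
      then have "set_integrable lborel {0..T} (\<lambda>s. m' s + g s \<omega>)" by (intro set_integral_add(1) m'i T0(2)) simp
      then show ?case by (subst set_integrable_cong[OF refl refl, of _ _ "\<lambda>s. m' s + g s \<omega>"]) (simp_all add: drift)
    qed
    fix t assume t: "t \<in> {0..T}"
    have "has_ito_integral M F W t (\<lambda>s \<omega>. C *v expectation (X s)) (Z t)"
      by (rule has_ito_integral_cong[OF Zito[OF t]]) (use t in \<open>simp add: H_def Xm\<close>)
    with Xeq[OF t]
    show "\<exists>Y. has_ito_integral M F W t (\<lambda>s \<omega>. C *v expectation (X s)) Y \<and>
        (AE \<omega> in M. X t \<omega> = x + (LINT s:{0..t}|lborel. drift M A1 A2 B1 B2 u X s \<omega>) + Y \<omega>)" by blast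
  qed
  moreover have "AE \<omega> in M. X T \<omega> = \<xi> \<omega>"
    using g\<zeta> by eventually_elim (simp add: X_def Y_def G_def mT \<zeta>_def)
  ultimately show ?thesis using u_ctrl by blast
qed

end

theorem theorem4p1:
  fixes M :: "'a measure" and W :: "real \<Rightarrow> 'a \<Rightarrow> real" and T p :: real
    and A1 A2 C :: "real ^ 'd ^ 'd" and B1 B2 :: "real ^ 'n ^ 'd"
  assumes "prob_space M" and "standard_brownian_motion M W" and "T > 0" and "p > 1"
    and "rank B1 = CARD('d)"
    and "invertible (integral {0..T} (\<lambda>t.
           matrix_exp ((- t) *\<^sub>R (A1 + A2)) ** (B1 + B2) ** transpose (B1 + B2)
             ** transpose (matrix_exp ((- t) *\<^sub>R (A1 + A2)))))"
  shows "controls_r M (augmented_filtration M W) T B1 B2 p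
           \<subseteq> controls M (augmented_filtration M W) T B1 B2 p
         \<and> exactly_controllable M (augmented_filtration M W) W T A1 A2 B1 B2 C p
             (Lp_rv M (augmented_filtration M W T) p)
             (controls_r M (augmented_filtration M W) T B1 B2 p)"
proof -
  interpret brownian M W
    using assms(1,2) by (simp add: brownian_def brownian_axioms_def)
  \<comment> \<open>Full row rank makes \<open>B1\<close> surjective, hence right
    invertible.\<close>
  obtain R where R: "B1 ** R = mat 1"
    using assms(5) full_rank_surjective[of B1] matrix_right_invertible_surjective[of B1] by auto
  have "exactly_controllable M F W T A1 A2 B1 B2 C p (Lp_rv M (F T) p) (controls_r M F T B1 B2 p)"
    unfolding exactly_controllable_def
  proof (intro allI ballI)
    fix x :: "real ^ 'd" and \<xi> :: "'a \<Rightarrow> real ^ 'd" assume \<xi>: "\<xi> \<in> Lp_rv M (F T) p"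
    obtain v m where vm: "continuous_on UNIV v" "m 0 = x" "m T = expectation \<xi>"
      "\<And>t. t \<in> {0..T} \<Longrightarrow> (m has_vector_derivative ((A1 + A2) *v m t + (B1 + B2) *v v t)) (at t within {0..T})"
      using deterministic_controllability[OF assms(3,6)] by blast
    obtain u X where uX: "u \<in> controls_r M F T B1 B2 p" "is_solution M F W T A1 A2 B1 B2 C p x u X" "AE \<omega> in M. X T \<omega> = \<xi> \<omega>"
      using steering[OF assms(3,4) \<xi> R continuous_on_subset[OF vm(1)] vm(2,3,4)] by blast
    have "AE \<omega> in M. X' T \<omega> = \<xi> \<omega>" if X': "is_solution M F W T A1 A2 B1 B2 C p x u X'" for X'
    proof -
      have "AE \<omega> in M. X' T \<omega> = X T \<omega>"
        using assms(3,4) by (intro solution_unique[OF X' uX(2)]) auto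
      with uX(3) show ?thesis by eventually_elim simp
    qed
    with uX show "\<exists>u\<in>controls_r M F T B1 B2 p. (\<exists>X. is_solution M F W T A1 A2 B1 B2 C p x u X) \<and>
        (\<forall>X. is_solution M F W T A1 A2 B1 B2 C p x u X \<longrightarrow> (AE \<omega> in M. X T \<omega> = \<xi> \<omega>))"
      by blast
  qed
  with controls_r_subset_controls[OF assms(3,4)] show ?thesis by blast
qed

end
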